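(* Let $\Sigma\subset\mathbb{R}^2$ be a domain, $f\colon\Sigma\to\mathbb{R}^3$ a front and $p\in\Sigma$ a non-degenerate singular point of $f$. Suppose that the Gaussian curvature $K$ of $f$ is bounded on a sufficiently small neighborhood $U$ of $p$. (1) When $p$ is a cuspidal edge, $p$ is a sub-parabolic point of $f$ if and only if $K(p)=0$. (2) When $p$ is of the second kind, $p$ is a sub-parabolic point of $f$.
   Context: Fronts. A $C^\infty$ map $f\colon\Sigma\to\mathbb{R}^3$ ($\Sigma\subset\mathbb{R}^2$ a domain) is a frontal if there is a $C^\infty$ map $\nu\colon\Sigma\to S^2$ (unit normal, Gauss map) with $\langle df_q(X),\nu(q)\rangle=0$ for all $q\in\Sigma$, $X\in T_q\Sigma$; it is a front if moreover $(f,\nu)\colon\Sigma\to\mathbb{R}^3\times S^2$ is an immersion. $S(f)$ is the set of points where $f$ is not an immersion, and $\lambda=\det(f_u,f_v,\nu)$, so $S(f)=\lambda^{-1}(0)$. A point $p\in S(f)$ is non-degenerate if $d\lambda(p)\neq0$; then near $p$ the set $S(f)$ is a regular curve $\gamma$ (singular curve) with $\gamma(0)=p$, $\operatorname{rank}df_p=1$, and there is a never-vanishing vector field $\eta$ near $p$ (null vector field) with $df_q(\eta_q)=0$ for $q\in S(f)$. A non-degenerate $p$ is of the first kind if $\gamma'(0)$ and $\eta_p$ are linearly independent, otherwise of the second kind. For a front, $p$ is of the first kind exactly when $f$ is a cuspidal edge at $p$, i.e. its germ at $p$ agrees, up to diffeomorphism germs of source and target, with $(u,v)\mapsto(u,v^2,v^3)$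 at the origin. The Gaussian curvature $K$ is defined on the set of regular points; if $p$ is a cuspidal edge and $K$ is bounded near $p$, then $K$ extends to a $C^\infty$ function near $p$, and $K(p)$ denotes the value of this extension. Principal curvatures. In local coordinates $(x_1,x_2)=(u,v)$ the principal curvatures of $f$ at regular points are the roots $k$ of $\det(II-kI)=0$, where $I=(\langle f_{x_i},f_{x_j}\rangle)$ and $II=(-\langle f_{x_i},\nu_{x_j}\rangle)$. It is known that near a non-degenerate singular point exactly one of them extends to a bounded $C^\infty$ function $\kappa$ (bounded principal curvature), the other, $\tilde\kappa$ (unbounded principal curvature), is unbounded, and $\hat\kappa:=\lambda\tilde\kappa$ extends to a $C^\infty$ function with $\hat\kappa(p)\neq0$. Principal vector $\widetilde V$ associated to $\tilde\kappa$. (a) $p$ of the second kind: take a coordinate system $(U;u,v)$ centered at $p$ with $f_u(p)=0$, the $u$-axis the singular curve, $|f_v(p)|=1$, $\langle f_{uv},f_v\rangle(p)=0$, and $U$ small. There are a $C^\infty$ function $e(u)$, $e(0)=0$, such that $\eta=\partial_u+e(u)\partial_v$ is a null vector field, and a $C^\infty$ map $h$ with $f_u+e(u)f_v=vh$; $h,f_v$ are linearly independent, $\nu=(h\times f_v)/|h\times f_v|$. With $\widehat F=\langle h,f_v\rangle$, $\widehat G=\langle f_v,f_v\rangle$, $\widehat M=-\langle h,\nu_v\rangle$, $\widehat N=-\langle f_v,\nu_v\rangle$ and $\widetilde V_1=\lambda\widehat N-\hat\kappa\widehat G$, put $\widetilde V=\widetilde V_1\partial_u+\big(-v(\lambda\widehat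 M-\hat\kappa\widehat F)+e(u)\widetilde V_1\big)\partial_v$. (b) $p$ a cuspidal edge: take a coordinate system $(U;u,v)$ centered at $p$ such that the $u$-axis is the singular curve, $\partial_v$ is a null vector field, there are no singular points off the $u$-axis, and $\{f_u,f_{vv},\nu\}$ is orthonormal along the $u$-axis. Write $f_v=vg$ with $g$ of class $C^\infty$ and $\nu=(f_u\times g)/|f_u\times g|$. With $\widetilde E=\langle f_u,f_u\rangle$, $\widetilde F=\langle f_u,g\rangle$, $\widetilde L=-\langle f_u,\nu_u\rangle$, $\widetilde M=-\langle g,\nu_u\rangle$, put $\widetilde V=v(\lambda\widetilde M-\hat\kappa\widetilde F)\partial_u+(-\lambda\widetilde L+\hat\kappa\widetilde E)\partial_v$. The point $p$ is a sub-parabolic point of $f$ (with respect to $\kappa$) if the directional derivative $\widetilde V\kappa$ vanishes at $p$. *)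

theory Defs
  imports "HOL-Analysis.Analysis"
begin

section \<open>Smooth maps and diffeomorphisms\<close>

text \<open>Meant for open sets \<open>S\<close> in finite-dimensional spaces, where it is the usual notion of a
  \<open>C\<^sup>k\<close> map: all iterated directional derivatives up to order \<open>k\<close> exist and are continuous.\<close>

primrec Ck_on :: "nat \<Rightarrow> 'a::real_normed_vector set \<Rightarrow> ('a \<Rightarrow> 'b::real_normed_vector) \<Rightarrow> bool" where
  "Ck_on 0 S f \<longleftrightarrow> continuous_on S f"
| "Ck_on (Suc k) S f \<longleftrightarrow> (\<forall>x\<in>S. f differentiable (at x)) \<and>
     (\<forall>X. Ck_on k S (\<lambda>x. frechet_derivative f (at x) X))"

definition smooth_on :: "'a::real_normed_vector set \<Rightarrow> ('a \<Rightarrow> 'b::real_normed_vector) \<Rightarrow> bool" where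
  "smooth_on S f \<longleftrightarrow> (\<forall>k. Ck_on k S f)"

definition diffeo_on ::
    "'a::real_normed_vector set \<Rightarrow> 'b::real_normed_vector set \<Rightarrow> ('a \<Rightarrow> 'b) \<Rightarrow> bool" where
  "diffeo_on V W \<phi> \<longleftrightarrow> open V \<and> open W \<and> smooth_on V \<phi> \<and> \<phi> ` V = W \<and>
     (\<exists>\<psi>. smooth_on W \<psi> \<and> \<psi> ` W = V \<and> (\<forall>x\<in>V. \<psi> (\<phi> x) = x) \<and> (\<forall>y\<in>W. \<phi> (\<psi> y) = y))"

text \<open>The partial derivative with respect to the \<open>i\<close>-th coordinate; the coordinates of
  \<open>q :: real^2\<close> are \<open>u = q$1\<close> and \<open>v = q$2\<close>.\<close>

definition partial :: "2 \<Rightarrow> (real^2 \<Rightarrow> 'b::real_normed_vector) \<Rightarrow> real^2 \<Rightarrow> 'b" where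
  "partial i f q = frechet_derivative f (at q) (axis i 1)"


section \<open>Fronts and their singular points\<close>

definition frontal :: "(real^2) set \<Rightarrow> (real^2 \<Rightarrow> real^3) \<Rightarrow> (real^2 \<Rightarrow> real^3) \<Rightarrow> bool" where
  "frontal \<Sigma> f \<nu> \<longleftrightarrow> smooth_on \<Sigma> f \<and> smooth_on \<Sigma> \<nu> \<and>
     (\<forall>q\<in>\<Sigma>. norm (\<nu> q) = 1 \<and> (\<forall>X. frechet_derivative f (at q) X \<bullet> \<nu> q = 0))"

definition front :: "(real^2) set \<Rightarrow> (real^2 \<Rightarrow> real^3) \<Rightarrow> (real^2 \<Rightarrow> real^3) \<Rightarrow> bool" where
  "front \<Sigma> f \<nu> \<longleftrightarrow> frontal \<Sigma> f \<nu> \<and>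
     (\<forall>q\<in>\<Sigma>. inj (frechet_derivative (\<lambda>x. (f x, \<nu> x)) (at q)))"

definition singular_set :: "(real^2) set \<Rightarrow> (real^2 \<Rightarrow> real^3) \<Rightarrow> (real^2) set" where
  "singular_set \<Sigma> f = {q \<in> \<Sigma>. \<not> inj (frechet_derivative f (at q))}"

text \<open>The function \<open>\<lambda> = det (f\<^sub>u, f\<^sub>v, \<nu>)\<close>.\<close>

definition signed_area :: "(real^2 \<Rightarrow> real^3) \<Rightarrow> (real^2 \<Rightarrow> real^3) \<Rightarrow> real^2 \<Rightarrow> real" where
  "signed_area f \<nu> q = det (vector [partial 1 f q, partial 2 f q, \<nu> q] :: real^3^3)"

definition non_degenerate ::
    "(real^2) set \<Rightarrow> (real^2 \<Rightarrow> real^3) \<Rightarrow> (real^2 \<Rightarrow> real^3) \<Rightarrow> real^2 \<Rightarrow> bool" where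
  "non_degenerate \<Sigma> f \<nu> p \<longleftrightarrow> p \<in> singular_set \<Sigma> f \<and>
     frechet_derivative (signed_area f \<nu>) (at p) \<noteq> (\<lambda>X. 0)"

definition singular_curve ::
    "(real^2) set \<Rightarrow> (real^2 \<Rightarrow> real^3) \<Rightarrow> real^2 \<Rightarrow> (real \<Rightarrow> real^2) \<Rightarrow> bool" where
  "singular_curve \<Sigma> f p \<gamma> \<longleftrightarrow> \<gamma> 0 = p \<and>
     (\<exists>\<epsilon>>0. smooth_on {-\<epsilon><..<\<epsilon>} \<gamma> \<and>
        (\<forall>t\<in>{-\<epsilon><..<\<epsilon>}. vector_derivative \<gamma> (at t) \<noteq> 0) \<and>
        (\<exists>W. open W \<and> p \<in> W \<and> singular_set \<Sigma> f \<inter> W = \<gamma> ` {-\<epsilon><..<\<epsilon>}))"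

definition null_vector_field ::
    "(real^2) set \<Rightarrow> (real^2 \<Rightarrow> real^3) \<Rightarrow> real^2 \<Rightarrow> (real^2 \<Rightarrow> real^2) \<Rightarrow> bool" where
  "null_vector_field \<Sigma> f p \<eta> \<longleftrightarrow>
     (\<exists>W. open W \<and> p \<in> W \<and> W \<subseteq> \<Sigma> \<and> smooth_on W \<eta> \<and> (\<forall>q\<in>W. \<eta> q \<noteq> 0) \<and>
        (\<forall>q \<in> W \<inter> singular_set \<Sigma> f. frechet_derivative f (at q) (\<eta> q) = 0))"

definition first_kind ::
    "(real^2) set \<Rightarrow> (real^2 \<Rightarrow> real^3) \<Rightarrow> (real^2 \<Rightarrow> real^3) \<Rightarrow> real^2 \<Rightarrow> bool" where
  "first_kind \<Sigma> f \<nu> p \<longleftrightarrow> non_degenerate \<Sigma> f \<nu> p \<and>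
     (\<exists>\<gamma> \<eta>. singular_curve \<Sigma> f p \<gamma> \<and> null_vector_field \<Sigma> f p \<eta> \<and>
        vector_derivative \<gamma> (at 0) \<noteq> \<eta> p \<and> independent {vector_derivative \<gamma> (at 0), \<eta> p})"

definition second_kind ::
    "(real^2) set \<Rightarrow> (real^2 \<Rightarrow> real^3) \<Rightarrow> (real^2 \<Rightarrow> real^3) \<Rightarrow> real^2 \<Rightarrow> bool" where
  "second_kind \<Sigma> f \<nu> p \<longleftrightarrow> non_degenerate \<Sigma> f \<nu> p \<and> \<not> first_kind \<Sigma> f \<nu> p"

text \<open>A coordinate system centered at \<open>p\<close> is given by its inverse \<open>\<phi>\<close>, a parametrization of a
  neighborhood of \<open>p\<close> by the coordinate domain \<open>V\<close>.\<close>

definition coordinates_at ::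
    "(real^2) set \<Rightarrow> real^2 \<Rightarrow> (real^2) set \<Rightarrow> (real^2 \<Rightarrow> real^2) \<Rightarrow> bool" where
  "coordinates_at \<Sigma> p V \<phi> \<longleftrightarrow> diffeo_on V (\<phi> ` V) \<phi> \<and> \<phi> ` V \<subseteq> \<Sigma> \<and> 0 \<in> V \<and> \<phi> 0 = p"

definition cuspidal_edge :: "(real^2) set \<Rightarrow> (real^2 \<Rightarrow> real^3) \<Rightarrow> real^2 \<Rightarrow> bool" where
  "cuspidal_edge \<Sigma> f p \<longleftrightarrow>
     (\<exists>V \<phi> A B \<Phi>. coordinates_at \<Sigma> p V \<phi> \<and>
        diffeo_on A B (\<Phi> :: real^3 \<Rightarrow> real^3) \<and> f p \<in> A \<and> \<Phi> (f p) = 0 \<and>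
        (\<forall>q\<in>V. f (\<phi> q) \<in> A \<and> \<Phi> (f (\<phi> q)) = vector [q$1, (q$2)^2, (q$2)^3]))"


section \<open>Curvatures\<close>

definition first_form :: "(real^2 \<Rightarrow> real^3) \<Rightarrow> real^2 \<Rightarrow> real^2^2" where
  "first_form f q = (\<chi> i j. partial i f q \<bullet> partial j f q)"

definition second_form :: "(real^2 \<Rightarrow> real^3) \<Rightarrow> (real^2 \<Rightarrow> real^3) \<Rightarrow> real^2 \<Rightarrow> real^2^2" where
  "second_form f \<nu> q = (\<chi> i j. - (partial i f q \<bullet> partial j \<nu> q))"

text \<open>Meaningful at regular points only.\<close>

definition gauss_curvature :: "(real^2 \<Rightarrow> real^3) \<Rightarrow> (real^2 \<Rightarrow> real^3) \<Rightarrow> real^2 \<Rightarrow> real" where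
  "gauss_curvature f \<nu> q = det (second_form f \<nu> q) / det (first_form f q)"

definition gauss_curvature_bounded_near ::
    "(real^2) set \<Rightarrow> (real^2 \<Rightarrow> real^3) \<Rightarrow> (real^2 \<Rightarrow> real^3) \<Rightarrow> real^2 \<Rightarrow> bool" where
  "gauss_curvature_bounded_near \<Sigma> f \<nu> p \<longleftrightarrow>
     (\<exists>U. open U \<and> p \<in> U \<and> U \<subseteq> \<Sigma> \<and> bounded (gauss_curvature f \<nu> ` (U - singular_set \<Sigma> f)))"

text \<open>The value \<open>K(p)\<close> at a singular point \<open>p\<close> of the smooth extension of the Gaussian curvature
  from the regular points near \<open>p\<close>.\<close>

definition gauss_curvature_value ::
    "(real^2) set \<Rightarrow> (real^2 \<Rightarrow> real^3) \<Rightarrow> (real^2 \<Rightarrow> real^3) \<Rightarrow> real^2 \<Rightarrow> real" where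
  "gauss_curvature_value \<Sigma> f \<nu> p =
     (THE k. \<exists>U K. open U \<and> p \<in> U \<and> U \<subseteq> \<Sigma> \<and> smooth_on U K \<and>
        (\<forall>q \<in> U - singular_set \<Sigma> f. K q = gauss_curvature f \<nu> q) \<and> k = K p)"

definition principal_curvatures ::
    "(real^2 \<Rightarrow> real^3) \<Rightarrow> (real^2 \<Rightarrow> real^3) \<Rightarrow> real^2 \<Rightarrow> real set" where
  "principal_curvatures f \<nu> q = {k. det (second_form f \<nu> q - k *\<^sub>R first_form f q) = 0}"

text \<open>\<open>\<kappa>\<close> is the principal curvature that extends smoothly to the coordinate domain \<open>V\<close>, and
  \<open>\<kappa>h\<close> is the smooth extension of \<open>\<lambda>\<close> times the other principal curvature \<open>\<kappa>t\<close>.  On a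
  neighborhood of a non-degenerate singular point of a front, \<open>\<kappa>t\<close> is unbounded and
  \<open>\<kappa>\<close>, \<open>\<kappa>h\<close> are unique.\<close>

definition principal_curvature_pair ::
    "(real^2) set \<Rightarrow> (real^2 \<Rightarrow> real^3) \<Rightarrow> (real^2 \<Rightarrow> real^3) \<Rightarrow>
     (real^2 \<Rightarrow> real) \<Rightarrow> (real^2 \<Rightarrow> real) \<Rightarrow> bool" where
  "principal_curvature_pair V f \<nu> \<kappa> \<kappa>h \<longleftrightarrow> smooth_on V \<kappa> \<and> smooth_on V \<kappa>h \<and>
     (\<exists>\<kappa>t. \<forall>q \<in> V - singular_set V f.
        principal_curvatures f \<nu> q = {\<kappa> q, \<kappa>t q} \<and> \<kappa>h q = signed_area f \<nu> q * \<kappa>t q)"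


section \<open>The principal vector of the unbounded principal curvature\<close>

text \<open>In this section \<open>F = f \<circ> \<phi>\<close> and \<open>N = \<nu> \<circ> \<phi>\<close> are the coordinate expressions of the front and
  of its unit normal.\<close>

definition second_kind_coordinates ::
    "(real^2) set \<Rightarrow> (real^2 \<Rightarrow> real^3) \<Rightarrow> (real^2 \<Rightarrow> real^3) \<Rightarrow> real^2 \<Rightarrow>
     (real^2) set \<Rightarrow> (real^2 \<Rightarrow> real^2) \<Rightarrow> (real \<Rightarrow> real) \<Rightarrow> (real^2 \<Rightarrow> real^3) \<Rightarrow> bool" where
  "second_kind_coordinates \<Sigma> f \<nu> p V \<phi> e h \<longleftrightarrow> coordinates_at \<Sigma> p V \<phi> \<and>
     (let F = f \<circ> \<phi>; N = \<nu> \<circ> \<phi> in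
        partial 1 F 0 = 0 \<and>
        singular_set V F = {q \<in> V. q$2 = 0} \<and>
        norm (partial 2 F 0) = 1 \<and>
        partial 2 (partial 1 F) 0 \<bullet> partial 2 F 0 = 0 \<and>
        smooth_on ((\<lambda>q. q$1) ` V) e \<and> e 0 = 0 \<and>
        (\<forall>q\<in>V. q$2 = 0 \<longrightarrow> frechet_derivative F (at q) (vector [1, e (q$1)]) = 0) \<and>
        smooth_on V h \<and>
        (\<forall>q\<in>V. partial 1 F q + e (q$1) *\<^sub>R partial 2 F q = q$2 *\<^sub>R h q) \<and>
        (\<forall>q\<in>V. N q = cross3 (h q) (partial 2 F q) /\<^sub>R norm (cross3 (h q) (partial 2 F q))))"

definition second_kind_principal_vector ::
    "(real^2 \<Rightarrow> real^3) \<Rightarrow> (real^2 \<Rightarrow> real^3) \<Rightarrow> (real \<Rightarrow> real) \<Rightarrow> (real^2 \<Rightarrow> real^3) \<Rightarrow>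
     (real^2 \<Rightarrow> real) \<Rightarrow> real^2 \<Rightarrow> real^2" where
  "second_kind_principal_vector F N e h \<kappa>h q =
     (let lam = signed_area F N q;
          Fh = h q \<bullet> partial 2 F q;
          Gh = partial 2 F q \<bullet> partial 2 F q;
          Mh = - (h q \<bullet> partial 2 N q);
          Nh = - (partial 2 F q \<bullet> partial 2 N q);
          V1 = lam * Nh - \<kappa>h q * Gh
      in vector [V1, - (q$2) * (lam * Mh - \<kappa>h q * Fh) + e (q$1) * V1])"

definition cuspidal_edge_coordinates ::
    "(real^2) set \<Rightarrow> (real^2 \<Rightarrow> real^3) \<Rightarrow> (real^2 \<Rightarrow> real^3) \<Rightarrow> real^2 \<Rightarrow>
     (real^2) set \<Rightarrow> (real^2 \<Rightarrow> real^2) \<Rightarrow> (real^2 \<Rightarrow> real^3) \<Rightarrow> bool" where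
  "cuspidal_edge_coordinates \<Sigma> f \<nu> p V \<phi> g \<longleftrightarrow> coordinates_at \<Sigma> p V \<phi> \<and>
     (let F = f \<circ> \<phi>; N = \<nu> \<circ> \<phi> in
        singular_set V F = {q \<in> V. q$2 = 0} \<and>
        (\<forall>q\<in>V. q$2 = 0 \<longrightarrow> partial 2 F q = 0) \<and>
        (\<forall>q\<in>V. q$2 = 0 \<longrightarrow>
           norm (partial 1 F q) = 1 \<and> norm (partial 2 (partial 2 F) q) = 1 \<and> norm (N q) = 1 \<and>
           partial 1 F q \<bullet> partial 2 (partial 2 F) q = 0 \<and>
           partial 1 F q \<bullet> N q = 0 \<and> partial 2 (partial 2 F) q \<bullet> N q = 0) \<and>
        smooth_on V g \<and>
        (\<forall>q\<in>V. partial 2 F q = q$2 *\<^sub>R g q) \<and>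
        (\<forall>q\<in>V. N q = cross3 (partial 1 F q) (g q) /\<^sub>R norm (cross3 (partial 1 F q) (g q))))"

definition cuspidal_edge_principal_vector ::
    "(real^2 \<Rightarrow> real^3) \<Rightarrow> (real^2 \<Rightarrow> real^3) \<Rightarrow> (real^2 \<Rightarrow> real^3) \<Rightarrow>
     (real^2 \<Rightarrow> real) \<Rightarrow> real^2 \<Rightarrow> real^2" where
  "cuspidal_edge_principal_vector F N g \<kappa>h q =
     (let lam = signed_area F N q;
          Et = partial 1 F q \<bullet> partial 1 F q;
          Ft = partial 1 F q \<bullet> g q;
          Lt = - (partial 1 F q \<bullet> partial 1 N q);
          Mt = - (g q \<bullet> partial 1 N q)
      in vector [q$2 * (lam * Mt - \<kappa>h q * Ft), - lam * Lt + \<kappa>h q * Et])"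

text \<open>The principal vector is only defined after the choice of an adapted coordinate system.
  The vanishing of the directional derivative below does not depend on that choice, so
  \<open>p\<close> is sub-parabolic as soon as it vanishes for one of them.\<close>

definition sub_parabolic ::
    "(real^2) set \<Rightarrow> (real^2 \<Rightarrow> real^3) \<Rightarrow> (real^2 \<Rightarrow> real^3) \<Rightarrow> real^2 \<Rightarrow> bool" where
  "sub_parabolic \<Sigma> f \<nu> p \<longleftrightarrow>
     second_kind \<Sigma> f \<nu> p \<and>
       (\<exists>V \<phi> e h \<kappa> \<kappa>h. second_kind_coordinates \<Sigma> f \<nu> p V \<phi> e h \<and>
          principal_curvature_pair V (f \<circ> \<phi>) (\<nu> \<circ> \<phi>) \<kappa> \<kappa>h \<and>
          frechet_derivative \<kappa> (at 0)
            (second_kind_principal_vector (f \<circ> \<phi>) (\<nu> \<circ> \<phi>) e h \<kappa>h 0) = 0)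
     \<or> cuspidal_edge \<Sigma> f p \<and>
       (\<exists>V \<phi> g \<kappa> \<kappa>h. cuspidal_edge_coordinates \<Sigma> f \<nu> p V \<phi> g \<and>
          principal_curvature_pair V (f \<circ> \<phi>) (\<nu> \<circ> \<phi>) \<kappa> \<kappa>h \<and>
          frechet_derivative \<kappa> (at 0)
            (cuspidal_edge_principal_vector (f \<circ> \<phi>) (\<nu> \<circ> \<phi>) g \<kappa>h 0) = 0)"

end

theory Submission
  imports Defs
begin

text \<open>
  Choose a null vector field \<open>\<eta>\<close> and a transversal field \<open>\<tau>\<close>, with \<open>df(\<eta>) = v w\<close> and \<open>v = 0\<close> the
  singular curve.  In this frame the characteristic polynomial of the curvatures is
  \<open>v (v D k\<^sup>2 - B k + C)\<close> with smooth \<open>D > 0\<close>, \<open>B\<close>, \<open>C\<close>, and the front condition gives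
  \<open>B \<noteq> 0\<close> at \<open>p\<close>, so that the two roots are \<open>\<kappa>\<close> and \<open>\<kappa>h / \<lambda>\<close> with \<open>\<kappa>\<close>, \<open>\<kappa>h\<close> smooth and
  \<open>\<kappa>h \<noteq> 0\<close> at \<open>p\<close>.  Since \<open>\<lambda> K = \<kappa> \<kappa>h\<close>, boundedness of \<open>K\<close> forces \<open>\<kappa> = 0\<close> along the singular
  curve.  At a point of the second kind the principal vector is tangent to that curve.  At a
  cuspidal edge it is a nonzero multiple of \<open>\<partial>\<^sub>v\<close>, and \<open>K(p) = \<kappa>\<^sub>v \<kappa>h / \<lambda>\<^sub>v\<close>.

  Adapted coordinates exist in both cases.  At a cuspidal edge the normal form is first reparametrized by arc length of the singular curve and then by
  \<open>(u, v) \<mapsto> (\<sigma> u + b(u) v\<^sup>2 / 2, c(u) v)\<close>; at a point of the second kind \<open>\<lambda>\<close> itself is used as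
  a coordinate, followed by \<open>(u, v) \<mapsto> (\<sigma> u, (a + b u) v)\<close>.  The sign \<open>\<sigma>\<close> orients the normal.
\<close>

text \<open>Curvatures are given at regular points only, so what is claimed on the singular curve is
  a limit: an identity of continuous functions is proved off the axis, which is dense, and then
  holds on it. The usual root formula has the denominator \<open>2 v D\<close>, which degenerates on
  the axis; the bounded root is therefore written \<open>2 C / (B + s R)\<close>, where
  \<open>R\<close> is the root of the discriminant and \<open>s\<close> is the sign of
  \<open>B\<close> at \<open>p\<close>. Recovering \<open>K\<close> from \<open>\<kappa>\<close>
  means dividing by \<open>v\<close> within smooth functions; Hadamard's lemma, an integral along
  segments to the axis, supplies the quotient.

  Sub-parabolicity asks for some adapted chart and some pair of curvatures. At a cuspidal edge one
  implication thus needs a computation valid in all adapted charts, whose outcome is the chart-free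
  value \<open>K(p)\<close>; the other needs that a chart exists. The alternative of the second kind
  has to be excluded as well. Adapted charts prescribe the normal as a positive multiple of a cross
  product, while the given \<open>\<nu>\<close> may be its opposite; only a reflection of the
  coordinates can correct this.\<close>

section \<open>Calculus of smooth maps\<close>

lemma has_derivative_frechet:
  "f differentiable (at x) \<Longrightarrow> (f has_derivative frechet_derivative f (at x)) (at x)"
  by (simp add: frechet_derivative_works)

lemma frechet_derivative_eqI: "(f has_derivative f') (at x) \<Longrightarrow> frechet_derivative f (at x) = f'"
  by (metis frechet_derivative_at)

lemma has_derivative_cong_open:
  assumes "open S" "x \<in> S" "\<And>y. y \<in> S \<Longrightarrow> f y = g y"
  shows "(f has_derivative D) (at x) \<longleftrightarrow> (g has_derivative D) (at x)"
  using assms has_derivative_transform_within_open by (metis (no_types, lifting))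

lemma frechet_derivative_cong_open:
  assumes "open S" "x \<in> S" "\<And>y. y \<in> S \<Longrightarrow> f y = g y"
  shows "frechet_derivative f (at x) = frechet_derivative g (at x)"
  unfolding frechet_derivative_def using has_derivative_cong_open[OF assms] by simp

lemma differentiable_cong_open:
  assumes "open S" "x \<in> S" "\<And>y. y \<in> S \<Longrightarrow> f y = g y"
  shows "f differentiable (at x) \<longleftrightarrow> g differentiable (at x)"
  unfolding differentiable_def using has_derivative_cong_open[OF assms] by simp

lemma Ck_on_mono: "Ck_on k S f \<Longrightarrow> T \<subseteq> S \<Longrightarrow> Ck_on k T f"
  by (induction k arbitrary: f) (auto intro: continuous_on_subset)

lemma Ck_on_cong:
  assumes "open S" "\<And>x. x \<in> S \<Longrightarrow> f x = g x" "Ck_on k S f"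
  shows "Ck_on k S g"
  using assms(2,3)
proof (induction k arbitrary: f g)
  case 0
  then show ?case by (metis Ck_on.simps(1) continuous_on_cong)
next
  case (Suc k)
  have "Ck_on k S (\<lambda>x. frechet_derivative g (at x) X)" for X
    by (rule Suc.IH[of "\<lambda>x. frechet_derivative f (at x) X"])
      (use Suc.prems frechet_derivative_cong_open[OF assms(1) _ Suc.prems(1)] in auto)
  then show ?case
    using Suc.prems differentiable_cong_open[OF assms(1) _ Suc.prems(1)] by auto
qed

text \<open>A derivative at an interior point is unique and depends only on nearby values, so on an
  open set an explicit formula \<open>f'\<close> may stand in for the
  \<open>frechet_derivative\<close> in the definition of \<open>Ck_on\<close>.\<close>

lemma Ck_on_SucI:
  assumes "open S" "\<And>x. x \<in> S \<Longrightarrow> (f has_derivative f' x) (at x)" "\<And>X. Ck_on k S (\<lambda>x. f' x X)"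
  shows "Ck_on (Suc k) S f"
  unfolding Ck_on.simps
proof (intro conjI ballI allI)
  show "f differentiable (at x)" if "x \<in> S" for x
    using assms(2) that differentiable_def by blast
  show "Ck_on k S (\<lambda>x. frechet_derivative f (at x) X)" for X
    by (rule Ck_on_cong[OF assms(1) _ assms(3)[of X]]) (metis assms(2) frechet_derivative_eqI)
qed

lemma Ck_on_SucD: "Ck_on (Suc k) S f \<Longrightarrow> Ck_on k S f"
proof (induction k arbitrary: f)
  case 0
  then show ?case
    by (auto intro!: continuous_at_imp_continuous_on differentiable_imp_continuous_within)
next
  case (Suc k)
  then show ?case by (simp del: Ck_on.simps add: Ck_on.simps(2)[of _ S f])
qed

lemma Ck_on_const: "Ck_on k S (\<lambda>x. c)"
  by (induction k arbitrary: c) auto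

lemma Ck_on_bounded_linear:
  assumes "bounded_linear L" "open S" "Ck_on k S f"
  shows "Ck_on k S (\<lambda>x. L (f x))"
  using assms(3)
proof (induction k arbitrary: f)
  case 0
  then show ?case
    using assms(1) bounded_linear.continuous_on by auto
next
  case (Suc k)
  show ?case
  proof (rule Ck_on_SucI[OF assms(2)])
    show "((\<lambda>x. L (f x)) has_derivative (\<lambda>X. L (frechet_derivative f (at x) X))) (at x)" if "x \<in> S" for x
      by (rule bounded_linear.has_derivative[OF assms(1) has_derivative_frechet]) (use Suc.prems that in auto)
    show "Ck_on k S (\<lambda>x. L (frechet_derivative f (at x) X))" for X
      by (rule Suc.IH) (use Suc.prems in auto)
  qed
qed

lemma Ck_on_add:
  assumes "open S" "Ck_on k S f" "Ck_on k S g"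
  shows "Ck_on k S (\<lambda>x. f x + g x)"
  using assms(2,3)
proof (induction k arbitrary: f g)
  case 0
  then show ?case by (auto intro: continuous_intros)
next
  case (Suc k)
  show ?case
  proof (rule Ck_on_SucI[OF assms(1)])
    show "((\<lambda>x. f x + g x) has_derivative (\<lambda>X. frechet_derivative f (at x) X + frechet_derivative g (at x) X)) (at x)"
      if "x \<in> S" for x
      by (intro has_derivative_add has_derivative_frechet) (use Suc.prems that in auto)
    show "Ck_on k S (\<lambda>x. frechet_derivative f (at x) X + frechet_derivative g (at x) X)" for X
      by (rule Suc.IH) (use Suc.prems in auto)
  qed
qed

lemma Ck_on_bilinear:
  assumes "bounded_bilinear pr" "open S" "Ck_on k S f" "Ck_on k S g"
  shows "Ck_on k S (\<lambda>x. pr (f x) (g x))"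
  using assms(3,4)
proof (induction k arbitrary: f g)
  case 0
  then show ?case using bounded_bilinear.continuous_on[OF assms(1)] by auto
next
  case (Suc k)
  show ?case
  proof (rule Ck_on_SucI[OF assms(2)])
    show "((\<lambda>x. pr (f x) (g x)) has_derivative
        (\<lambda>X. pr (f x) (frechet_derivative g (at x) X) + pr (frechet_derivative f (at x) X) (g x))) (at x)"
      if "x \<in> S" for x
      by (intro bounded_bilinear.FDERIV[OF assms(1)] has_derivative_frechet) (use Suc.prems that in auto)
    show "Ck_on k S (\<lambda>x. pr (f x) (frechet_derivative g (at x) X) + pr (frechet_derivative f (at x) X) (g x))" for X
      using Suc.prems Ck_on_SucD[OF Suc.prems(1)] Ck_on_SucD[OF Suc.prems(2)]
      by (intro Ck_on_add assms(2) Suc.IH) simp_all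
  qed
qed

lemma Ck_on_sum:
  assumes "open S" "\<And>i. i \<in> I \<Longrightarrow> Ck_on k S (f i)"
  shows "Ck_on k S (\<lambda>x. \<Sum>i\<in>I. f i x)"
  using assms(2)
proof (induction I rule: infinite_finite_induct)
  case (insert i I)
  then show ?case by (simp add: Ck_on_add assms(1))
qed (auto simp: Ck_on_const)

lemma linear_basis_expansion:
  fixes X :: "'a::euclidean_space"
  assumes "linear L"
  shows "L X = (\<Sum>b\<in>Basis. (X \<bullet> b) *\<^sub>R L b)"
  using assms by (metis (mono_tags, lifting) euclidean_representation linear_scale linear_sum sum.cong)

text \<open>\<open>Ck_on\<close> speaks of derivatives in a fixed direction, whereas the chain rule
  differentiates \<open>g\<close> in the moving direction \<open>df(X)\<close>. Expanding that
  direction in \<open>Basis\<close> leaves only fixed directions, to which the induction hypothesis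
  applies.\<close>

lemma Ck_on_compose:
  fixes f :: "'a::real_normed_vector \<Rightarrow> 'b::euclidean_space" and g :: "'b \<Rightarrow> 'c::real_normed_vector"
  assumes "open S" "open T" "f ` S \<subseteq> T" "Ck_on k S f" "Ck_on k T g"
  shows "Ck_on k S (\<lambda>x. g (f x))"
  using assms(4,5)
proof (induction k arbitrary: g)
  case 0
  then show ?case using assms(3) by (auto intro: continuous_on_compose2)
next
  case (Suc k)
  let ?D = "\<lambda>x X. \<Sum>b\<in>Basis. (frechet_derivative f (at x) X \<bullet> b) *\<^sub>R frechet_derivative g (at (f x)) b"
  show ?case
  proof (rule Ck_on_SucI[OF assms(1)])
    show "((\<lambda>x. g (f x)) has_derivative ?D x) (at x)" if "x \<in> S" for x
    proof -
      have g: "(g has_derivative frechet_derivative g (at (f x))) (at (f x))"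
        by (rule has_derivative_frechet) (use Suc.prems that assms(3) in auto)
      have f: "(f has_derivative frechet_derivative f (at x)) (at x)"
        by (rule has_derivative_frechet) (use Suc.prems that assms(3) in auto)
      have "frechet_derivative g (at (f x)) \<circ> frechet_derivative f (at x) = ?D x"
        unfolding o_def by (rule ext, rule linear_basis_expansion[OF has_derivative_linear[OF g]])
      with diff_chain_at[OF f g] show ?thesis by (simp add: o_def)
    qed
    show "Ck_on k S (\<lambda>x. ?D x X)" for X
    proof (rule Ck_on_sum[OF assms(1)], rule Ck_on_bilinear[OF bounded_bilinear_scaleR assms(1)])
      fix b :: 'b
      show "Ck_on k S (\<lambda>x. frechet_derivative f (at x) X \<bullet> b)"
        by (rule Ck_on_bounded_linear[OF bounded_linear_inner_left assms(1)]) (use Suc.prems in auto)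
      show "Ck_on k S (\<lambda>x. frechet_derivative g (at (f x)) b)"
        by (rule Suc.IH) (use Suc.prems Ck_on_SucD in auto)
    qed
  qed
qed

section \<open>Closure properties of smooth maps\<close>

lemma smooth_on_subset: "smooth_on S f \<Longrightarrow> T \<subseteq> S \<Longrightarrow> smooth_on T f"
  unfolding smooth_on_def using Ck_on_mono by blast

lemma smooth_on_cong: "open S \<Longrightarrow> (\<And>x. x \<in> S \<Longrightarrow> f x = g x) \<Longrightarrow> smooth_on S f \<Longrightarrow> smooth_on S g"
  unfolding smooth_on_def using Ck_on_cong by blast

lemma smooth_on_differentiable: "smooth_on S f \<Longrightarrow> x \<in> S \<Longrightarrow> f differentiable (at x)"
  unfolding smooth_on_def by (metis Ck_on.simps(2))

lemma smooth_on_has_derivative: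
  "smooth_on S f \<Longrightarrow> x \<in> S \<Longrightarrow> (f has_derivative frechet_derivative f (at x)) (at x)"
  by (rule has_derivative_frechet[OF smooth_on_differentiable])

lemma smooth_on_continuous_on: "smooth_on S f \<Longrightarrow> continuous_on S f"
  unfolding smooth_on_def by (metis Ck_on.simps(1))

lemma smooth_on_isCont: "smooth_on S f \<Longrightarrow> x \<in> S \<Longrightarrow> isCont f x"
  using smooth_on_differentiable differentiable_imp_continuous_within by blast

lemma smooth_on_frechet: "smooth_on S f \<Longrightarrow> smooth_on S (\<lambda>x. frechet_derivative f (at x) X)"
  unfolding smooth_on_def by (metis Ck_on.simps(2))

lemma smooth_on_partial: "smooth_on S f \<Longrightarrow> smooth_on S (partial i f)"
  using smooth_on_frechet[of S f "axis i 1"] unfolding partial_def .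

lemma smooth_onI_derivative:
  assumes "open S" "\<And>x. x \<in> S \<Longrightarrow> (f has_derivative f' x) (at x)" "\<And>X. smooth_on S (\<lambda>x. f' x X)"
  shows "smooth_on S f"
  unfolding smooth_on_def using Ck_on_SucI[OF assms(1,2)] assms(3) Ck_on_SucD unfolding smooth_on_def by blast

lemma smooth_on_const: "smooth_on S (\<lambda>x. c)"
  by (simp add: smooth_on_def Ck_on_const)

lemma smooth_on_bounded_linear:
  "bounded_linear L \<Longrightarrow> open S \<Longrightarrow> smooth_on S f \<Longrightarrow> smooth_on S (\<lambda>x. L (f x))"
  unfolding smooth_on_def using Ck_on_bounded_linear by blast

lemma smooth_on_ident: "open S \<Longrightarrow> smooth_on S (\<lambda>x. x)"
  by (rule smooth_onI_derivative[where f' = "\<lambda>x X. X"]) (auto intro: smooth_on_const)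

lemma smooth_on_add: "open S \<Longrightarrow> smooth_on S f \<Longrightarrow> smooth_on S g \<Longrightarrow> smooth_on S (\<lambda>x. f x + g x)"
  unfolding smooth_on_def using Ck_on_add by blast

lemma smooth_on_minus: "open S \<Longrightarrow> smooth_on S f \<Longrightarrow> smooth_on S (\<lambda>x. - f x)"
  by (rule smooth_on_bounded_linear[OF bounded_linear_minus[OF bounded_linear_ident]])

lemma smooth_on_diff: "open S \<Longrightarrow> smooth_on S f \<Longrightarrow> smooth_on S g \<Longrightarrow> smooth_on S (\<lambda>x. f x - g x)"
  using smooth_on_add[of S f "\<lambda>x. - g x"] smooth_on_minus by auto

lemma smooth_on_bilinear:
  "bounded_bilinear pr \<Longrightarrow> open S \<Longrightarrow> smooth_on S f \<Longrightarrow> smooth_on S g \<Longrightarrow> smooth_on S (\<lambda>x. pr (f x) (g x))"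
  unfolding smooth_on_def using Ck_on_bilinear by blast

lemmas smooth_on_scaleR = smooth_on_bilinear[OF bounded_bilinear_scaleR]
lemmas smooth_on_inner = smooth_on_bilinear[OF bounded_bilinear_inner]
lemmas smooth_on_mult = smooth_on_bilinear[OF bounded_bilinear_mult]

lemma bounded_bilinear_cross3: "bounded_bilinear cross3"
  using bilinear_cross bilinear_conv_bounded_bilinear by blast

lemmas smooth_on_cross3 = smooth_on_bilinear[OF bounded_bilinear_cross3]

lemma smooth_on_nth: "open S \<Longrightarrow> smooth_on S f \<Longrightarrow> smooth_on S (\<lambda>x. f x $ i)"
  by (rule smooth_on_bounded_linear[OF bounded_linear_vec_nth])

lemma smooth_on_power: "open S \<Longrightarrow> smooth_on S f \<Longrightarrow> smooth_on S (\<lambda>x. f x ^ n :: 'a::real_normed_algebra_1)"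
  by (induction n) (auto intro: smooth_on_const smooth_on_mult)

lemma smooth_on_compose:
  fixes f :: "'a::real_normed_vector \<Rightarrow> 'b::euclidean_space" and g :: "'b \<Rightarrow> 'c::real_normed_vector"
  assumes "open S" "open T" "f ` S \<subseteq> T" "smooth_on S f" "smooth_on T g"
  shows "smooth_on S (\<lambda>x. g (f x))"
  using assms Ck_on_compose unfolding smooth_on_def by metis

text \<open>The derivative along a vector field, reduced to fixed directions by the same basis
  expansion as in the chain rule.\<close>

lemma smooth_on_frechet_apply:
  fixes f :: "'a::euclidean_space \<Rightarrow> 'b::real_normed_vector"
  assumes "open S" "smooth_on S f" "smooth_on S X"
  shows "smooth_on S (\<lambda>x. frechet_derivative f (at x) (X x))"
proof (rule smooth_on_cong[OF assms(1)])
  show "(\<Sum>b\<in>Basis. (X x \<bullet> b) *\<^sub>R frechet_derivative f (at x) b) = frechet_derivative f (at x) (X x)"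
    if "x \<in> S" for x
    by (rule linear_basis_expansion[symmetric])
      (use smooth_on_has_derivative[OF assms(2) that] has_derivative_linear in blast)
  have "Ck_on k S (\<lambda>x. \<Sum>b\<in>Basis. (X x \<bullet> b) *\<^sub>R frechet_derivative f (at x) b)" for k
    using smooth_on_scaleR[OF assms(1) smooth_on_inner[OF assms(1,3) smooth_on_const] smooth_on_frechet[OF assms(2)]]
    by (intro Ck_on_sum assms(1)) (auto simp: smooth_on_def)
  then show "smooth_on S (\<lambda>x. \<Sum>b\<in>Basis. (X x \<bullet> b) *\<^sub>R frechet_derivative f (at x) b)"
    by (simp add: smooth_on_def)
qed

lemma open_nonzero_reals: "open {x::real. x \<noteq> 0}"
  using open_Compl[of "{0::real}"] by (simp add: Compl_eq)

lemma smooth_on_inverse_real: "smooth_on {x. x \<noteq> 0} (inverse :: real \<Rightarrow> real)"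
proof -
  have "Ck_on k {x. x \<noteq> 0} (inverse :: real \<Rightarrow> real)" for k
  proof (induction k)
    case 0
    then show ?case by (auto intro!: continuous_intros)
  next
    case (Suc k)
    show ?case
      \<comment> \<open>The derivative of \<open>inverse\<close> is a product of copies of
        \<open>inverse\<close>, so one more order of smoothness follows from the present
        one.\<close>
      by (rule Ck_on_SucI[where f' = "\<lambda>x X. - (inverse x * X * inverse x)"])
        (auto intro!: Suc Ck_on_const open_nonzero_reals Ck_on_bilinear[OF bounded_bilinear_mult]
          has_derivative_inverse' Ck_on_bounded_linear[OF bounded_linear_minus[OF bounded_linear_ident]])
  qed
  then show ?thesis by (simp add: smooth_on_def)
qed

lemma smooth_on_inverse:
  fixes f :: "'a::real_normed_vector \<Rightarrow> real"
  assumes "open S" "smooth_on S f" "\<And>x. x \<in> S \<Longrightarrow> f x \<noteq> 0"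
  shows "smooth_on S (\<lambda>x. inverse (f x))"
  by (rule smooth_on_compose[OF assms(1) open_nonzero_reals _ assms(2) smooth_on_inverse_real]) (use assms(3) in auto)

lemma smooth_on_divide:
  fixes f :: "'a::real_normed_vector \<Rightarrow> real"
  assumes "open S" "smooth_on S f" "smooth_on S g" "\<And>x. x \<in> S \<Longrightarrow> g x \<noteq> 0"
  shows "smooth_on S (\<lambda>x. f x / g x)"
  unfolding divide_inverse using assms by (intro smooth_on_mult smooth_on_inverse)

lemma smooth_on_sqrt_real: "smooth_on {0<..} sqrt"
proof -
  have "Ck_on k {0<..} sqrt" for k
  proof (induction k)
    case 0
    then show ?case by (auto intro!: continuous_intros)
  next
    case (Suc k)
    \<comment> \<open>The derivative of \<open>sqrt\<close> is half of \<open>1 / sqrt\<close>,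
      again built from \<open>sqrt\<close>, so the induction closes.\<close>
    have *: "Ck_on k {0<..} (\<lambda>x. inverse (sqrt x))"
      by (rule Ck_on_compose[OF _ open_nonzero_reals _ Suc])
        (use smooth_on_inverse_real in \<open>auto simp: smooth_on_def\<close>)
    show ?case
    proof (rule Ck_on_SucI)
      show "(sqrt has_derivative (\<lambda>X. X * (inverse (sqrt x) / 2))) (at x)" if "x \<in> {0<..}" for x
        using that by (auto intro!: derivative_eq_intros simp: field_simps)
      show "Ck_on k {0<..} (\<lambda>x. X * (inverse (sqrt x) / 2))" for X
        by (intro Ck_on_bilinear[OF bounded_bilinear_mult] Ck_on_const
            Ck_on_bounded_linear[OF bounded_linear_divide] * open_greaterThan)
    qed simp
  qed
  then show ?thesis by (simp add: smooth_on_def)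
qed

lemma smooth_on_sqrt:
  assumes "open S" "smooth_on S f" "\<And>x. x \<in> S \<Longrightarrow> f x > 0"
  shows "smooth_on S (\<lambda>x. sqrt (f x))"
  by (rule smooth_on_compose[OF assms(1) _ _ assms(2) smooth_on_sqrt_real]) (use assms(3) in auto)

lemma smooth_on_norm:
  fixes f :: "'a::real_normed_vector \<Rightarrow> 'b::real_inner"
  assumes "open S" "smooth_on S f" "\<And>x. x \<in> S \<Longrightarrow> f x \<noteq> 0"
  shows "smooth_on S (\<lambda>x. norm (f x))"
  unfolding norm_eq_sqrt_inner using assms by (intro smooth_on_sqrt smooth_on_inner) auto

lemmas smooth_intros = smooth_on_const smooth_on_ident smooth_on_add smooth_on_minus smooth_on_diff
  smooth_on_scaleR smooth_on_inner smooth_on_mult smooth_on_cross3 smooth_on_nth smooth_on_power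
  smooth_on_divide smooth_on_inverse smooth_on_sqrt smooth_on_norm smooth_on_partial smooth_on_frechet_apply

section \<open>Maps of the plane in coordinates\<close>

lemma vector2_eq_axis: "(vector [a, b] :: real^2) = a *\<^sub>R axis 1 1 + b *\<^sub>R axis 2 1"
  by (simp add: vec_eq_iff forall_2 axis_def)

lemma vector2_eta: "(vector [q$1, q$2] :: real^2) = q"
  by (simp add: vec_eq_iff forall_2)

lemma smooth_on_vector2:
  "open S \<Longrightarrow> smooth_on S a \<Longrightarrow> smooth_on S b \<Longrightarrow> smooth_on S (\<lambda>x. vector [a x, b x] :: real^2)"
  unfolding vector2_eq_axis by (intro smooth_intros)

lemma linear_vec2:
  fixes L :: "real^2 \<Rightarrow> 'a::real_vector"
  assumes "linear L"
  shows "L X = X$1 *\<^sub>R L (axis 1 1) + X$2 *\<^sub>R L (axis 2 1)"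
proof -
  have "L X = L (X$1 *\<^sub>R axis 1 1 + X$2 *\<^sub>R axis 2 1)"
    by (simp flip: vector2_eq_axis add: vector2_eta)
  then show ?thesis using assms by (simp add: linear_add linear_scale)
qed

lemma linear_frechet: "f differentiable (at x) \<Longrightarrow> linear (frechet_derivative f (at x))"
  using has_derivative_frechet has_derivative_linear by blast

lemma frechet_partials:
  fixes f :: "real^2 \<Rightarrow> 'a::real_normed_vector"
  assumes "f differentiable (at q)"
  shows "frechet_derivative f (at q) X = X$1 *\<^sub>R partial 1 f q + X$2 *\<^sub>R partial 2 f q"
  unfolding partial_def by (rule linear_vec2[OF linear_frechet[OF assms]])

lemma frechet_chain:
  assumes "f differentiable (at x)" "g differentiable (at (f x))"
  shows "frechet_derivative (g \<circ> f) (at x) X = frechet_derivative g (at (f x)) (frechet_derivative f (at x) X)"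
  using frechet_derivative_compose[OF assms] by simp

section \<open>Division by a coordinate\<close>

text \<open>The homotopy that contracts a disc around the origin to the axis \<open>v = 0\<close>
  along the \<open>v\<close>-direction.\<close>

definition squash :: "real \<Rightarrow> real^2 \<Rightarrow> real^2" where
  "squash t q = vector [q$1, t * q$2]"

lemma squash_alt: "squash t q = q$1 *\<^sub>R axis 1 1 + (t * q$2) *\<^sub>R axis 2 1"
  by (simp add: squash_def vector2_eq_axis)

lemma squash_1: "squash 1 q = q"
  by (simp add: squash_def vector2_eta)

lemma norm_squash:
  assumes "0 \<le> t" "t \<le> 1"
  shows "norm (squash t q) \<le> norm q"
proof (rule norm_le_componentwise_cart)
  show "norm (squash t q $ i) \<le> norm (q $ i)" for i
    using exhaust_2[of i] assms by (auto simp: squash_def abs_mult mult_left_le_one_le)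
qed

lemma bounded_linear_squash: "bounded_linear (squash t)"
  by (rule linear_conv_bounded_linear[THEN iffD1])
    (auto intro!: linearI simp: squash_def vec_eq_iff forall_2 algebra_simps)

lemma continuous_on_squash_compose:
  assumes "continuous_on (ball 0 r) g"
  shows "continuous_on (ball 0 r \<times> {0..1}) (\<lambda>z. g (squash (snd z) (fst z)))"
proof (rule continuous_on_compose2[OF assms])
  show "continuous_on (ball 0 r \<times> {0..1}) (\<lambda>z. squash (snd z) (fst z))"
    unfolding squash_alt by (intro continuous_intros)
  show "(\<lambda>z. squash (snd z) (fst z)) ` (ball 0 r \<times> {0..1}) \<subseteq> ball 0 r"
    by (auto intro: le_less_trans[OF norm_squash])
qed

text \<open>For \<open>m = 0\<close> and \<open>g = \<partial>f/\<partial>v\<close> this is the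
  Hadamard quotient of \<open>f\<close> by \<open>v\<close>. The weight \<open>t ^ m\<close> makes
  the family closed under differentiation.\<close>

definition fibre_moment :: "nat \<Rightarrow> (real^2 \<Rightarrow> 'b::euclidean_space) \<Rightarrow> real^2 \<Rightarrow> 'b" where
  "fibre_moment m g q = integral {0..1} (\<lambda>t. t ^ m *\<^sub>R g (squash t q))"

lemma continuous_on_fibre_integrand:
  fixes g :: "real^2 \<Rightarrow> 'b::real_normed_vector"
  assumes "continuous_on (ball 0 r) g"
  shows "continuous_on (ball 0 r \<times> cbox 0 1) (\<lambda>(q, t::real). t ^ m *\<^sub>R g (squash t q))"
  unfolding split_beta cbox_interval
  by (intro continuous_on_scaleR continuous_on_power continuous_on_snd continuous_on_id
      continuous_on_squash_compose assms)

lemma fibre_integrable: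
  fixes g :: "real^2 \<Rightarrow> 'b::banach"
  assumes "continuous_on (ball 0 r) g" "q \<in> ball 0 r"
  shows "(\<lambda>t::real. t ^ m *\<^sub>R g (squash t q)) integrable_on {0..1}"
proof -
  have "continuous_on {0..1::real} (\<lambda>t. (\<lambda>(q, t::real). t ^ m *\<^sub>R g (squash t q)) (q, t))"
    by (rule continuous_on_compose2[OF continuous_on_fibre_integrand[OF assms(1)]])
      (use assms(2) in \<open>auto intro!: continuous_intros\<close>)
  then show ?thesis by (intro integrable_continuous_real) simp
qed

text \<open>Differentiation under the integral sign. The chain rule through \<open>squash\<close>
  multiplies the second component of \<open>X\<close> by \<open>t\<close>, which turns
  \<open>m\<close> into \<open>Suc m\<close>.\<close>

lemma has_derivative_fibre_moment:
  fixes g :: "real^2 \<Rightarrow> 'b::euclidean_space"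
  assumes g: "smooth_on (ball 0 r) g" and q: "q \<in> ball 0 r"
  shows "(fibre_moment m g has_derivative
    (\<lambda>X. X$1 *\<^sub>R fibre_moment m (partial 1 g) q + X$2 *\<^sub>R fibre_moment (Suc m) (partial 2 g) q)) (at q)"
proof -
  let ?D = "\<lambda>q t X. t ^ m *\<^sub>R frechet_derivative g (at (squash t q)) (squash t X)"
  \<comment> \<open>The Leibniz rule expects the derivative of the integrand as a continuous map
    into the bounded linear maps. In finite dimension, continuity in each single direction suffices
    for this.\<close>
  define fx where "fx q t = Blinfun (?D q t)" for q t
  have sq: "squash t q \<in> ball 0 r" if "q \<in> ball 0 r" "t \<in> {0..1}" for q t
    using that norm_squash[of t q] by auto
  have d: "((\<lambda>q. t ^ m *\<^sub>R g (squash t q)) has_derivative ?D q t) (at q)" if "q \<in> ball 0 r" "t \<in> {0..1}" for q t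
    by (intro has_derivative_scaleR_right has_derivative_compose[OF bounded_linear_imp_has_derivative[OF bounded_linear_squash]]
        smooth_on_has_derivative[OF g sq] that)
  have fx: "blinfun_apply (fx q t) = ?D q t" if "q \<in> ball 0 r" "t \<in> {0..1}" for q t
    unfolding fx_def by (rule bounded_linear_Blinfun_apply[OF has_derivative_bounded_linear[OF d[OF that]]])
  have fx': "blinfun_apply (fx q t) X
      = X$1 *\<^sub>R (t ^ m *\<^sub>R partial 1 g (squash t q)) + X$2 *\<^sub>R (t ^ Suc m *\<^sub>R partial 2 g (squash t q))"
    if "q \<in> ball 0 r" "t \<in> {0..1}" for q t X
    unfolding fx[OF that] frechet_partials[OF smooth_on_differentiable[OF g sq[OF that]]]
    by (simp add: squash_def algebra_simps)
  have c: "continuous_on (ball 0 r) (partial i g)" for i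
    by (intro smooth_on_continuous_on smooth_on_partial g)
  have contfx: "continuous_on (ball 0 r \<times> cbox 0 1) (\<lambda>(x, t). fx x t)"
  proof (rule continuous_on_blinfun_componentwise)
    fix i :: "real^2"
    have "continuous_on (ball 0 r \<times> cbox 0 1) (\<lambda>(q, t). i$1 *\<^sub>R (t ^ m *\<^sub>R partial 1 g (squash t q))
        + i$2 *\<^sub>R (t ^ Suc m *\<^sub>R partial 2 g (squash t q)))"
      using continuous_on_fibre_integrand[OF c[of 1], of m] continuous_on_fibre_integrand[OF c[of 2], of "Suc m"]
      unfolding split_beta by (intro continuous_on_add continuous_on_scaleR[OF continuous_on_const])
    then show "continuous_on (ball 0 r \<times> cbox 0 1) (\<lambda>x. blinfun_apply (case x of (x, t) \<Rightarrow> fx x t) i)"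
      by (rule continuous_on_cong[THEN iffD1, OF refl, rotated]) (auto simp: fx')
  qed
  have "((\<lambda>q. integral (cbox 0 1) (\<lambda>t::real. t ^ m *\<^sub>R g (squash t q))) has_derivative
      blinfun_apply (integral (cbox 0 1) (fx q))) (at q within ball 0 r)"
  proof (rule leibniz_rule)
    show "((\<lambda>q. t ^ m *\<^sub>R g (squash t q)) has_derivative blinfun_apply (fx q t)) (at q within ball 0 r)"
      if "q \<in> ball 0 r" "t \<in> cbox 0 1" for q t
      using d[of q t] fx[of q t] that by (auto intro: has_derivative_at_withinI)
    show "(\<lambda>t. t ^ m *\<^sub>R g (squash t q)) integrable_on cbox 0 1" if "q \<in> ball 0 r" for q
      using fibre_integrable[OF smooth_on_continuous_on[OF g] that] by simp
  qed (use contfx q in auto)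
  then have "(fibre_moment m g has_derivative blinfun_apply (integral {0..1} (fx q))) (at q)"
    using q by (simp add: fibre_moment_def[abs_def] at_within_open[OF _ open_ball])
  moreover have "blinfun_apply (integral {0..1} (fx q)) X
      = X$1 *\<^sub>R fibre_moment m (partial 1 g) q + X$2 *\<^sub>R fibre_moment (Suc m) (partial 2 g) q" for X
  proof -
    have "continuous_on {0..1} (\<lambda>t. (\<lambda>(x, t). fx x t) (q, t))"
      by (rule continuous_on_compose2[OF contfx]) (use q in \<open>auto intro!: continuous_intros\<close>)
    then have "fx q integrable_on {0..1}" by (simp add: integrable_continuous_real)
    then have "blinfun_apply (integral {0..1} (fx q)) X = integral {0..1} (\<lambda>t. blinfun_apply (fx q t) X)"
      by (rule blinfun_apply_integral)
    also have "\<dots> = integral {0..1} (\<lambda>t. X$1 *\<^sub>R (t ^ m *\<^sub>R partial 1 g (squash t q)) + X$2 *\<^sub>R (t ^ Suc m *\<^sub>R partial 2 g (squash t q)))"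
      by (rule integral_cong) (simp add: fx'[OF q] del: power_Suc scaleR_scaleR)
    also have "\<dots> = X$1 *\<^sub>R fibre_moment m (partial 1 g) q + X$2 *\<^sub>R fibre_moment (Suc m) (partial 2 g) q"
      unfolding fibre_moment_def
      by (subst integral_add)
        (auto simp del: power_Suc scaleR_scaleR intro!: integrable_cmul fibre_integrable[OF c q])
    finally show ?thesis .
  qed
  then have "blinfun_apply (integral {0..1} (fx q))
      = (\<lambda>X. X$1 *\<^sub>R fibre_moment m (partial 1 g) q + X$2 *\<^sub>R fibre_moment (Suc m) (partial 2 g) q)"
    by (rule ext)
  ultimately show ?thesis by simp
qed

lemma smooth_on_fibre_moment:
  fixes g :: "real^2 \<Rightarrow> 'b::euclidean_space"
  assumes "smooth_on (ball 0 r) g"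
  shows "smooth_on (ball 0 r) (fibre_moment m g)"
proof -
  have "Ck_on k (ball 0 r) (fibre_moment m g)" for k
    using assms
  proof (induction k arbitrary: m g)
    case 0
    show ?case
      using integral_continuous_on_param[OF continuous_on_fibre_integrand[OF smooth_on_continuous_on[OF 0]], of m]
      by (simp add: fibre_moment_def[abs_def])
  next
    case (Suc k)
    show ?case
      by (rule Ck_on_SucI[OF _ has_derivative_fibre_moment[OF Suc.prems]])
        (auto intro!: Ck_on_add Ck_on_bounded_linear[OF bounded_linear_scaleR_right] Suc.IH
          smooth_on_partial[OF Suc.prems])
  qed
  then show ?thesis by (simp add: smooth_on_def)
qed

text \<open>Hadamard's lemma: the fundamental theorem of calculus on the segment from
  \<open>(u, 0)\<close> to \<open>(u, v)\<close>, parametrized over the unit interval, produces the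
  factor \<open>v\<close>. On a ball these segments stay in the domain.\<close>

lemma divide_by_second_coordinate:
  fixes f :: "real^2 \<Rightarrow> 'b::euclidean_space"
  assumes f: "smooth_on (ball 0 r) f" and zero: "\<And>q. q \<in> ball 0 r \<Longrightarrow> q$2 = 0 \<Longrightarrow> f q = 0"
  obtains h where "smooth_on (ball 0 r) h" "\<And>q. q \<in> ball 0 r \<Longrightarrow> f q = q$2 *\<^sub>R h q"
proof
  show "smooth_on (ball 0 r) (fibre_moment 0 (partial 2 f))"
    by (intro smooth_on_fibre_moment smooth_on_partial f)
  fix q :: "real^2" assume q: "q \<in> ball 0 r"
  have sq: "squash t q \<in> ball 0 r" if "t \<in> {0..1}" for t
    using that norm_squash[of t q] q by auto
  have "((\<lambda>t. q$2 *\<^sub>R partial 2 f (squash t q)) has_integral (f (squash 1 q) - f (squash 0 q))) {0..1}"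
  proof (rule fundamental_theorem_of_calculus)
    fix t :: real assume t: "t \<in> {0..1}"
    have "((\<lambda>t. squash t q) has_derivative (\<lambda>s. s *\<^sub>R (q$2 *\<^sub>R axis 2 1))) (at t within {0..1})"
      unfolding squash_alt by (auto intro!: derivative_eq_intros simp: algebra_simps)
    then have "((\<lambda>t. squash t q) has_vector_derivative (q$2 *\<^sub>R axis 2 1)) (at t within {0..1})"
      by (simp add: has_vector_derivative_def)
    then have "(f \<circ> (\<lambda>t. squash t q) has_vector_derivative frechet_derivative f (at (squash t q)) (q$2 *\<^sub>R axis 2 1))
        (at t within {0..1})"
      by (rule vector_derivative_diff_chain_within)
        (rule has_derivative_at_withinI[OF smooth_on_has_derivative[OF f sq[OF t]]])
    then show "((\<lambda>t. f (squash t q)) has_vector_derivative q$2 *\<^sub>R partial 2 f (squash t q)) (at t within {0..1})"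
      by (simp add: o_def frechet_partials[OF smooth_on_differentiable[OF f sq[OF t]]] axis_def)
  qed simp
  moreover have "f (squash 0 q) = 0"
    using sq[of 0] by (intro zero) (auto simp: squash_def)
  ultimately have "((\<lambda>t. q$2 *\<^sub>R partial 2 f (squash t q)) has_integral f q) {0..1}"
    by (simp add: squash_1)
  from integral_unique[OF this, symmetric] have "f q = integral {0..1} (\<lambda>t. q$2 *\<^sub>R partial 2 f (squash t q))" .
  then show "f q = q$2 *\<^sub>R fibre_moment 0 (partial 2 f) q"
    by (simp add: fibre_moment_def)
qed

section \<open>Symmetry of second derivatives\<close>

text \<open>The mean value theorem, applied once along \<open>X\<close> and once along
  \<open>Y\<close>, turns the second difference into a mixed derivative at some nearby point. The
  difference is symmetric in \<open>X\<close> and \<open>Y\<close>, the mixed derivative is not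
  visibly so.\<close>

lemma second_difference_mean_value:
  fixes f :: "'a::real_normed_vector \<Rightarrow> real"
  assumes f: "smooth_on S f" and s: "s > 0"
    and S: "\<And>x y. 0 \<le> x \<Longrightarrow> x \<le> s \<Longrightarrow> 0 \<le> y \<Longrightarrow> y \<le> s \<Longrightarrow> q + x *\<^sub>R X + y *\<^sub>R Y \<in> S"
  obtains x y where "0 \<le> x" "x \<le> s" "0 \<le> y" "y \<le> s"
    "f (q + s *\<^sub>R X + s *\<^sub>R Y) - f (q + s *\<^sub>R X) - f (q + s *\<^sub>R Y) + f q
      = s^2 * frechet_derivative (\<lambda>z. frechet_derivative f (at z) X) (at (q + x *\<^sub>R X + y *\<^sub>R Y)) Y"
proof -
  have D: "((\<lambda>x. g (a + x *\<^sub>R Z)) has_real_derivative frechet_derivative g (at (a + x *\<^sub>R Z)) Z) (at x)"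
    if "smooth_on S g" "a + x *\<^sub>R Z \<in> S" for g :: "'a \<Rightarrow> real" and a Z x
  proof -
    have "((\<lambda>x. a + x *\<^sub>R Z) has_derivative (\<lambda>h. h *\<^sub>R Z)) (at x)"
      by (auto intro!: derivative_eq_intros)
    from has_derivative_compose[OF this smooth_on_has_derivative[OF that]]
    show ?thesis
      by (simp add: has_field_derivative_def linear_scale[OF linear_frechet[OF smooth_on_differentiable[OF that]]] mult_commute_abs)
  qed
  let ?u = "\<lambda>x. f (q + s *\<^sub>R Y + x *\<^sub>R X) - f (q + x *\<^sub>R X)"
  let ?g = "\<lambda>z. frechet_derivative f (at z) X"
  have "\<exists>x>0. x < s \<and> ?u s - ?u 0 = (s - 0) * (?g (q + s *\<^sub>R Y + x *\<^sub>R X) - ?g (q + x *\<^sub>R X))"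
  proof (rule MVT2[OF s])
    fix x assume "0 \<le> x" "x \<le> s"
    then show "(?u has_real_derivative ?g (q + s *\<^sub>R Y + x *\<^sub>R X) - ?g (q + x *\<^sub>R X)) (at x)"
      using S[of x s] S[of x 0] s by (intro DERIV_diff D f) (auto simp: algebra_simps)
  qed
  then obtain x where x: "0 < x" "x < s" "?u s - ?u 0 = s * (?g (q + s *\<^sub>R Y + x *\<^sub>R X) - ?g (q + x *\<^sub>R X))"
    by auto
  have "\<exists>y>0. y < s \<and> ?g (q + x *\<^sub>R X + s *\<^sub>R Y) - ?g (q + x *\<^sub>R X + 0 *\<^sub>R Y)
      = (s - 0) * frechet_derivative ?g (at (q + x *\<^sub>R X + y *\<^sub>R Y)) Y"
    using x by (intro MVT2[OF s] D smooth_on_frechet f S) auto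
  then obtain y where "0 < y" "y < s" "?g (q + x *\<^sub>R X + s *\<^sub>R Y) - ?g (q + x *\<^sub>R X)
      = s * frechet_derivative ?g (at (q + x *\<^sub>R X + y *\<^sub>R Y)) Y" by auto
  with x show ?thesis
    by (intro that[of x y]) (auto simp: algebra_simps power2_eq_square)
qed

lemma frechet_derivative_commute_real:
  fixes f :: "'a::real_normed_vector \<Rightarrow> real"
  assumes S: "open S" and f: "smooth_on S f" and q: "q \<in> S"
  shows "frechet_derivative (\<lambda>z. frechet_derivative f (at z) X) (at q) Y
       = frechet_derivative (\<lambda>z. frechet_derivative f (at z) Y) (at q) X" (is "?A q = ?B q")
proof (rule ccontr)
  assume ne: "?A q \<noteq> ?B q"
  \<comment> \<open>Half of the gap: two mixed derivatives that stay within \<open>e\<close> of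
    their values at \<open>q\<close> cannot take a common value.\<close>
  define e where "e = \<bar>?A q - ?B q\<bar> / 2"
  have e: "e > 0" using ne by (simp add: e_def)
  have "isCont ?A q" "isCont ?B q"
    by (rule smooth_on_isCont[OF smooth_on_frechet[OF smooth_on_frechet[OF f]] q])+
  then have "\<forall>\<^sub>F z in nhds q. dist (?A z) (?A q) < e" "\<forall>\<^sub>F z in nhds q. dist (?B z) (?B q) < e"
    using e unfolding isCont_def tendsto_at_iff_tendsto_nhds[of ?A] tendsto_at_iff_tendsto_nhds[of ?B]
    by (auto dest: tendstoD)
  moreover have "\<forall>\<^sub>F z in nhds q. z \<in> S" using S q by (rule eventually_nhds_in_open)
  ultimately have "\<forall>\<^sub>F z in nhds q. dist (?A z) (?A q) < e \<and> dist (?B z) (?B q) < e \<and> z \<in> S"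
    by eventually_elim auto
  then obtain d where d: "d > 0" "\<And>z. dist z q < d \<Longrightarrow> dist (?A z) (?A q) < e \<and> dist (?B z) (?B q) < e \<and> z \<in> S"
    unfolding eventually_nhds_metric by blast
  \<comment> \<open>Small enough for the parallelogram spanned at \<open>q\<close> by
    \<open>s X\<close> and \<open>s Y\<close> to lie in the ball of radius \<open>d\<close>. The
    summand 1 keeps the denominator positive.\<close>
  define s where "s = d / (2 * (1 + norm X + norm Y))"
  have s: "s > 0" using d by (simp add: s_def add_pos_nonneg)
  have close: "dist (q + x *\<^sub>R X + y *\<^sub>R Y) q < d" if "0 \<le> x" "x \<le> s" "0 \<le> y" "y \<le> s" for x y
  proof -
    have "norm (x *\<^sub>R X + y *\<^sub>R Y) \<le> x * norm X + y * norm Y"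
      using that norm_triangle_ineq[of "x *\<^sub>R X" "y *\<^sub>R Y"] by simp
    also have "\<dots> \<le> s * norm X + s * norm Y"
      using that by (intro add_mono mult_right_mono) auto
    also have "\<dots> < s * (2 * (1 + norm X + norm Y))"
      using s by (simp add: algebra_simps add_nonneg_pos)
    also have "\<dots> = d"
      by (simp add: s_def add_pos_nonneg) (smt (verit) norm_ge_zero)
    finally show ?thesis by (simp add: dist_norm algebra_simps)
  qed
  have mem: "q + x *\<^sub>R X + y *\<^sub>R Y \<in> S" if "0 \<le> x" "x \<le> s" "0 \<le> y" "y \<le> s" for x y
    using d(2) close that by blast
  have mem': "q + x *\<^sub>R Y + y *\<^sub>R X \<in> S" if "0 \<le> x" "x \<le> s" "0 \<le> y" "y \<le> s" for x y
    using mem[OF that(3,4,1,2)] by (simp add: algebra_simps)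
  obtain x y where 1: "0 \<le> x" "x \<le> s" "0 \<le> y" "y \<le> s" "f (q + s *\<^sub>R X + s *\<^sub>R Y) - f (q + s *\<^sub>R X) - f (q + s *\<^sub>R Y) + f q
      = s^2 * ?A (q + x *\<^sub>R X + y *\<^sub>R Y)"
    by (rule second_difference_mean_value[OF f s, of q X Y]) (use mem in blast)+
  obtain x' y' where 2: "0 \<le> x'" "x' \<le> s" "0 \<le> y'" "y' \<le> s" "f (q + s *\<^sub>R Y + s *\<^sub>R X) - f (q + s *\<^sub>R Y) - f (q + s *\<^sub>R X) + f q
      = s^2 * ?B (q + x' *\<^sub>R Y + y' *\<^sub>R X)"
    by (rule second_difference_mean_value[OF f s, of q Y X]) (use mem' in blast)+
  have "s^2 * ?A (q + x *\<^sub>R X + y *\<^sub>R Y) = s^2 * ?B (q + y' *\<^sub>R X + x' *\<^sub>R Y)"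
    using 1(5) 2(5) by (simp add: algebra_simps)
  then have "?A (q + x *\<^sub>R X + y *\<^sub>R Y) = ?B (q + y' *\<^sub>R X + x' *\<^sub>R Y)" using s by simp
  moreover have "\<bar>?A (q + x *\<^sub>R X + y *\<^sub>R Y) - ?A q\<bar> < e" "\<bar>?B (q + y' *\<^sub>R X + x' *\<^sub>R Y) - ?B q\<bar> < e"
    using d(2)[OF close[OF 1(1-4)]] d(2)[OF close[OF 2(3,4,1,2)]] by (simp_all add: dist_real_def)
  ultimately have "\<bar>?A q - ?B q\<bar> < e + e" by (smt (verit))
  then show False by (simp add: e_def)
qed

lemma frechet_derivative_inner_left:
  assumes "f differentiable (at x)"
  shows "frechet_derivative (\<lambda>x. f x \<bullet> c) (at x) X = frechet_derivative f (at x) X \<bullet> c"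
  by (subst frechet_derivative_eqI[OF has_derivative_inner_left[OF has_derivative_frechet[OF assms]]]) simp

lemma frechet_derivative_commute:
  fixes f :: "'a::real_normed_vector \<Rightarrow> 'b::euclidean_space"
  assumes S: "open S" and f: "smooth_on S f" and q: "q \<in> S"
  shows "frechet_derivative (\<lambda>z. frechet_derivative f (at z) X) (at q) Y
       = frechet_derivative (\<lambda>z. frechet_derivative f (at z) Y) (at q) X"
proof (rule euclidean_eqI)
  fix c :: 'b
  have *: "frechet_derivative (\<lambda>z. frechet_derivative (\<lambda>x. f x \<bullet> c) (at z) X) (at q) Y
      = frechet_derivative (\<lambda>z. frechet_derivative f (at z) X) (at q) Y \<bullet> c" for X Y
  proof -
    have "frechet_derivative (\<lambda>z. frechet_derivative (\<lambda>x. f x \<bullet> c) (at z) X) (at q)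
      = frechet_derivative (\<lambda>z. frechet_derivative f (at z) X \<bullet> c) (at q)"
      by (rule frechet_derivative_cong_open[OF S q])
        (simp add: frechet_derivative_inner_left smooth_on_differentiable[OF f])
    then show ?thesis
      by (simp add: frechet_derivative_inner_left[OF smooth_on_differentiable[OF smooth_on_frechet[OF f] q]])
  qed
  have "smooth_on S (\<lambda>x. f x \<bullet> c)"
    by (intro smooth_intros S f)
  from frechet_derivative_commute_real[OF S this q, of X Y]
  show "frechet_derivative (\<lambda>z. frechet_derivative f (at z) X) (at q) Y \<bullet> c
       = frechet_derivative (\<lambda>z. frechet_derivative f (at z) Y) (at q) X \<bullet> c"
    by (simp only: *)
qed

section \<open>Local diffeomorphisms of the plane\<close>

definition jacobian :: "(real^2 \<Rightarrow> real^2) \<Rightarrow> real^2 \<Rightarrow> real" where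
  "jacobian f q = partial 1 f q $ 1 * partial 2 f q $ 2 - partial 2 f q $ 1 * partial 1 f q $ 2"

lemma smooth_on_jacobian: "open S \<Longrightarrow> smooth_on S f \<Longrightarrow> smooth_on S (jacobian f)"
  unfolding jacobian_def[abs_def] by (intro smooth_intros)

text \<open>Cramer's rule for the inverse of the derivative. Its dependence on \<open>q\<close> is
  explicit, so its smoothness can be read off.\<close>

definition jacobian_inverse :: "(real^2 \<Rightarrow> real^2) \<Rightarrow> real^2 \<Rightarrow> real^2 \<Rightarrow> real^2" where
  "jacobian_inverse f q X = vector
     [(partial 2 f q $ 2 * X$1 - partial 2 f q $ 1 * X$2) / jacobian f q,
      (partial 1 f q $ 1 * X$2 - partial 1 f q $ 2 * X$1) / jacobian f q]"

lemma bounded_linear_jacobian_inverse: "bounded_linear (jacobian_inverse f q)"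
  by (rule linear_conv_bounded_linear[THEN iffD1])
    (auto intro!: linearI simp: jacobian_inverse_def vec_eq_iff forall_2 add_divide_distrib diff_divide_distrib algebra_simps)

lemma jacobian_inverse:
  assumes "f differentiable (at q)" "jacobian f q \<noteq> 0"
  shows "jacobian_inverse f q (frechet_derivative f (at q) X) = X"
    and "frechet_derivative f (at q) (jacobian_inverse f q X) = X"
proof -
  have J: "jacobian f q * inverse (jacobian f q) = 1" using assms(2) by simp
  show "jacobian_inverse f q (frechet_derivative f (at q) X) = X"
    "frechet_derivative f (at q) (jacobian_inverse f q X) = X"
    using J unfolding frechet_partials[OF assms(1)] jacobian_inverse_def vec_eq_iff forall_2 divide_inverse
    by (simp_all add: jacobian_def) algebra+
qed

lemma inj_frechet_iff_jacobian:
  assumes "f differentiable (at q)"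
  shows "inj (frechet_derivative f (at q)) \<longleftrightarrow> jacobian f q \<noteq> 0"
proof
  assume inj: "inj (frechet_derivative f (at q))"
  show "jacobian f q \<noteq> 0"
  proof
    assume J: "jacobian f q = 0"
    have lin: "linear (frechet_derivative f (at q))" by (rule linear_frechet[OF assms])
    have 0: "X = 0" if "frechet_derivative f (at q) X = 0" for X
      using injD[OF inj, of X 0] that linear_0[OF lin] by simp
    \<comment> \<open>When the Jacobian vanishes, the columns of the adjugate matrix lie in the
      kernel (here up to sign). Injectivity makes them zero, hence the whole derivative, and then
      any vector is in the kernel.\<close>
    have "(vector [partial 2 f q $ 2, - partial 1 f q $ 2] :: real^2) = 0"
      by (rule 0) (use J in \<open>simp add: frechet_partials[OF assms] vec_eq_iff forall_2 jacobian_def algebra_simps\<close>)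
    moreover have "(vector [partial 2 f q $ 1, - partial 1 f q $ 1] :: real^2) = 0"
      by (rule 0) (use J in \<open>simp add: frechet_partials[OF assms] vec_eq_iff forall_2 jacobian_def algebra_simps\<close>)
    ultimately have p: "partial 1 f q = 0" "partial 2 f q = 0"
      by (auto simp: vec_eq_iff forall_2)
    have "(axis 1 1 :: real^2) = 0" by (rule 0) (simp add: frechet_partials[OF assms] p)
    then show False by simp
  qed
next
  assume "jacobian f q \<noteq> 0"
  then show "inj (frechet_derivative f (at q))"
    by (metis assms injI jacobian_inverse(1))
qed

text \<open>The inverse function theorem yields a differentiable inverse \<open>g\<close> only. Its
  derivative is \<open>jacobian_inverse f\<close> evaluated at \<open>g\<close>, so each order of
  smoothness of \<open>g\<close> gives the next one.\<close>

lemma local_diffeo: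
  fixes f :: "real^2 \<Rightarrow> real^2"
  assumes S: "open S" and f: "smooth_on S f" and x0: "x0 \<in> S" and J: "jacobian f x0 \<noteq> 0"
  obtains V where "open V" "x0 \<in> V" "V \<subseteq> S" "diffeo_on V (f ` V) f"
proof -
  have cJ: "continuous_on S (jacobian f)"
    by (intro smooth_on_continuous_on smooth_on_jacobian S f)
  define T where "T = S \<inter> jacobian f -` (- {0})"
  have T: "open T" "T \<subseteq> S" "x0 \<in> T"
    unfolding T_def using continuous_open_preimage[OF cJ S, of "- {0}"] x0 J by auto
  have JT: "jacobian f q \<noteq> 0" if "q \<in> T" for q using that by (simp add: T_def)
  define f' where "f' q = Blinfun (frechet_derivative f (at q))" for q
  have f': "blinfun_apply (f' q) = frechet_derivative f (at q)" if "q \<in> T" for q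
    unfolding f'_def
    by (rule bounded_linear_Blinfun_apply[OF has_derivative_bounded_linear[OF smooth_on_has_derivative[OF f]]])
      (use that T in auto)
  have der: "(f has_derivative blinfun_apply (f' q)) (at q)" if "q \<in> T" for q
    unfolding f'[OF that] using smooth_on_has_derivative[OF f] that T by auto
  have cont: "continuous_on T f'"
  proof (rule continuous_on_blinfun_componentwise)
    fix i :: "real^2"
    have "continuous_on T (\<lambda>x. frechet_derivative f (at x) i)"
      by (intro smooth_on_continuous_on smooth_on_frechet smooth_on_subset[OF f] T)
    then show "continuous_on T (\<lambda>x. blinfun_apply (f' x) i)"
      by (rule continuous_on_cong[THEN iffD1, OF refl, rotated]) (simp add: f')
  qed
  have inv: "Blinfun (jacobian_inverse f x0) o\<^sub>L f' x0 = id_blinfun"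
  proof (rule blinfun_eqI)
    show "blinfun_apply (Blinfun (jacobian_inverse f x0) o\<^sub>L f' x0) i = blinfun_apply id_blinfun i" for i
      using jacobian_inverse(1)[OF smooth_on_differentiable[OF f x0] J] T(3)
      by (simp add: bounded_linear_Blinfun_apply[OF bounded_linear_jacobian_inverse] f')
  qed
  obtain V W g g' where V: "open V" "V \<subseteq> T" "x0 \<in> V" "open W" "homeomorphism V W f g"
    and g': "\<And>y. y \<in> W \<Longrightarrow> (g has_derivative g' y) (at y)"
      "\<And>y. y \<in> W \<Longrightarrow> g' y = inv (blinfun_apply (f' (g y)))"
    proof (rule inverse_function_theorem[OF T(1) der cont T(3) inv])
    fix V W g g'
    assume "open V" "V \<subseteq> T" "x0 \<in> V" "open W" "homeomorphism V W f g"
      "\<And>y. y \<in> W \<Longrightarrow> (g has_derivative g' y) (at y)"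
      "\<And>y. y \<in> W \<Longrightarrow> g' y = inv (blinfun_apply (f' (g y)))"
    then show thesis by (rule that)
  qed
  have VW: "f ` V = W" "g ` W = V" "\<And>x. x \<in> V \<Longrightarrow> g (f x) = x" "\<And>y. y \<in> W \<Longrightarrow> f (g y) = y"
    using V(5) by (auto simp: homeomorphism_def)
  have g'_eq: "g' y = jacobian_inverse f (g y)" if "y \<in> W" for y
  proof -
    have gy: "g y \<in> T" using VW that V by auto
    then have d: "f differentiable (at (g y))" using T smooth_on_differentiable[OF f] by auto
    show ?thesis
      unfolding g'(2)[OF that] f'[OF gy]
      by (rule inv_unique_comp) (auto simp: fun_eq_iff jacobian_inverse[OF d JT[OF gy]])
  qed
  have smJ: "smooth_on T (\<lambda>q. jacobian_inverse f q X)" for X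
    unfolding jacobian_inverse_def
    by (intro smooth_on_vector2 smooth_intros smooth_on_jacobian T smooth_on_subset[OF f] JT)
  have "Ck_on k W g" for k
  proof (induction k)
    case 0
    then show ?case using V(5) by (simp add: homeomorphism_def)
  next
    case (Suc k)
    show ?case
    proof (rule Ck_on_SucI[OF V(4) g'(1)])
      fix X
      have "Ck_on k W (\<lambda>y. jacobian_inverse f (g y) X)"
        by (rule Ck_on_compose[OF V(4) T(1) _ Suc]) (use smJ VW V in \<open>auto simp: smooth_on_def\<close>)
      then show "Ck_on k W (\<lambda>x. g' x X)"
        by (rule Ck_on_cong[OF V(4), rotated]) (simp add: g'_eq)
    qed
  qed
  then have "smooth_on W g" by (simp add: smooth_on_def)
  then have "diffeo_on V (f ` V) f"
    unfolding diffeo_on_def using V VW smooth_on_subset[OF f] T by (auto intro!: exI[of _ g])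
  then show ?thesis using that V T by blast
qed

section \<open>Antiderivatives, passage to the axis by density, quadratic equations, vector
  algebra\<close>

lemma smooth_antiderivative:
  fixes m :: "real \<Rightarrow> real"
  assumes m: "smooth_on {-r<..<r} m" and d: "0 < d" "d < r"
  obtains A where "smooth_on {-d<..<d} A" "\<And>x. x \<in> {-d<..<d} \<Longrightarrow> (A has_real_derivative m x) (at x)" "A 0 = 0"
proof -
  have "continuous_on {-d..d} m"
    by (rule continuous_on_subset[OF smooth_on_continuous_on[OF m]]) (use d in auto)
  then obtain g where g: "\<And>x. x \<in> {-d..d} \<Longrightarrow> (g has_vector_derivative m x) (at x within {-d..d})"
    using antiderivative_continuous by blast
  have D: "(g has_real_derivative m x) (at x)" if "x \<in> {-d<..<d}" for x
  proof -
    have "(g has_real_derivative m x) (at x within {-d<..<d})"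
      unfolding has_real_derivative_iff_has_vector_derivative
      by (rule has_vector_derivative_within_subset[OF g]) (use that in auto)
    then show ?thesis using that by (simp add: at_within_open[OF _ open_greaterThanLessThan])
  qed
  have D': "((\<lambda>x. g x - g 0) has_real_derivative m x) (at x)" if "x \<in> {-d<..<d}" for x
    using D[OF that] by (auto intro!: derivative_eq_intros)
  have "smooth_on {-d<..<d} (\<lambda>x. g x - g 0)"
  proof (rule smooth_onI_derivative[OF _ has_field_derivative_imp_has_derivative[OF D']])
    have "smooth_on {-d<..<d} m" by (rule smooth_on_subset[OF m]) (use d in auto)
    then show "smooth_on {-d<..<d} (\<lambda>x. m x * X)" for X by (intro smooth_intros) auto
  qed auto
  with that D' show ?thesis by simp
qed

lemma open_contains_off_axis:
  fixes q :: "real^2"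
  assumes "open V" "q \<in> V"
  obtains q' where "q' \<in> V" "q'$2 \<noteq> 0"
proof (cases "q$2 = 0")
  case True
  obtain d where d: "d > 0" "ball q d \<subseteq> V" using assms open_contains_ball by blast
  have "q + (d / 2) *\<^sub>R axis 2 1 \<in> ball q d"
    using d by (simp add: dist_norm norm_axis_1)
  with d True that[of "q + (d / 2) *\<^sub>R axis 2 1"] show ?thesis by (auto simp: axis_def)
qed (use assms that in auto)

text \<open>Points with \<open>v \<noteq> 0\<close> are dense in an open set. This carries
  identities known at regular points over to the singular curve.\<close>

lemma zero_off_axis_imp_zero:
  fixes f :: "real^2 \<Rightarrow> 'a::real_normed_vector"
  assumes V: "open V" and f: "continuous_on V f" and z: "\<And>q. q \<in> V \<Longrightarrow> q$2 \<noteq> 0 \<Longrightarrow> f q = 0"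
    and q: "q \<in> V"
  shows "f q = 0"
proof (rule ccontr)
  assume "f q \<noteq> 0"
  then have "open (V \<inter> f -` (- {0}))" "q \<in> V \<inter> f -` (- {0})"
    using continuous_open_preimage[OF f V, of "- {0}"] q by auto
  then obtain q' where "q' \<in> V \<inter> f -` (- {0})" "q'$2 \<noteq> 0" by (rule open_contains_off_axis)
  then show False using z by auto
qed

lemma frechet_derivative_inner:
  assumes "f differentiable (at x)" "g differentiable (at x)"
  shows "frechet_derivative (\<lambda>x. f x \<bullet> g x) (at x) X
    = f x \<bullet> frechet_derivative g (at x) X + frechet_derivative f (at x) X \<bullet> g x"
  by (subst frechet_derivative_eqI[OF has_derivative_inner[OF has_derivative_frechet[OF assms(1)] has_derivative_frechet[OF assms(2)]]]) simp

text \<open>Vieta's formulas from a set of roots, which does not record multiplicities. With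
  \<open>x\<close> also \<open>b / a - x\<close> is a root; if it equals \<open>x\<close>, the
  polynomial is \<open>a * (k - x)^2\<close> and \<open>y\<close> equals \<open>x\<close>
  too.\<close>

lemma quadratic_roots_pair:
  fixes a b c x y :: real
  assumes "{k. a * k^2 - b * k + c = 0} = {x, y}" "a \<noteq> 0"
  shows "a * x * y = c" "a * (x + y) = b"
proof -
  have x: "a * x^2 - b * x + c = 0" and y: "a * y^2 - b * y + c = 0" using assms(1) by blast+
  define z where "z = b / a - x"
  have az: "a * z = b - a * x" using assms(2) by (simp add: z_def right_diff_distrib)
  have "a * (a * z^2 - b * z + c) = (a * z)^2 - b * (a * z) + a * c"
    by (simp add: algebra_simps power2_eq_square)
  also have "\<dots> = a * (a * x^2 - b * x + c)" unfolding az by (simp add: algebra_simps power2_eq_square)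
  finally have "a * z^2 - b * z + c = 0" using x assms(2) by simp
  then have "z = x \<or> z = y" using assms(1) by blast
  moreover have "z = x \<Longrightarrow> y = x"
  proof -
    assume "z = x"
    then have b: "b = 2 * a * x" using az by simp
    have "a * (y - x)^2 = (a * y^2 - b * y + c) - (a * x^2 - b * x + c)"
      unfolding b by (simp add: algebra_simps power2_eq_square)
    then show "y = x" using x y assms(2) by simp
  qed
  ultimately have "z = y" by blast
  then show s: "a * (x + y) = b" using az by (simp add: algebra_simps)
  have "c = b * x - a * x^2" using x by simp
  then show "a * x * y = c" unfolding s[symmetric] by (simp add: algebra_simps power2_eq_square)
qed

text \<open>The first root is in rationalized form: it has no \<open>a\<close> in its denominator
  and remains smooth as \<open>a\<close> tends to 0, provided that the sign \<open>s\<close> keeps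
  \<open>B + s * R\<close> away from 0.\<close>

lemma quadratic_roots:
  fixes a B C R s k :: real
  assumes s: "s^2 = 1" and a: "a \<noteq> 0" and R: "R^2 = B^2 - 4 * a * C" and ne: "B + s * R \<noteq> 0"
  shows "a * k^2 - B * k + C = 0 \<longleftrightarrow> k = 2 * C / (B + s * R) \<or> k = (B + s * R) / (2 * a)"
proof -
  let ?t = "B + s * R"
  have "4 * a * C = B^2 - s^2 * R^2" using R s by simp
  then have "4 * a * C = ?t * (2 * B - ?t)" by (simp add: algebra_simps power2_eq_square)
  then have "2 * (a * k^2 - B * k + C) * ?t = (k * ?t - 2 * C) * (2 * a * k - ?t)"
    by algebra
  then have "a * k^2 - B * k + C = 0 \<longleftrightarrow> k * ?t = 2 * C \<or> 2 * a * k = ?t"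
    using ne by (metis eq_iff_diff_eq_0 mult_eq_0_iff zero_neq_numeral)
  then show ?thesis using ne a by (auto simp: field_simps)
qed

text \<open>Up to the triple product, the cross products of \<open>a\<close>, \<open>b\<close>,
  \<open>c\<close> form the dual basis; \<open>x\<close> is expanded in it.\<close>

lemma eq_zero_if_orthogonal_to_basis:
  fixes x :: "real^3"
  assumes "cross3 a b \<bullet> c \<noteq> 0" "x \<bullet> a = 0" "x \<bullet> b = 0" "x \<bullet> c = 0"
  shows "x = 0"
proof -
  have "(cross3 a b \<bullet> c) *\<^sub>R x = (x \<bullet> a) *\<^sub>R cross3 b c + (x \<bullet> b) *\<^sub>R cross3 c a + (x \<bullet> c) *\<^sub>R cross3 a b"
    by (simp add: cross3_simps forall_3)
  then show ?thesis using assms by simp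
qed

lemma signed_area_cross: "signed_area F N q = cross3 (partial 1 F q) (partial 2 F q) \<bullet> N q"
  unfolding signed_area_def by (metis cross_triple dot_cross_det inner_commute)

lemma smooth_on_signed_area:
  "open S \<Longrightarrow> smooth_on S F \<Longrightarrow> smooth_on S N \<Longrightarrow> smooth_on S (signed_area F N)"
  unfolding signed_area_cross[abs_def] by (intro smooth_intros)

text \<open>Symmetry of the second fundamental form, valid at singular points too. Differentiating
  \<open>df(X) \<bullet> N = 0\<close> along \<open>Y\<close> expresses
  \<open>df(X) \<bullet> dN(Y)\<close> through the second derivative of \<open>F\<close>, whose two
  directions commute.\<close>

lemma tangential_symmetric:
  fixes F N :: "real^2 \<Rightarrow> real^3"
  assumes V: "open V" and F: "smooth_on V F" and N: "smooth_on V N"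
    and T: "\<And>q X. q \<in> V \<Longrightarrow> frechet_derivative F (at q) X \<bullet> N q = 0" and q: "q \<in> V"
  shows "frechet_derivative F (at q) X \<bullet> frechet_derivative N (at q) Y
       = frechet_derivative F (at q) Y \<bullet> frechet_derivative N (at q) X"
proof -
  have *: "frechet_derivative F (at q) X \<bullet> frechet_derivative N (at q) Y
      = - (frechet_derivative (\<lambda>z. frechet_derivative F (at z) X) (at q) Y \<bullet> N q)" for X Y
  proof -
    have "frechet_derivative (\<lambda>z. frechet_derivative F (at z) X \<bullet> N z) (at q) = frechet_derivative (\<lambda>z. 0) (at q)"
      by (rule frechet_derivative_cong_open[OF V q]) (rule T)
    then have "frechet_derivative (\<lambda>z. frechet_derivative F (at z) X \<bullet> N z) (at q) Y = 0" by simp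
    then show ?thesis
      by (subst (asm) frechet_derivative_inner)
        (auto intro: smooth_on_differentiable[OF smooth_on_frechet[OF F] q] smooth_on_differentiable[OF N q])
  qed
  show ?thesis
    unfolding *[of X Y] *[of Y X] frechet_derivative_commute[OF V F q, of X Y] ..
qed

lemma unit_derivative_orthogonal:
  fixes N :: "'a::real_normed_vector \<Rightarrow> 'b::real_inner"
  assumes V: "open V" and N: "N differentiable (at q)" and n: "\<And>q. q \<in> V \<Longrightarrow> norm (N q) = 1" and q: "q \<in> V"
  shows "frechet_derivative N (at q) X \<bullet> N q = 0"
proof -
  have "frechet_derivative (\<lambda>z. N z \<bullet> N z) (at q) = frechet_derivative (\<lambda>z. 1) (at q)"
    by (rule frechet_derivative_cong_open[OF V q]) (simp add: n dot_square_norm)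
  then have "frechet_derivative (\<lambda>z. N z \<bullet> N z) (at q) X = 0" by simp
  then show ?thesis by (subst (asm) frechet_derivative_inner) (auto simp: N inner_commute)
qed

section \<open>Principal curvatures in an adapted frame\<close>

text \<open>The common setting of both kinds: at a cuspidal edge \<open>\<eta> = \<partial>v\<close>
  and \<open>w = g\<close>, at a point of the second kind
  \<open>\<eta> = \<partial>u + e \<partial>v\<close> and \<open>w = h\<close>. The frame has
  determinant \<open>\<delta>\<close>, which is -1 in the first case and 1 in the second. The
  immersion property of a front enters through \<open>immersed\<close>.\<close>

locale adapted_frame =
  fixes V :: "(real^2) set" and F N :: "real^2 \<Rightarrow> real^3"
    and \<eta> \<tau> :: "real^2 \<Rightarrow> real^2" and w :: "real^2 \<Rightarrow> real^3" and \<delta> :: real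
  assumes open_V: "open V" and origin: "0 \<in> V"
    and smooth_F: "smooth_on V F" and smooth_N: "smooth_on V N"
    and smooth_frame: "smooth_on V \<eta>" "smooth_on V \<tau>" "smooth_on V w"
    and unit_N: "\<And>q. q \<in> V \<Longrightarrow> norm (N q) = 1"
    and tangent: "\<And>q X. q \<in> V \<Longrightarrow> frechet_derivative F (at q) X \<bullet> N q = 0"
    and singular_axis: "singular_set V F = {q \<in> V. q$2 = 0}"
    and frame_det: "\<And>q. q \<in> V \<Longrightarrow> \<eta> q $ 1 * \<tau> q $ 2 - \<eta> q $ 2 * \<tau> q $ 1 = \<delta>" and delta: "\<delta>^2 = 1"
    and null: "\<And>q. q \<in> V \<Longrightarrow> frechet_derivative F (at q) (\<eta> q) = q$2 *\<^sub>R w q"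
    and independent: "\<And>q. q \<in> V \<Longrightarrow> cross3 (w q) (frechet_derivative F (at q) (\<tau> q)) \<bullet> N q \<noteq> 0"
    and immersed: "frechet_derivative N (at 0) (\<eta> 0) \<noteq> 0"
begin

definition t where "t q = frechet_derivative F (at q) (\<tau> q)"
definition N\<^sub>\<eta> where "N\<^sub>\<eta> q = frechet_derivative N (at q) (\<eta> q)"
definition N\<^sub>\<tau> where "N\<^sub>\<tau> q = frechet_derivative N (at q) (\<tau> q)"
text \<open>The smooth quotient of \<open>signed_area F N\<close> by \<open>v\<close>; independence
  of \<open>w\<close> and \<open>t\<close> makes it nowhere zero.\<close>

definition area where "area q = \<delta> * (cross3 (w q) (t q) \<bullet> N q)"
definition gram where "gram q = (w q \<bullet> w q) * (t q \<bullet> t q) - (w q \<bullet> t q)^2"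
text \<open>\<open>gram\<close>, \<open>lin\<close> and \<open>cst\<close> are the overview's
  \<open>D\<close>, \<open>B\<close> and \<open>C\<close>. They arise from the determinant of
  \<open>II - k I\<close> in the frame after removal of one factor \<open>v\<close>, which is
  present because \<open>df(\<eta>) = v w\<close>.\<close>

definition lin where
  "lin q = - (w q \<bullet> N\<^sub>\<eta> q) * (t q \<bullet> t q) + q$2 * (- (w q \<bullet> w q) * (t q \<bullet> N\<^sub>\<tau> q) + 2 * (w q \<bullet> t q) * (w q \<bullet> N\<^sub>\<tau> q))"
definition cst where
  "cst q = (w q \<bullet> N\<^sub>\<eta> q) * (t q \<bullet> N\<^sub>\<tau> q) - q$2 * (w q \<bullet> N\<^sub>\<tau> q)^2"

lemma smooth_coeffs:
  "smooth_on V area" "smooth_on V gram" "smooth_on V lin" "smooth_on V cst"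
  unfolding area_def[abs_def] gram_def[abs_def] lin_def[abs_def] cst_def[abs_def] t_def N\<^sub>\<eta>_def N\<^sub>\<tau>_def
  by (intro smooth_intros smooth_frame smooth_F smooth_N open_V)+

lemma area_nonzero: "q \<in> V \<Longrightarrow> area q \<noteq> 0"
  using independent delta by (auto simp: area_def t_def)

lemma gram_pos: "q \<in> V \<Longrightarrow> gram q > 0"
proof -
  assume q: "q \<in> V"
  have "gram q = (norm (cross3 (w q) (t q)))^2"
    using norm_cross_dot[of "w q" "t q"] by (simp add: gram_def dot_square_norm power_mult_distrib)
  moreover have "cross3 (w q) (t q) \<noteq> 0" using area_nonzero[OF q] by (auto simp: area_def)
  ultimately show ?thesis by simp
qed

lemma signed_area_eq: "q \<in> V \<Longrightarrow> signed_area F N q = q$2 * area q"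
proof -
  assume q: "q \<in> V"
  have d: "F differentiable (at q)" by (rule smooth_on_differentiable[OF smooth_F q])
  have "cross3 (q$2 *\<^sub>R w q) (t q) = \<delta> *\<^sub>R cross3 (partial 1 F q) (partial 2 F q)"
    unfolding null[OF q, symmetric] t_def frechet_partials[OF d] frame_det[OF q, symmetric]
    by (simp add: cross3_simps forall_3)
  then have "q$2 * (cross3 (w q) (t q) \<bullet> N q) = \<delta> * signed_area F N q"
    by (simp add: signed_area_cross cross_mult_left flip: inner_scaleR_left)
  then have "q$2 * area q = \<delta>^2 * signed_area F N q" by (simp add: area_def power2_eq_square)
  then show ?thesis by (simp add: delta)
qed

lemma symmetric: "q \<in> V \<Longrightarrow> frechet_derivative F (at q) X \<bullet> frechet_derivative N (at q) Y
       = frechet_derivative F (at q) Y \<bullet> frechet_derivative N (at q) X"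
  by (rule tangential_symmetric[OF open_V smooth_F smooth_N tangent])

lemma characteristic_polynomial:
  assumes q: "q \<in> V"
  shows "det (second_form F N q - k *\<^sub>R first_form F q) = q$2 * (q$2 * gram q * k^2 - lin q * k + cst q)"
proof -
  have dF: "F differentiable (at q)" by (rule smooth_on_differentiable[OF smooth_F q])
  have dN: "N differentiable (at q)" by (rule smooth_on_differentiable[OF smooth_N q])
  \<comment> \<open>The matrix of the form \<open>II - k I\<close>. It is evaluated below on the
    pairs \<open>(\<eta>, \<eta>)\<close>, \<open>(\<eta>, \<tau>)\<close> and
    \<open>(\<tau>, \<tau>)\<close>; symmetry lets the first two be written with \<open>v w\<close>
    in place of \<open>df(\<eta>)\<close>.\<close>
  define Q where "Q i j = - (partial i F q \<bullet> partial j N q) - k * (partial i F q \<bullet> partial j F q)" for i j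
  have sym: "Q 2 1 = Q 1 2"
    unfolding Q_def partial_def using symmetric[OF q, of "axis 2 1" "axis 1 1"] by (simp add: inner_commute)
  have q\<eta>: "\<eta> q $1 * \<eta> q $1 * Q 1 1 + 2 * \<eta> q $1 * \<eta> q $ 2 * Q 1 2 + \<eta> q $ 2 * \<eta> q $ 2 * Q 2 2
      = q$2 * (- (w q \<bullet> N\<^sub>\<eta> q) - k * q$2 * (w q \<bullet> w q))" (is "?q1 = _")
  proof -
    have "?q1 = \<eta> q $1 * \<eta> q $1 * Q 1 1 + \<eta> q $1 * \<eta> q $ 2 * Q 1 2 + \<eta> q $1 * \<eta> q $ 2 * Q 2 1 + \<eta> q $ 2 * \<eta> q $ 2 * Q 2 2"
      by (simp add: sym)
    also have "\<dots> = - (frechet_derivative F (at q) (\<eta> q) \<bullet> N\<^sub>\<eta> q)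
        - k * (frechet_derivative F (at q) (\<eta> q) \<bullet> frechet_derivative F (at q) (\<eta> q))"
      unfolding Q_def N\<^sub>\<eta>_def frechet_partials[OF dF] frechet_partials[OF dN]
      by (simp add: inner_simps algebra_simps)
    finally show ?thesis by (simp add: null[OF q] algebra_simps)
  qed
  have q\<eta>\<tau>: "\<eta> q $1 * \<tau> q $1 * Q 1 1 + (\<eta> q $1 * \<tau> q $ 2 + \<eta> q $ 2 * \<tau> q $ 1) * Q 1 2 + \<eta> q $ 2 * \<tau> q $ 2 * Q 2 2
      = q$2 * (- (w q \<bullet> N\<^sub>\<tau> q) - k * (w q \<bullet> t q))" (is "?q2 = _")
  proof -
    have "?q2 = \<eta> q $1 * \<tau> q $1 * Q 1 1 + \<eta> q $1 * \<tau> q $ 2 * Q 1 2 + \<eta> q $ 2 * \<tau> q $ 1 * Q 2 1 + \<eta> q $ 2 * \<tau> q $ 2 * Q 2 2"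
      by (simp add: sym algebra_simps)
    also have "\<dots> = - (frechet_derivative F (at q) (\<eta> q) \<bullet> N\<^sub>\<tau> q)
        - k * (frechet_derivative F (at q) (\<eta> q) \<bullet> t q)"
      unfolding Q_def N\<^sub>\<tau>_def t_def frechet_partials[OF dF] frechet_partials[OF dN]
      by (simp add: inner_simps algebra_simps)
    finally show ?thesis by (simp add: null[OF q] algebra_simps)
  qed
  have q\<tau>: "\<tau> q $1 * \<tau> q $1 * Q 1 1 + 2 * \<tau> q $1 * \<tau> q $ 2 * Q 1 2 + \<tau> q $ 2 * \<tau> q $ 2 * Q 2 2
      = - (t q \<bullet> N\<^sub>\<tau> q) - k * (t q \<bullet> t q)" (is "?q3 = _")
  proof -
    have "?q3 = \<tau> q $1 * \<tau> q $1 * Q 1 1 + \<tau> q $1 * \<tau> q $ 2 * Q 1 2 + \<tau> q $1 * \<tau> q $ 2 * Q 2 1 + \<tau> q $ 2 * \<tau> q $ 2 * Q 2 2"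
      by (simp add: sym)
    also have "\<dots> = - (t q \<bullet> N\<^sub>\<tau> q) - k * (t q \<bullet> t q)"
      unfolding Q_def N\<^sub>\<tau>_def t_def frechet_partials[OF dF] frechet_partials[OF dN]
      by (simp add: inner_simps algebra_simps)
    finally show ?thesis .
  qed
  have "det (second_form F N q - k *\<^sub>R first_form F q) = Q 1 1 * Q 2 2 - Q 1 2 * Q 2 1"
    by (simp add: det_2 second_form_def first_form_def Q_def)
  \<comment> \<open>Passing from the coordinate basis to the frame multiplies the determinant of the
    form by \<open>\<delta>^2 = 1\<close>.\<close>
  also have "\<dots> = \<delta>^2 * (Q 1 1 * Q 2 2 - (Q 1 2)^2)" unfolding delta by (simp add: sym power2_eq_square)
  also have "\<dots> = ?q1 * ?q3 - ?q2^2"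
    unfolding frame_det[OF q, symmetric] by algebra
  also have "\<dots> = q$2 * (q$2 * gram q * k^2 - lin q * k + cst q)"
    unfolding q\<eta> q\<eta>\<tau> q\<tau> gram_def lin_def cst_def by algebra
  finally show ?thesis .
qed

lemma gauss_curvature_eq:
  assumes q: "q \<in> V" and v: "q$2 \<noteq> 0"
  shows "gauss_curvature F N q = cst q / (q$2 * gram q)"
proof -
  have a: "det (second_form F N q) = q$2 * cst q"
    using characteristic_polynomial[OF q, of 0] by simp
  have *: "det (second_form F N q - k *\<^sub>R first_form F q)
      = det (second_form F N q) - k * b + k^2 * det (first_form F q)"
    if "b = second_form F N q $ 1 $ 1 * first_form F q $ 2 $ 2 + second_form F N q $ 2 $ 2 * first_form F q $ 1 $ 1
      - second_form F N q $ 1 $ 2 * first_form F q $ 2 $ 1 - second_form F N q $ 2 $ 1 * first_form F q $ 1 $ 2" for k b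
    unfolding that by (simp add: det_2 algebra_simps power2_eq_square)
  define b where "b = second_form F N q $ 1 $ 1 * first_form F q $ 2 $ 2 + second_form F N q $ 2 $ 2 * first_form F q $ 1 $ 1
      - second_form F N q $ 1 $ 2 * first_form F q $ 2 $ 1 - second_form F N q $ 2 $ 1 * first_form F q $ 1 $ 2"
  \<comment> \<open>\<open>det I\<close> is the coefficient of \<open>k^2\<close> in the
    characteristic polynomial, recovered from the values at \<open>k = 0\<close>, \<open>1\<close>
    and \<open>-1\<close>.\<close>
  have "det (first_form F q) = q$2 * (q$2 * gram q)"
    using *[OF b_def, of 1] *[OF b_def, of "-1"] characteristic_polynomial[OF q, of 1]
      characteristic_polynomial[OF q, of "-1"] a by (simp add: algebra_simps)
  then show ?thesis using v by (simp add: gauss_curvature_def a)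
qed

lemma principal_curvatures_eq:
  assumes q: "q \<in> V" and v: "q$2 \<noteq> 0"
  shows "principal_curvatures F N q = {k. q$2 * gram q * k^2 - lin q * k + cst q = 0}"
  unfolding principal_curvatures_def characteristic_polynomial[OF q] using v by simp

text \<open>At the origin \<open>lin\<close> is
  \<open>-(w \<bullet> N\<^sub>\<eta>) (t \<bullet> t)\<close>. If it vanished,
  \<open>N\<^sub>\<eta>\<close> would be orthogonal to \<open>w\<close>, to \<open>t\<close> (by
  symmetry, as \<open>df(\<eta>) = 0\<close> there) and to the unit normal, hence zero, against
  \<open>immersed\<close>.\<close>

lemma lin_origin: "lin 0 \<noteq> 0"
proof -
  have t0: "t 0 \<noteq> 0" using area_nonzero[OF origin] by (auto simp: area_def)
  have "w 0 \<bullet> N\<^sub>\<eta> 0 \<noteq> 0"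
  proof
    assume w: "w 0 \<bullet> N\<^sub>\<eta> 0 = 0"
    have "N\<^sub>\<eta> 0 = 0"
    proof (rule eq_zero_if_orthogonal_to_basis)
      show "cross3 (w 0) (t 0) \<bullet> N 0 \<noteq> 0" using independent[OF origin] by (simp add: t_def)
      show "N\<^sub>\<eta> 0 \<bullet> w 0 = 0" using w by (simp add: inner_commute)
      show "N\<^sub>\<eta> 0 \<bullet> t 0 = 0"
        using symmetric[OF origin, of "\<tau> 0" "\<eta> 0"] null[OF origin] by (simp add: N\<^sub>\<eta>_def t_def inner_commute)
      show "N\<^sub>\<eta> 0 \<bullet> N 0 = 0"
        unfolding N\<^sub>\<eta>_def
        by (rule unit_derivative_orthogonal[OF open_V smooth_on_differentiable[OF smooth_N origin] unit_N origin])
    qed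
    then show False using immersed by (simp add: N\<^sub>\<eta>_def)
  qed
  then show ?thesis using t0 by (simp add: lin_def)
qed

lemma principal_curvature_pair_exists:
  obtains V' \<kappa> \<kappa>h where "open V'" "0 \<in> V'" "V' \<subseteq> V"
    "principal_curvature_pair V' F N \<kappa> \<kappa>h"
proof -
  define s where "s = sgn (lin 0)"
  have s: "s^2 = 1" using lin_origin by (simp add: s_def sgn_if)
  define d where "d q = (lin q)^2 - 4 * (q$2 * gram q) * cst q" for q
  have sd: "smooth_on V d"
    unfolding d_def[abs_def] by (intro smooth_intros smooth_coeffs open_V)
  \<comment> \<open>At the origin the discriminant \<open>d\<close> is \<open>(lin 0)^2\<close>, so
    both open conditions hold there. Since \<open>s * lin\<close> is positive, nothing cancels in
    \<open>m = lin + s * R\<close>, which therefore has no zero on \<open>V'\<close>.\<close>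
  define V' where "V' = {q \<in> V. s * lin q > 0} \<inter> {q \<in> V. d q > 0}"
  have V': "open V'" "0 \<in> V'" "V' \<subseteq> V"
  proof -
    have "continuous_on V (\<lambda>q. s * lin q)" "continuous_on V d"
      by (intro smooth_on_continuous_on smooth_intros smooth_coeffs open_V sd)+
    from continuous_open_preimage[OF this(1) open_V open_greaterThan[of 0]]
      continuous_open_preimage[OF this(2) open_V open_greaterThan[of 0]]
    show "open V'" unfolding V'_def by (intro open_Int) (simp_all add: vimage_def Int_def)
    show "0 \<in> V'" "V' \<subseteq> V" using origin lin_origin
      by (auto simp: V'_def d_def s_def sgn_if)
  qed
  define R where "R q = sqrt (d q)" for q
  define m where "m q = lin q + s * R q" for q
  have R: "R q > 0" "(R q)^2 = d q" if "q \<in> V'" for q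
    using that by (auto simp: R_def V'_def)
  have m: "m q \<noteq> 0" if "q \<in> V'" for q
  proof -
    have "s * m q = s * lin q + s^2 * R q" by (simp add: m_def power2_eq_square algebra_simps)
    also have "\<dots> > 0" using that R[OF that] s by (simp add: V'_def)
    finally show ?thesis by auto
  qed
  have sm: "smooth_on V' m"
    unfolding m_def[abs_def] R_def
    by (intro smooth_intros V' smooth_on_subset[OF sd] smooth_on_subset[OF smooth_coeffs(3)])
      (auto simp: V'_def)
  define \<kappa> where "\<kappa> q = 2 * cst q / m q" for q
  \<comment> \<open>The other root is \<open>m / (2 v gram)\<close>; multiplication by
    \<open>\<lambda> = v area\<close> cancels its denominator \<open>v\<close>.\<close>
  define \<kappa>h where "\<kappa>h q = area q * m q / (2 * gram q)" for q
  have pos: "2 * gram q \<noteq> 0" if "q \<in> V'" for q using gram_pos[of q] that V' by auto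
  have sk: "smooth_on V' \<kappa>" "smooth_on V' \<kappa>h"
    unfolding \<kappa>_def[abs_def] \<kappa>h_def[abs_def]
    by (intro smooth_intros V'(1) sm m pos smooth_on_subset[OF smooth_coeffs(1) V'(3)]
        smooth_on_subset[OF smooth_coeffs(2) V'(3)] smooth_on_subset[OF smooth_coeffs(4) V'(3)]; assumption)+
  show ?thesis
  proof (rule that[OF V'])
    have sing: "q \<in> V" "q \<in> V'" "q$2 \<noteq> 0" if "q \<in> V' - singular_set V' F" for q
      using that V' singular_axis by (auto simp: singular_set_def)
    have "principal_curvatures F N q = {\<kappa> q, m q / (2 * (q$2 * gram q))}
        \<and> \<kappa>h q = signed_area F N q * (m q / (2 * (q$2 * gram q)))" if "q \<in> V' - singular_set V' F" for q
    proof -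
      note q = sing[OF that]
      have g: "gram q \<noteq> 0" using gram_pos[OF q(1)] by simp
      have "q$2 * gram q * k^2 - lin q * k + cst q = 0 \<longleftrightarrow> k = \<kappa> q \<or> k = m q / (2 * (q$2 * gram q))" for k
        unfolding \<kappa>_def m_def
        by (rule quadratic_roots[OF s]) (use q g R[OF q(2)] m[OF q(2)] in \<open>auto simp: d_def m_def\<close>)
      then have "principal_curvatures F N q = {\<kappa> q, m q / (2 * (q$2 * gram q))}"
        unfolding principal_curvatures_eq[OF q(1,3)] by blast
      moreover have "\<kappa>h q = signed_area F N q * (m q / (2 * (q$2 * gram q)))"
        using q(3) by (simp add: \<kappa>h_def signed_area_eq[OF q(1)])
      ultimately show ?thesis ..
    qed
    then show "principal_curvature_pair V' F N \<kappa> \<kappa>h"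
      unfolding principal_curvature_pair_def
      by (intro conjI[OF sk(1) conjI[OF sk(2)]] exI[of _ "\<lambda>q. m q / (2 * (q$2 * gram q))"] ballI)
  qed
qed

section \<open>Consequences for an arbitrary pair of principal curvatures\<close>

context
  fixes \<kappa> \<kappa>h
  assumes pair: "principal_curvature_pair V F N \<kappa> \<kappa>h"
begin

lemma smooth_pair: "smooth_on V \<kappa>" "smooth_on V \<kappa>h"
  using pair by (auto simp: principal_curvature_pair_def)

text \<open>Vieta's formulas for the product and the sum, multiplied by \<open>area\<close> and with
  \<open>v area \<kappa>t\<close> replaced by \<open>\<kappa>h\<close>. No quotient by
  \<open>v\<close> is left, so both identities extend to the axis by continuity.\<close>

lemma pair_identities_off_axis:
  assumes q: "q \<in> V" and v: "q$2 \<noteq> 0"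
  shows "\<kappa> q * \<kappa>h q * gram q = area q * cst q"
    and "q$2 * area q * gram q * \<kappa> q + gram q * \<kappa>h q = area q * lin q"
proof -
  obtain \<kappa>t where "principal_curvatures F N q = {\<kappa> q, \<kappa>t q}" and h: "\<kappa>h q = signed_area F N q * \<kappa>t q"
    using pair q v singular_axis unfolding principal_curvature_pair_def by blast
  then have "{k. q$2 * gram q * k^2 - lin q * k + cst q = 0} = {\<kappa> q, \<kappa>t q}"
    using principal_curvatures_eq[OF q v] by simp
  moreover have "q$2 * gram q \<noteq> 0" using v gram_pos[OF q] by simp
  ultimately have *: "q$2 * gram q * \<kappa> q * \<kappa>t q = cst q" "q$2 * gram q * (\<kappa> q + \<kappa>t q) = lin q"
    by (rule quadratic_roots_pair)+
  show "\<kappa> q * \<kappa>h q * gram q = area q * cst q"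
    "q$2 * area q * gram q * \<kappa> q + gram q * \<kappa>h q = area q * lin q"
    unfolding h signed_area_eq[OF q] *[symmetric] by (simp_all add: algebra_simps)
qed

lemma pair_identities:
  assumes q: "q \<in> V"
  shows "\<kappa> q * \<kappa>h q * gram q = area q * cst q"
    and "q$2 * area q * gram q * \<kappa> q + gram q * \<kappa>h q = area q * lin q"
proof -
  have c: "continuous_on V (\<lambda>q. \<kappa> q * \<kappa>h q * gram q - area q * cst q)"
    "continuous_on V (\<lambda>q. q$2 * area q * gram q * \<kappa> q + gram q * \<kappa>h q - area q * lin q)"
    by (intro smooth_on_continuous_on smooth_intros smooth_pair smooth_coeffs open_V)+
  have "\<kappa> q * \<kappa>h q * gram q - area q * cst q = 0"
    by (rule zero_off_axis_imp_zero[OF open_V c(1) _ q]) (simp add: pair_identities_off_axis)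
  moreover have "q$2 * area q * gram q * \<kappa> q + gram q * \<kappa>h q - area q * lin q = 0"
    by (rule zero_off_axis_imp_zero[OF open_V c(2) _ q]) (simp add: pair_identities_off_axis)
  ultimately show "\<kappa> q * \<kappa>h q * gram q = area q * cst q"
    "q$2 * area q * gram q * \<kappa> q + gram q * \<kappa>h q = area q * lin q" by simp_all
qed

lemma unbounded_curvature_nonzero: "\<kappa>h 0 \<noteq> 0"
  using pair_identities(2)[OF origin] area_nonzero[OF origin] lin_origin by auto

lemma area_gauss_curvature:
  assumes q: "q \<in> V" and v: "q$2 \<noteq> 0"
  shows "q$2 * area q * gauss_curvature F N q = \<kappa> q * \<kappa>h q"
  using pair_identities(1)[OF q] v gram_pos[OF q] by (simp add: gauss_curvature_eq[OF q v] field_simps)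

context
  fixes U
  assumes U: "open U" "0 \<in> U" "U \<subseteq> V" and bdd: "bounded (gauss_curvature F N ` (U - singular_set V F))"
begin

lemma curvature_product_zero_on_axis:
  assumes q: "q \<in> U" "q$2 = 0"
  shows "\<kappa> q * \<kappa>h q = 0"
proof -
  obtain M where M: "\<And>q. q \<in> U \<Longrightarrow> q$2 \<noteq> 0 \<Longrightarrow> \<bar>gauss_curvature F N q\<bar> \<le> M"
    using bdd U unfolding bounded_iff singular_axis by fastforce
  \<comment> \<open>The amount by which the estimate
    \<open>|\<kappa> \<kappa>h| \<le> |v area| M\<close> fails. Boundedness of \<open>K\<close>
    makes it zero off the axis, so by continuity also on the axis, where the right-hand side is
    0.\<close>
  let ?g = "\<lambda>q. max 0 (\<bar>\<kappa> q * \<kappa>h q\<bar> - \<bar>q$2 * area q\<bar> * M)"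
  have "continuous_on V (\<lambda>q. \<kappa> q * \<kappa>h q)" "continuous_on V (\<lambda>q. q$2 * area q)"
    by (intro smooth_on_continuous_on smooth_intros smooth_pair smooth_coeffs open_V)+
  then have "continuous_on V ?g" by (intro continuous_on_max continuous_on_diff continuous_on_rabs
      continuous_on_mult[OF _ continuous_on_const] continuous_on_const)
  then have "continuous_on U ?g" using U(3) by (rule continuous_on_subset)
  then have "?g q = 0"
  proof (rule zero_off_axis_imp_zero[OF U(1) _ _ q(1)])
    fix q assume "q \<in> U" "q$2 \<noteq> 0"
    then have "\<bar>\<kappa> q * \<kappa>h q\<bar> \<le> \<bar>q$2 * area q\<bar> * M"
      using M[of q] U(3) by (subst area_gauss_curvature[symmetric]) (auto simp: abs_mult mult_left_mono)
    then show "?g q = 0" by simp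
  qed
  then show ?thesis using q(2) by simp
qed

text \<open>Near the origin \<open>\<kappa>h\<close> has no zero, so the vanishing of the product is
  that of \<open>\<kappa>\<close>.\<close>

lemma vanishing_radius:
  obtains r where "r > 0" "ball 0 r \<subseteq> U" "\<And>q. q \<in> ball 0 r \<Longrightarrow> q$2 = 0 \<Longrightarrow> \<kappa> q = 0"
proof -
  have "continuous_on U \<kappa>h"
    using smooth_on_continuous_on[OF smooth_pair(2)] U continuous_on_subset by blast
  from continuous_open_preimage[OF this U(1), of "- {0}"]
  have "open (U \<inter> \<kappa>h -` (- {0}))" by auto
  moreover have "0 \<in> U \<inter> \<kappa>h -` (- {0})" using U unbounded_curvature_nonzero by auto
  ultimately obtain r where r: "r > 0" "ball 0 r \<subseteq> U \<inter> \<kappa>h -` (- {0})"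
    using open_contains_ball by blast
  have "\<kappa> q = 0" if "q \<in> ball 0 r" "q$2 = 0" for q
  proof -
    have "q \<in> U \<inter> \<kappa>h -` (- {0})" using that(1) r(2) by blast
    then show ?thesis using curvature_product_zero_on_axis[of q] that(2) by auto
  qed
  with that r show ?thesis by auto
qed

text \<open>With \<open>\<kappa> = v \<kappa>1\<close> the relation
  \<open>v area K = \<kappa> \<kappa>h\<close> becomes
  \<open>K = \<kappa>1 \<kappa>h / area\<close>, which is smooth across the axis. The constant
  \<open>c\<close> is \<open>\<kappa>1 0\<close>: the \<open>v\<close>-derivative of
  \<open>\<kappa>\<close> and, up to a nonzero factor, the value of \<open>K\<close> at the
  origin.\<close>

lemma gauss_curvature_extension:
  obtains r Kt c where "r > 0" "ball 0 r \<subseteq> U" "smooth_on (ball 0 r) Kt"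
    "\<And>q. q \<in> ball 0 r \<Longrightarrow> q$2 \<noteq> 0 \<Longrightarrow> Kt q = gauss_curvature F N q"
    "frechet_derivative \<kappa> (at 0) = (\<lambda>X. X$2 * c)" "Kt 0 = 0 \<longleftrightarrow> c = 0"
proof -
  obtain r where r: "r > 0" "ball 0 r \<subseteq> U" "\<And>q. q \<in> ball 0 r \<Longrightarrow> q$2 = 0 \<Longrightarrow> \<kappa> q = 0"
    using vanishing_radius by blast
  have rV: "ball 0 r \<subseteq> V" using r U by blast
  obtain \<kappa>1 where k: "smooth_on (ball 0 r) \<kappa>1" "\<And>q. q \<in> ball 0 r \<Longrightarrow> \<kappa> q = q$2 *\<^sub>R \<kappa>1 q"
    using divide_by_second_coordinate[OF smooth_on_subset[OF smooth_pair(1) rV] r(3)] by blast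
  define Kt where "Kt q = \<kappa>1 q * \<kappa>h q / area q" for q
  show ?thesis
  proof (rule that[OF r(1,2)])
    show "smooth_on (ball 0 r) Kt"
      unfolding Kt_def[abs_def] using area_nonzero rV
      by (intro smooth_intros k smooth_on_subset[OF smooth_pair(2) rV] smooth_on_subset[OF smooth_coeffs(1) rV]) auto
    show "Kt q = gauss_curvature F N q" if "q \<in> ball 0 r" "q$2 \<noteq> 0" for q
    proof -
      have q: "q \<in> V" using that rV by blast
      show ?thesis using area_gauss_curvature[OF q that(2)] k(2)[OF that(1)] that(2) area_nonzero[OF q]
        by (simp add: Kt_def field_simps)
    qed
    have 0: "(0::real^2) \<in> ball 0 r" using r by simp
    have "((\<lambda>q. q$2 *\<^sub>R \<kappa>1 q) has_derivative (\<lambda>X. X$2 * \<kappa>1 0)) (at 0)"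
      using smooth_on_has_derivative[OF k(1) 0]
      by (auto intro!: derivative_eq_intros bounded_linear_imp_has_derivative simp: bounded_linear_vec_nth)
    then have "(\<kappa> has_derivative (\<lambda>X. X$2 * \<kappa>1 0)) (at 0)"
      by (subst has_derivative_cong_open[OF open_ball 0 k(2)]) auto
    then show "frechet_derivative \<kappa> (at 0) = (\<lambda>X. X$2 * \<kappa>1 0)" by (rule frechet_derivative_eqI)
    show "Kt 0 = 0 \<longleftrightarrow> \<kappa>1 0 = 0"
      using unbounded_curvature_nonzero area_nonzero[OF origin] by (simp add: Kt_def)
  qed
qed

end

end

end

section \<open>Fronts in local coordinates\<close>

lemma diffeo_onE:
  assumes "diffeo_on V W \<phi>"
  obtains \<psi> where "open V" "open W" "smooth_on V \<phi>" "smooth_on W \<psi>" "\<phi> ` V = W" "\<psi> ` W = V"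
    "\<And>x. x \<in> V \<Longrightarrow> \<psi> (\<phi> x) = x" "\<And>y. y \<in> W \<Longrightarrow> \<phi> (\<psi> y) = y"
  using assms unfolding diffeo_on_def by blast

lemma diffeo_on_image_open:
  assumes "diffeo_on V W \<phi>" "open V'" "V' \<subseteq> V"
  shows "open (\<phi> ` V')"
proof -
  obtain \<psi> where p: "open W" "smooth_on W \<psi>" "\<phi> ` V = W" "\<And>x. x \<in> V \<Longrightarrow> \<psi> (\<phi> x) = x" "\<And>y. y \<in> W \<Longrightarrow> \<phi> (\<psi> y) = y"
    using diffeo_onE[OF assms(1)] by metis
  have "\<phi> ` V' = W \<inter> \<psi> -` V'"
    using p(3-5) assms(3) by (force simp: image_iff)
  then show ?thesis
    using continuous_open_preimage[OF smooth_on_continuous_on[OF p(2)] p(1) assms(2)] by simp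
qed

lemma diffeo_on_restrict:
  assumes "diffeo_on V W \<phi>" "open V'" "V' \<subseteq> V"
  shows "diffeo_on V' (\<phi> ` V') \<phi>"
proof -
  obtain \<psi> where p: "smooth_on V \<phi>" "smooth_on W \<psi>" "\<phi> ` V = W" "\<And>x. x \<in> V \<Longrightarrow> \<psi> (\<phi> x) = x" "\<And>y. y \<in> W \<Longrightarrow> \<phi> (\<psi> y) = y"
    using diffeo_onE[OF assms(1)] by metis
  have s: "\<phi> ` V' \<subseteq> W" using p assms by auto
  have i: "\<psi> ` \<phi> ` V' = V'" using p(4) assms(3) by (force simp: image_iff)
  show ?thesis
    unfolding diffeo_on_def
    using assms diffeo_on_image_open[OF assms] p s i smooth_on_subset[OF p(1)] smooth_on_subset[OF p(2) s]
    by (auto intro!: exI[of _ \<psi>])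
qed

lemma diffeo_on_compose:
  fixes \<rho> :: "real^2 \<Rightarrow> real^2" and \<phi> :: "real^2 \<Rightarrow> real^2"
  assumes r: "diffeo_on V' W' \<rho>" and p: "diffeo_on V W \<phi>" and "W' \<subseteq> V"
  shows "diffeo_on V' (\<phi> ` W') (\<phi> \<circ> \<rho>)"
proof -
  obtain \<rho>' where r': "open V'" "open W'" "smooth_on V' \<rho>" "smooth_on W' \<rho>'" "\<rho> ` V' = W'" "\<rho>' ` W' = V'"
    "\<And>x. x \<in> V' \<Longrightarrow> \<rho>' (\<rho> x) = x" "\<And>y. y \<in> W' \<Longrightarrow> \<rho> (\<rho>' y) = y"
    using diffeo_onE[OF r] by blast
  obtain \<psi> where p': "open V" "open W" "smooth_on V \<phi>" "smooth_on W \<psi>" "\<phi> ` V = W" "\<psi> ` W = V"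
    "\<And>x. x \<in> V \<Longrightarrow> \<psi> (\<phi> x) = x" "\<And>y. y \<in> W \<Longrightarrow> \<phi> (\<psi> y) = y"
    using diffeo_onE[OF p] by blast
  have o: "open (\<phi> ` W')" by (rule diffeo_on_image_open[OF p r'(2) assms(3)])
  have sub: "\<phi> ` W' \<subseteq> W" using p' assms(3) by auto
  have pw: "\<psi> (\<phi> x) = x" if "x \<in> W'" for x using that assms(3) p'(7) by blast
  have 1: "smooth_on V' (\<phi> \<circ> \<rho>)" unfolding o_def
    by (rule smooth_on_compose[OF r'(1) p'(1) _ r'(3) p'(3)]) (use r' assms in auto)
  have 2: "smooth_on (\<phi> ` W') (\<rho>' \<circ> \<psi>)" unfolding o_def
    by (rule smooth_on_compose[OF o r'(2) _ smooth_on_subset[OF p'(4) sub] r'(4)]) (auto simp: pw)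
  have i: "(\<rho>' \<circ> \<psi>) ` \<phi> ` W' = V'" unfolding r'(6)[symmetric] by (auto simp: image_iff pw)
  have i2: "(\<phi> \<circ> \<rho>) ` V' = \<phi> ` W'" using r'(5) by (auto simp: image_comp[symmetric])
  have ri: "\<rho> x \<in> W'" if "x \<in> V'" for x using that r'(5) by blast
  show ?thesis
    unfolding diffeo_on_def
  proof (intro conjI exI[of _ "\<rho>' \<circ> \<psi>"] ballI)
    show "(\<rho>' \<circ> \<psi>) ((\<phi> \<circ> \<rho>) x) = x" if "x \<in> V'" for x
      using that by (simp add: pw ri r'(7))
    show "(\<phi> \<circ> \<rho>) ((\<rho>' \<circ> \<psi>) y) = y" if "y \<in> \<phi> ` W'" for y
      using that by (auto simp: pw r'(8))
  qed (fact r'(1) o 1 i2 2 i)+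
qed

lemma coordinates_at_restrict:
  assumes "coordinates_at \<Sigma> p V \<phi>" "open V'" "V' \<subseteq> V" "0 \<in> V'"
  shows "coordinates_at \<Sigma> p V' \<phi>"
  using assms diffeo_on_restrict unfolding coordinates_at_def by blast

lemma coordinates_at_compose:
  assumes c: "coordinates_at \<Sigma> p V \<phi>" and r: "diffeo_on V' (\<rho> ` V') \<rho>" and s: "\<rho> ` V' \<subseteq> V" and 0: "0 \<in> V'" "\<rho> 0 = 0"
  shows "coordinates_at \<Sigma> p V' (\<phi> \<circ> \<rho>)"
  using diffeo_on_compose[OF r _ s, of "\<phi> ` V" \<phi>] c s 0 by (auto simp: coordinates_at_def image_comp)

text \<open>The rule \<open>det (A M A\<^sup>T) = (det A)\<^sup>2 det M\<close> for 2 by 2 matrices,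
  with \<open>M\<close> not assumed symmetric. It makes the Gaussian curvature independent of
  coordinates.\<close>

lemma bilinear_form_det:
  fixes a b c d x x' y y' :: real
  shows "(x * x * a + x * x' * b + x' * x * c + x' * x' * d) * (y * y * a + y * y' * b + y' * y * c + y' * y' * d)
    - (x * y * a + x * y' * b + x' * y * c + x' * y' * d) * (y * x * a + y * x' * b + y' * x * c + y' * x' * d)
    = (x * y' - y * x')^2 * (a * d - b * c)"
  by algebra

lemma not_inj_linearE:
  assumes "linear L" "\<not> inj L"
  obtains X where "X \<noteq> 0" "L X = 0"
  using assms linear_injective_0 by blast

section \<open>Pulling a front back by a chart\<close>

locale front_chart =
  fixes \<Sigma> :: "(real^2) set" and f \<nu> :: "real^2 \<Rightarrow> real^3" and p :: "real^2"
    and V :: "(real^2) set" and \<phi> :: "real^2 \<Rightarrow> real^2"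
  assumes front: "front \<Sigma> f \<nu>" and open_\<Sigma>: "open \<Sigma>" and chart: "coordinates_at \<Sigma> p V \<phi>"
begin

abbreviation "F \<equiv> f \<circ> \<phi>"
abbreviation "N \<equiv> \<nu> \<circ> \<phi>"

lemma smooth_f: "smooth_on \<Sigma> f" and smooth_\<nu>: "smooth_on \<Sigma> \<nu>"
  and unit_\<nu>: "\<And>q. q \<in> \<Sigma> \<Longrightarrow> norm (\<nu> q) = 1"
  and tangent_f: "\<And>q X. q \<in> \<Sigma> \<Longrightarrow> frechet_derivative f (at q) X \<bullet> \<nu> q = 0"
  using front by (auto simp: front_def frontal_def)

lemma open_V: "open V" and origin: "0 \<in> V" and \<phi>_0: "\<phi> 0 = p" and smooth_\<phi>: "smooth_on V \<phi>"
  and diffeo: "diffeo_on V (\<phi> ` V) \<phi>"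
  using chart by (auto simp: coordinates_at_def diffeo_on_def)

lemma \<phi>_in: "q \<in> V \<Longrightarrow> \<phi> q \<in> \<Sigma>"
  using chart by (auto simp: coordinates_at_def)

lemma smooth_F: "smooth_on V F" and smooth_N: "smooth_on V N"
  unfolding o_def using \<phi>_in
  by (auto intro!: smooth_on_compose[OF open_V open_\<Sigma> _ smooth_\<phi>] smooth_f smooth_\<nu>)

lemma derivative_F: "q \<in> V \<Longrightarrow> frechet_derivative F (at q) X = frechet_derivative f (at (\<phi> q)) (frechet_derivative \<phi> (at q) X)"
  and derivative_N: "q \<in> V \<Longrightarrow> frechet_derivative N (at q) X = frechet_derivative \<nu> (at (\<phi> q)) (frechet_derivative \<phi> (at q) X)"
  by (intro frechet_chain smooth_on_differentiable[OF smooth_\<phi>] smooth_on_differentiable[OF smooth_f]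
      smooth_on_differentiable[OF smooth_\<nu>] \<phi>_in; assumption)+

lemma unit_N: "q \<in> V \<Longrightarrow> norm (N q) = 1"
  by (simp add: unit_\<nu> \<phi>_in)

lemma tangent: "q \<in> V \<Longrightarrow> frechet_derivative F (at q) X \<bullet> N q = 0"
  by (simp add: derivative_F tangent_f \<phi>_in)

lemma tangent_partial: "q \<in> V \<Longrightarrow> partial i F q \<bullet> N q = 0"
  unfolding partial_def by (rule tangent)

lemma derivative_inverse:
  obtains \<psi> where "smooth_on (\<phi> ` V) \<psi>" "open (\<phi> ` V)" "\<And>q. q \<in> V \<Longrightarrow> \<psi> (\<phi> q) = q"
    "\<And>q X. q \<in> V \<Longrightarrow> frechet_derivative \<psi> (at (\<phi> q)) (frechet_derivative \<phi> (at q) X) = X"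
    "\<And>q X. q \<in> V \<Longrightarrow> frechet_derivative \<phi> (at q) (frechet_derivative \<psi> (at (\<phi> q)) X) = X"
proof -
  obtain \<psi> where p: "open (\<phi> ` V)" "smooth_on (\<phi> ` V) \<psi>" "\<And>x. x \<in> V \<Longrightarrow> \<psi> (\<phi> x) = x" "\<And>y. y \<in> \<phi> ` V \<Longrightarrow> \<phi> (\<psi> y) = y"
    using diffeo_onE[OF diffeo] by metis
  have d\<psi>: "\<psi> differentiable (at (\<phi> q))" if "q \<in> V" for q
    using smooth_on_differentiable[OF p(2)] that by blast
  have d\<phi>: "\<phi> differentiable (at q)" if "q \<in> V" for q
    using smooth_on_differentiable[OF smooth_\<phi>] that by blast
  have "frechet_derivative \<psi> (at (\<phi> q)) (frechet_derivative \<phi> (at q) X) = X" if "q \<in> V" for q X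
  proof -
    have "frechet_derivative (\<psi> \<circ> \<phi>) (at q) = frechet_derivative (\<lambda>x. x) (at q)"
      by (rule frechet_derivative_cong_open[OF open_V that]) (simp add: p)
    then show ?thesis using frechet_chain[OF d\<phi>[OF that] d\<psi>[OF that]] by simp
  qed
  moreover have "frechet_derivative \<phi> (at q) (frechet_derivative \<psi> (at (\<phi> q)) X) = X" if "q \<in> V" for q X
  proof -
    have "frechet_derivative (\<phi> \<circ> \<psi>) (at (\<phi> q)) = frechet_derivative (\<lambda>x. x) (at (\<phi> q))"
      by (rule frechet_derivative_cong_open[OF p(1)]) (use p that in auto)
    then show ?thesis using frechet_chain[OF d\<psi>[OF that], of \<phi> X] d\<phi>[OF that] p(3)[OF that] by simp
  qed
  ultimately show ?thesis using that[of \<psi>] p by blast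
qed

lemma derivative_\<phi>_linear: "q \<in> V \<Longrightarrow> linear (frechet_derivative \<phi> (at q))"
  by (rule linear_frechet[OF smooth_on_differentiable[OF smooth_\<phi>]])

lemma derivative_\<phi>_bij: "q \<in> V \<Longrightarrow> bij (frechet_derivative \<phi> (at q))"
  by (rule derivative_inverse) (metis bijI injI surjI)

lemma derivative_\<phi>_eq_0: "q \<in> V \<Longrightarrow> frechet_derivative \<phi> (at q) X = 0 \<longleftrightarrow> X = 0"
  using derivative_\<phi>_bij[of q] derivative_\<phi>_linear[of q] by (metis bij_is_inj injD linear_0)

lemma singular_chart: "singular_set V F = {q \<in> V. \<phi> q \<in> singular_set \<Sigma> f}"
proof -
  have "inj (frechet_derivative F (at q)) \<longleftrightarrow> inj (frechet_derivative f (at (\<phi> q)))" if "q \<in> V" for q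
  proof -
    have "frechet_derivative F (at q) = frechet_derivative f (at (\<phi> q)) \<circ> frechet_derivative \<phi> (at q)"
      using derivative_F[OF that] by auto
    then show ?thesis
      using derivative_\<phi>_bij[OF that] by (metis bij_def inj_compose inj_on_imageI)
  qed
  then show ?thesis by (auto simp: singular_set_def \<phi>_in)
qed

lemma immersion: "q \<in> V \<Longrightarrow> frechet_derivative F (at q) X = 0 \<Longrightarrow> frechet_derivative N (at q) X = 0 \<Longrightarrow> X = 0"
proof -
  assume q: "q \<in> V" and 0: "frechet_derivative F (at q) X = 0" "frechet_derivative N (at q) X = 0"
  have d: "f differentiable (at (\<phi> q))" "\<nu> differentiable (at (\<phi> q))"
    using smooth_on_differentiable[OF smooth_f] smooth_on_differentiable[OF smooth_\<nu>] \<phi>_in[OF q] by auto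
  have *: "frechet_derivative (\<lambda>x. (f x, \<nu> x)) (at (\<phi> q)) = (\<lambda>X. (frechet_derivative f (at (\<phi> q)) X, frechet_derivative \<nu> (at (\<phi> q)) X))"
    by (rule frechet_derivative_eqI[OF has_derivative_Pair[OF has_derivative_frechet[OF d(1)] has_derivative_frechet[OF d(2)]]])
  have inj: "inj (\<lambda>X. (frechet_derivative f (at (\<phi> q)) X, frechet_derivative \<nu> (at (\<phi> q)) X))"
    using front \<phi>_in[OF q] unfolding *[symmetric] by (simp add: front_def)
  have "frechet_derivative \<phi> (at q) X = 0"
    using injD[OF inj, of "frechet_derivative \<phi> (at q) X" 0]
      0 linear_0[OF linear_frechet[OF d(1)]] linear_0[OF linear_frechet[OF d(2)]]
    by (simp add: derivative_F[OF q] derivative_N[OF q])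
  then show "X = 0" using derivative_\<phi>_eq_0[OF q] by simp
qed

lemma gauss_curvature_chart: "q \<in> V \<Longrightarrow> gauss_curvature F N q = gauss_curvature f \<nu> (\<phi> q)"
proof -
  assume q: "q \<in> V"
  have d: "f differentiable (at (\<phi> q))" "\<nu> differentiable (at (\<phi> q))" "\<phi> differentiable (at q)"
    using smooth_on_differentiable[OF smooth_f] smooth_on_differentiable[OF smooth_\<nu>] smooth_on_differentiable[OF smooth_\<phi> q] \<phi>_in[OF q] by auto
  have pF: "partial i F q = partial i \<phi> q $ 1 *\<^sub>R partial 1 f (\<phi> q) + partial i \<phi> q $ 2 *\<^sub>R partial 2 f (\<phi> q)" for i
    unfolding partial_def[of i] derivative_F[OF q] frechet_partials[OF d(1)] ..
  have pN: "partial i N q = partial i \<phi> q $ 1 *\<^sub>R partial 1 \<nu> (\<phi> q) + partial i \<phi> q $ 2 *\<^sub>R partial 2 \<nu> (\<phi> q)" for i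
    unfolding partial_def[of i] derivative_N[OF q] frechet_partials[OF d(2)] ..
  define a where "a i j = partial i f (\<phi> q) \<bullet> partial j f (\<phi> q)" for i j
  define b where "b i j = - (partial i f (\<phi> q) \<bullet> partial j \<nu> (\<phi> q))" for i j
  have expand: "first_form F q $ i $ j = partial i \<phi> q $ 1 * partial j \<phi> q $ 1 * a 1 1 + partial i \<phi> q $ 1 * partial j \<phi> q $ 2 * a 1 2
      + partial i \<phi> q $ 2 * partial j \<phi> q $ 1 * a 2 1 + partial i \<phi> q $ 2 * partial j \<phi> q $ 2 * a 2 2"
    "second_form F N q $ i $ j = partial i \<phi> q $ 1 * partial j \<phi> q $ 1 * b 1 1 + partial i \<phi> q $ 1 * partial j \<phi> q $ 2 * b 1 2
      + partial i \<phi> q $ 2 * partial j \<phi> q $ 1 * b 2 1 + partial i \<phi> q $ 2 * partial j \<phi> q $ 2 * b 2 2" for i j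
    unfolding first_form_def second_form_def pF pN a_def b_def by (simp_all add: inner_simps algebra_simps)
  have "det (first_form F q) = (jacobian \<phi> q)^2 * det (first_form f (\<phi> q))"
    unfolding det_2 expand bilinear_form_det by (simp add: jacobian_def first_form_def a_def)
  moreover have "det (second_form F N q) = (jacobian \<phi> q)^2 * det (second_form f \<nu> (\<phi> q))"
    unfolding det_2 expand bilinear_form_det by (simp add: jacobian_def second_form_def b_def)
  moreover have "jacobian \<phi> q \<noteq> 0"
    using inj_frechet_iff_jacobian[OF d(3)] bij_is_inj[OF derivative_\<phi>_bij[OF q]] by simp
  ultimately show ?thesis by (simp add: gauss_curvature_def)
qed

lemma gauss_curvature_bounded_chart:
  assumes "gauss_curvature_bounded_near \<Sigma> f \<nu> p"
  obtains U where "open U" "0 \<in> U" "U \<subseteq> V" "bounded (gauss_curvature F N ` (U - singular_set V F))"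
proof -
  obtain U where U: "open U" "p \<in> U" "bounded (gauss_curvature f \<nu> ` (U - singular_set \<Sigma> f))"
    using assms by (auto simp: gauss_curvature_bounded_near_def)
  have "open (V \<inter> \<phi> -` U)"
    by (rule continuous_open_preimage[OF smooth_on_continuous_on[OF smooth_\<phi>] open_V U(1)])
  moreover have "gauss_curvature F N ` (V \<inter> \<phi> -` U - singular_set V F) \<subseteq> gauss_curvature f \<nu> ` (U - singular_set \<Sigma> f)"
    by (auto simp: gauss_curvature_chart singular_chart)
  ultimately show ?thesis
    using U origin \<phi>_0 by (intro that[of "V \<inter> \<phi> -` U"]) (auto intro: bounded_subset)
qed

text \<open>Existence in the definite description: the extension \<open>Kt\<close> is carried back
  by the inverse chart. Uniqueness: two extensions agree at regular points, and in the chart these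
  are dense.\<close>

lemma gauss_curvature_value_chart:
  assumes axis: "singular_set V F = {q \<in> V. q$2 = 0}" and r: "r > 0" "ball 0 r \<subseteq> V"
    and K: "smooth_on (ball 0 r) Kt" "\<And>q. q \<in> ball 0 r \<Longrightarrow> q$2 \<noteq> 0 \<Longrightarrow> Kt q = gauss_curvature F N q"
  shows "gauss_curvature_value \<Sigma> f \<nu> p = Kt 0"
  unfolding gauss_curvature_value_def
proof (rule the_equality)
  obtain \<psi> where \<psi>: "smooth_on (\<phi> ` V) \<psi>" "\<And>q. q \<in> V \<Longrightarrow> \<psi> (\<phi> q) = q"
    using derivative_inverse by metis
  have o: "open (\<phi> ` ball 0 r)" by (rule diffeo_on_image_open[OF diffeo open_ball r(2)])
  have sing: "q$2 = 0 \<longleftrightarrow> \<phi> q \<in> singular_set \<Sigma> f" if "q \<in> V" for q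
    using axis that unfolding singular_chart by blast
  have main: "\<exists>U K. open U \<and> p \<in> U \<and> U \<subseteq> \<Sigma> \<and> smooth_on U K \<and>
        (\<forall>q \<in> U - singular_set \<Sigma> f. K q = gauss_curvature f \<nu> q) \<and> Kt 0 = K p"
  proof (intro exI conjI)
    show "open (\<phi> ` ball 0 r)" by (rule o)
    show "p \<in> \<phi> ` ball 0 r" using r \<phi>_0 by (auto intro!: image_eqI[of p \<phi> 0])
    show "\<phi> ` ball 0 r \<subseteq> \<Sigma>" using r \<phi>_in by auto
    show "smooth_on (\<phi> ` ball 0 r) (\<lambda>x. Kt (\<psi> x))"
    proof (rule smooth_on_compose[OF o open_ball _ _ K(1)])
      show "smooth_on (\<phi> ` ball 0 r) \<psi>" by (rule smooth_on_subset[OF \<psi>(1)]) (use r in auto)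
      show "\<psi> ` \<phi> ` ball 0 r \<subseteq> ball 0 r"
      proof
        fix x assume "x \<in> \<psi> ` \<phi> ` ball 0 r"
        then obtain q where "q \<in> ball 0 r" "x = \<psi> (\<phi> q)" by blast
        then show "x \<in> ball 0 r" using \<psi>(2)[of q] r by auto
      qed
    qed
    show "\<forall>q \<in> \<phi> ` ball 0 r - singular_set \<Sigma> f. Kt (\<psi> q) = gauss_curvature f \<nu> q"
    proof
      fix x assume x: "x \<in> \<phi> ` ball 0 r - singular_set \<Sigma> f"
      then obtain q where q: "q \<in> ball 0 r" "x = \<phi> q" by blast
      have qV: "q \<in> V" using q r by blast
      then have "q$2 \<noteq> 0" using sing[OF qV] x q by auto
      then show "Kt (\<psi> x) = gauss_curvature f \<nu> x"
        using K(2)[OF q(1)] gauss_curvature_chart[OF qV] \<psi>(2)[OF qV] q by simp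
    qed
    show "Kt 0 = Kt (\<psi> p)" using \<psi>(2)[OF origin] \<phi>_0 by simp
  qed
  then show "\<exists>U K. open U \<and> p \<in> U \<and> U \<subseteq> \<Sigma> \<and> smooth_on U K \<and>
        (\<forall>q \<in> U - singular_set \<Sigma> f. K q = gauss_curvature f \<nu> q) \<and> Kt 0 = K p" .
  fix k
  assume "\<exists>U K. open U \<and> p \<in> U \<and> U \<subseteq> \<Sigma> \<and> smooth_on U K \<and>
        (\<forall>q \<in> U - singular_set \<Sigma> f. K q = gauss_curvature f \<nu> q) \<and> k = K p"
  then obtain U K where U: "open U" "p \<in> U" "smooth_on U K" "\<And>q. q \<in> U - singular_set \<Sigma> f \<Longrightarrow> K q = gauss_curvature f \<nu> q" "k = K p"
    by blast
  define B where "B = ball 0 r \<inter> (V \<inter> \<phi> -` U)"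
  have B: "open B" "0 \<in> B"
    unfolding B_def using continuous_open_preimage[OF smooth_on_continuous_on[OF smooth_\<phi>] open_V U(1)] r origin \<phi>_0 U(2) by auto
  have "continuous_on B (\<lambda>q. K (\<phi> q))"
    by (rule continuous_on_compose2[OF smooth_on_continuous_on[OF U(3)] continuous_on_subset[OF smooth_on_continuous_on[OF smooth_\<phi>]]])
      (auto simp: B_def)
  moreover have "continuous_on B Kt"
    by (rule continuous_on_subset[OF smooth_on_continuous_on[OF K(1)]]) (auto simp: B_def)
  ultimately have "continuous_on B (\<lambda>q. K (\<phi> q) - Kt q)" by (rule continuous_on_diff)
  then have "K (\<phi> 0) - Kt 0 = 0"
  proof (rule zero_off_axis_imp_zero[OF B(1) _ _ B(2)])
    fix q assume q: "q \<in> B" "q$2 \<noteq> 0"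
    then have qV: "q \<in> V" "q \<in> ball 0 r" "\<phi> q \<in> U" by (auto simp: B_def)
    then show "K (\<phi> q) - Kt q = 0"
      using U(4)[of "\<phi> q"] K(2)[OF qV(2) q(2)] sing[OF qV(1)] q(2) gauss_curvature_chart[OF qV(1)] by simp
  qed
  then show "k = Kt 0" using U(5) \<phi>_0 by simp
qed

text \<open>At a singular point the partials are dependent, so one of them, if nonzero, carries the
  other, with the projection coefficient as factor. That coefficient is smooth wherever the former
  is nonzero. Both orders of the indices occur later.\<close>

lemma singular_partials:
  assumes q: "q \<in> singular_set V F" and ne: "partial i F q \<noteq> 0" and ij: "{i, j} = {1, 2}"
  shows "partial j F q = ((partial i F q \<bullet> partial j F q) / (partial i F q \<bullet> partial i F q)) *\<^sub>R partial i F q"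
proof -
  have qV: "q \<in> V" using q by (simp add: singular_set_def)
  have d: "F differentiable (at q)" by (rule smooth_on_differentiable[OF smooth_F qV])
  obtain X where X: "X \<noteq> 0" "frechet_derivative F (at q) X = 0"
    by (rule not_inj_linearE[OF linear_frechet[OF d]]) (use q in \<open>auto simp: singular_set_def\<close>)
  have eq: "X$i *\<^sub>R partial i F q + X$j *\<^sub>R partial j F q = 0"
    using X(2) ij unfolding frechet_partials[OF d] by (auto simp: doubleton_eq_iff add.commute)
  have "X$j \<noteq> 0"
  proof
    assume z: "X$j = 0"
    then have "X$i = 0" using eq ne by simp
    then show False using X(1) z ij by (auto simp: vec_eq_iff forall_2 doubleton_eq_iff)
  qed
  define c where "c = - (X$i / X$j)"
  have "partial j F q = c *\<^sub>R partial i F q"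
  proof -
    have "X$j *\<^sub>R partial j F q = (- X$i) *\<^sub>R partial i F q"
      using eq by (simp add: eq_neg_iff_add_eq_0 add.commute)
    then have "(1 / X$j) *\<^sub>R (X$j *\<^sub>R partial j F q) = (1 / X$j) *\<^sub>R ((- X$i) *\<^sub>R partial i F q)" by simp
    then show ?thesis using \<open>X$j \<noteq> 0\<close> by (simp add: c_def)
  qed
  then show ?thesis using ne by simp
qed

text \<open>The singular curve is the \<open>u\<close>-axis. Since \<open>F\<^sub>u\<close> does not
  vanish, the null direction has a nonzero \<open>v\<close>-component and is thus transversal to
  it.\<close>

lemma first_kindI:
  assumes axis: "singular_set V F = {q \<in> V. q$2 = 0}" and nd: "non_degenerate \<Sigma> f \<nu> p"
    and ne: "partial 1 F 0 \<noteq> 0"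
  shows "first_kind \<Sigma> f \<nu> p"
proof -
  obtain \<psi> where \<psi>: "smooth_on (\<phi> ` V) \<psi>" "\<And>q. q \<in> V \<Longrightarrow> \<psi> (\<phi> q) = q"
    using derivative_inverse by metis
  have "continuous_on V (partial 1 F)" by (intro smooth_on_continuous_on smooth_on_partial smooth_F)
  from continuous_open_preimage[OF this open_V, of "- {0}"]
  have "open (V \<inter> partial 1 F -` (- {0}))" by auto
  moreover have "0 \<in> V \<inter> partial 1 F -` (- {0})" using ne origin by auto
  ultimately obtain d where d: "d > 0" "ball 0 d \<subseteq> V \<inter> partial 1 F -` (- {0})"
    using open_contains_ball by blast
  define \<epsilon> where "\<epsilon> = d / 2"
  have \<epsilon>: "\<epsilon> > 0" using d by (simp add: \<epsilon>_def)
  \<comment> \<open>A square: its intersection with the axis is the image of exactly the interval on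
    which \<open>singular_curve\<close> parametrizes.\<close>
  define B where "B = {q::real^2. \<bar>q$1\<bar> < \<epsilon>} \<inter> {q. \<bar>q$2\<bar> < \<epsilon>}"
  have oB: "open B" unfolding B_def by (intro open_Int open_Collect_less continuous_intros)
  have Bd: "q \<in> V \<and> partial 1 F q \<noteq> 0" if "q \<in> B" for q
  proof -
    have "norm q \<le> \<bar>q$1\<bar> + \<bar>q$2\<bar>" using norm_le_l1_cart[of q] by (simp add: sum_2)
    then have "norm q < d" using that by (simp add: B_def \<epsilon>_def)
    then show ?thesis using d(2) by auto
  qed
  have BV: "B \<subseteq> V" using Bd by blast
  define j where "j t = (vector [t, 0] :: real^2)" for t :: real
  have jB: "j t \<in> B" if "t \<in> {-\<epsilon><..<\<epsilon>}" for t using that by (auto simp: j_def B_def)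
  define \<gamma> where "\<gamma> t = \<phi> (j t)" for t
  have dj: "(j has_derivative (\<lambda>h. h *\<^sub>R axis 1 1)) (at t)" for t
    unfolding j_def vector2_eq_axis by (auto intro!: derivative_eq_intros)
  have dg: "(\<gamma> has_vector_derivative frechet_derivative \<phi> (at (j t)) (axis 1 1)) (at t)" if "t \<in> {-\<epsilon><..<\<epsilon>}" for t
  proof -
    have V: "j t \<in> V" using jB[OF that] BV by blast
    have "(\<gamma> has_derivative (\<lambda>h. frechet_derivative \<phi> (at (j t)) (h *\<^sub>R axis 1 1))) (at t)"
      unfolding \<gamma>_def by (rule has_derivative_compose[OF dj smooth_on_has_derivative[OF smooth_\<phi> V]])
    then show ?thesis
      by (simp add: has_vector_derivative_def linear_scale[OF derivative_\<phi>_linear[OF V]])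
  qed
  \<comment> \<open>Minus the projection coefficient, so \<open>dF(X)\<close> is
    \<open>F\<^sub>v\<close> minus its projection to \<open>F\<^sub>u\<close>. It vanishes at
    singular points, while \<open>X\<close> is smooth and nonzero everywhere on
    \<open>B\<close>.\<close>
  define c where "c q = - ((partial 1 F q \<bullet> partial 2 F q) / (partial 1 F q \<bullet> partial 1 F q))" for q
  define X where "X q = (vector [c q, 1] :: real^2)" for q
  have sX: "smooth_on B X"
    unfolding X_def[abs_def] c_def
    by (intro smooth_on_vector2 smooth_intros oB smooth_on_subset[OF smooth_F BV]) (use Bd in auto)
  define \<eta> where "\<eta> x = frechet_derivative \<phi> (at (\<psi> x)) (X (\<psi> x))" for x
  have oW: "open (\<phi> ` B)" by (rule diffeo_on_image_open[OF diffeo oB BV])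
  have sing: "q$2 = 0 \<longleftrightarrow> \<phi> q \<in> singular_set \<Sigma> f" if "q \<in> V" for q
    using axis that unfolding singular_chart by blast
  have \<epsilon>0: "0 \<in> {-\<epsilon><..<\<epsilon>}" using \<epsilon> by simp
  have j0: "j 0 = 0" by (simp add: j_def vec_eq_iff forall_2)
  have pW: "p \<in> \<phi> ` B" using jB[OF \<epsilon>0] j0 \<phi>_0 by (auto intro!: image_eqI[of p \<phi> 0])
  have g: "singular_curve \<Sigma> f p \<gamma>"
    unfolding singular_curve_def
  proof (intro conjI exI[of _ \<epsilon>] ballI exI[of _ "\<phi> ` B"])
    show "\<gamma> 0 = p" by (simp add: \<gamma>_def j0 \<phi>_0)
    show "smooth_on {-\<epsilon><..<\<epsilon>} \<gamma>"
      unfolding \<gamma>_def[abs_def]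
    proof (rule smooth_on_compose[OF _ open_V _ _ smooth_\<phi>])
      show "smooth_on {-\<epsilon><..<\<epsilon>} j" unfolding j_def[abs_def] by (intro smooth_on_vector2 smooth_intros) auto
    qed (use jB BV in auto)
    show "vector_derivative \<gamma> (at t) \<noteq> 0" if "t \<in> {-\<epsilon><..<\<epsilon>}" for t
    proof -
      have "j t \<in> V" using jB[OF that] BV by blast
      then show ?thesis
        unfolding vector_derivative_at[OF dg[OF that]] by (simp add: derivative_\<phi>_eq_0)
    qed
    show "singular_set \<Sigma> f \<inter> \<phi> ` B = \<gamma> ` {-\<epsilon><..<\<epsilon>}"
    proof (intro equalityI subsetI)
      fix x assume "x \<in> singular_set \<Sigma> f \<inter> \<phi> ` B"
      then obtain q where q: "q \<in> B" "x = \<phi> q" "q$2 = 0" using sing BV by blast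
      then have "q = j (q$1)" "q$1 \<in> {-\<epsilon><..<\<epsilon>}" by (auto simp: j_def vec_eq_iff forall_2 B_def)
      then show "x \<in> \<gamma> ` {-\<epsilon><..<\<epsilon>}" using q(2) by (metis \<gamma>_def imageI)
    next
      fix x assume "x \<in> \<gamma> ` {-\<epsilon><..<\<epsilon>}"
      then obtain t where t: "t \<in> {-\<epsilon><..<\<epsilon>}" "x = \<phi> (j t)" by (auto simp: \<gamma>_def)
      have "(j t)$2 = 0" by (simp add: j_def)
      then show "x \<in> singular_set \<Sigma> f \<inter> \<phi> ` B" using sing[of "j t"] jB[OF t(1)] BV t(2) by blast
    qed
  qed (use \<epsilon> oW pW in auto)
  have e: "null_vector_field \<Sigma> f p \<eta>"
    unfolding null_vector_field_def
  proof (intro conjI exI[of _ "\<phi> ` B"] ballI)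
    show "\<phi> ` B \<subseteq> \<Sigma>" using BV \<phi>_in by auto
    have s: "\<psi> ` \<phi> ` B \<subseteq> B"
    proof
      fix x assume "x \<in> \<psi> ` \<phi> ` B"
      then obtain q where "q \<in> B" "x = \<psi> (\<phi> q)" by blast
      then show "x \<in> B" using \<psi>(2)[of q] BV by auto
    qed
    show "smooth_on (\<phi> ` B) \<eta>" unfolding \<eta>_def
    proof (rule smooth_on_compose[OF oW oB s])
      show "smooth_on (\<phi> ` B) \<psi>" by (rule smooth_on_subset[OF \<psi>(1)]) (use BV in auto)
      show "smooth_on B (\<lambda>x. frechet_derivative \<phi> (at x) (X x))"
        by (intro smooth_on_frechet_apply oB sX smooth_on_subset[OF smooth_\<phi> BV])
    qed
    show "\<eta> x \<noteq> 0" if x: "x \<in> \<phi> ` B" for x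
    proof -
      obtain q where q: "q \<in> B" "x = \<phi> q" using x by blast
      have "X q \<noteq> 0" by (auto simp: X_def vec_eq_iff forall_2)
      then show ?thesis using q \<psi>(2)[of q] BV by (auto simp: \<eta>_def derivative_\<phi>_eq_0)
    qed
    show "frechet_derivative f (at x) (\<eta> x) = 0" if x: "x \<in> \<phi> ` B \<inter> singular_set \<Sigma> f" for x
    proof -
      obtain q where q: "q \<in> B" "x = \<phi> q" using x by blast
      have qV: "q \<in> V" using q BV by blast
      have s: "q \<in> singular_set V F" using x q qV by (auto simp: singular_chart)
      have "frechet_derivative f (at x) (\<eta> x) = frechet_derivative F (at q) (X q)"
        using q \<psi>(2)[OF qV] by (simp add: \<eta>_def derivative_F[OF qV])
      also have "\<dots> = c q *\<^sub>R partial 1 F q + partial 2 F q"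
        unfolding frechet_partials[OF smooth_on_differentiable[OF smooth_F qV]] by (simp add: X_def)
      also have "\<dots> = 0"
        using Bd[OF q(1)] by (subst singular_partials[OF s, of 1 2]) (auto simp: c_def)
      finally show ?thesis .
    qed
  qed (use oW pW in auto)
  have \<gamma>0: "vector_derivative \<gamma> (at 0) = frechet_derivative \<phi> (at 0) (axis 1 1)"
    using vector_derivative_at[OF dg[OF \<epsilon>0]] by (simp add: j0)
  have \<eta>0: "\<eta> p = frechet_derivative \<phi> (at 0) (X 0)"
    using \<psi>(2)[OF origin] \<phi>_0 by (simp add: \<eta>_def)
  have lin: "frechet_derivative \<phi> (at 0) (axis 1 1) = k *\<^sub>R frechet_derivative \<phi> (at 0) (X 0) \<longleftrightarrow> axis 1 1 = k *\<^sub>R X 0" for k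
    using inj_eq[OF bij_is_inj[OF derivative_\<phi>_bij[OF origin]]]
    by (simp flip: linear_scale[OF derivative_\<phi>_linear[OF origin]])
  have nk: "axis 1 1 \<noteq> k *\<^sub>R X 0" for k
    by (auto simp: X_def vec_eq_iff forall_2 axis_def)
  have ne: "\<eta> p \<noteq> 0" unfolding \<eta>0 using derivative_\<phi>_eq_0[OF origin] by (auto simp: X_def vec_eq_iff forall_2)
  have nk': "vector_derivative \<gamma> (at 0) \<noteq> k *\<^sub>R \<eta> p" for k unfolding \<gamma>0 \<eta>0 lin by (rule nk)
  have nk1: "vector_derivative \<gamma> (at 0) \<noteq> \<eta> p" using nk'[of 1] by simp
  moreover have "independent {vector_derivative \<gamma> (at 0), \<eta> p}"
    using ne nk' nk1 by (auto simp: independent_insert span_singleton)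
  ultimately show ?thesis unfolding first_kind_def using nd g e by blast
qed

lemma cuspidal_edge_frame:
  assumes c: "cuspidal_edge_coordinates \<Sigma> f \<nu> p V \<phi> g"
  shows "adapted_frame V F N (\<lambda>q. axis 2 1) (\<lambda>q. axis 1 1) g (-1)"
proof
  have c': "singular_set V F = {q \<in> V. q$2 = 0}" "smooth_on V g" "\<And>q. q \<in> V \<Longrightarrow> partial 2 F q = q$2 *\<^sub>R g q"
    "\<And>q. q \<in> V \<Longrightarrow> N q = cross3 (partial 1 F q) (g q) /\<^sub>R norm (cross3 (partial 1 F q) (g q))"
    using c unfolding cuspidal_edge_coordinates_def Let_def by blast+
  show "singular_set V F = {q \<in> V. q$2 = 0}" "smooth_on V g" by fact+
  show null: "frechet_derivative F (at q) (axis 2 1) = q$2 *\<^sub>R g q" if "q \<in> V" for q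
    using c'(3)[OF that] by (simp add: partial_def)
  show "cross3 (g q) (frechet_derivative F (at q) (axis 1 1)) \<bullet> N q \<noteq> 0" if "q \<in> V" for q
  proof -
    let ?c = "cross3 (partial 1 F q) (g q)"
    have "?c \<noteq> 0" using unit_N[OF that] c'(4)[OF that] by auto
    then show ?thesis
      unfolding cross_skew[of "g q"] c'(4)[OF that] by (simp flip: partial_def)
  qed
  show "frechet_derivative N (at 0) (axis 2 1) \<noteq> 0"
    using immersion[OF origin, of "axis 2 1"] null[OF origin] by auto
qed (auto simp: smooth_on_const open_V origin smooth_F smooth_N unit_\<nu> \<phi>_in tangent[simplified] axis_def)

lemma second_kind_frame:
  assumes c: "second_kind_coordinates \<Sigma> f \<nu> p V \<phi> e h"
  shows "adapted_frame V F N (\<lambda>q. vector [1, e (q$1)]) (\<lambda>q. axis 2 1) h 1"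
proof
  have c': "singular_set V F = {q \<in> V. q$2 = 0}" "smooth_on V h" "smooth_on ((\<lambda>q. q$1) ` V) e"
    "\<And>q. q \<in> V \<Longrightarrow> partial 1 F q + e (q$1) *\<^sub>R partial 2 F q = q$2 *\<^sub>R h q"
    "\<And>q. q \<in> V \<Longrightarrow> N q = cross3 (h q) (partial 2 F q) /\<^sub>R norm (cross3 (h q) (partial 2 F q))"
    using c unfolding second_kind_coordinates_def Let_def by blast+
  show "singular_set V F = {q \<in> V. q$2 = 0}" "smooth_on V h" by fact+
  have "surj (\<lambda>q::real^2. q$1)" by (rule surjI[of _ "\<lambda>x. vector [x, 0]"]) simp
  then have "open ((\<lambda>q. q$1) ` V)"
    by (intro open_surjective_linear_image open_V) (auto intro: linearI)
  then have "smooth_on V (\<lambda>q. e (q$1))"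
    by (rule smooth_on_compose[OF open_V _ order_refl _ c'(3)]) (intro smooth_intros open_V)
  then show "smooth_on V (\<lambda>q. vector [1, e (q$1)] :: real^2)"
    by (intro smooth_on_vector2 smooth_intros open_V)
  show null: "frechet_derivative F (at q) (vector [1, e (q$1)]) = q$2 *\<^sub>R h q" if "q \<in> V" for q
    using c'(4)[OF that] frechet_partials[OF smooth_on_differentiable[OF smooth_F that]] by simp
  show "cross3 (h q) (frechet_derivative F (at q) (axis 2 1)) \<bullet> N q \<noteq> 0" if "q \<in> V" for q
  proof -
    have "cross3 (h q) (partial 2 F q) \<noteq> 0" using unit_N[OF that] c'(5)[OF that] by auto
    then show ?thesis
      unfolding c'(5)[OF that] by (simp flip: partial_def)
  qed
  have "(vector [1, e 0] :: real^2) \<noteq> 0" by (simp add: vec_eq_iff forall_2)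
  then show "frechet_derivative N (at 0) (vector [1, e (0$1)]) \<noteq> 0"
    using immersion[OF origin, of "vector [1, e 0]"] null[OF origin] by auto
qed (auto simp: smooth_on_const open_V origin smooth_F smooth_N unit_\<nu> \<phi>_in tangent[simplified] axis_def)

end

section \<open>Adapted coordinates at a cuspidal edge\<close>

lemma diffeo_on_inverse:
  assumes "diffeo_on V W \<phi>"
  obtains \<psi> where "diffeo_on W V \<psi>" "\<And>x. x \<in> V \<Longrightarrow> \<psi> (\<phi> x) = x" "\<And>y. y \<in> W \<Longrightarrow> \<phi> (\<psi> y) = y"
  using assms unfolding diffeo_on_def by metis

lemma cross3_eq_0_iff:
  fixes x y :: "real^3"
  shows "cross3 x y = 0 \<longleftrightarrow> (\<exists>a b. (a \<noteq> 0 \<or> b \<noteq> 0) \<and> a *\<^sub>R x + b *\<^sub>R y = 0)"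
proof
  assume "cross3 x y = 0"
  then consider "x = 0" | "y = 0" | c where "y = c *\<^sub>R x" unfolding cross_eq_0 collinear_lemma by blast
  then show "\<exists>a b. (a \<noteq> 0 \<or> b \<noteq> 0) \<and> a *\<^sub>R x + b *\<^sub>R y = 0"
  proof cases
    case 1 then show ?thesis by (intro exI[of _ 1] exI[of _ 0]) simp
  next
    case 2 then show ?thesis by (intro exI[of _ 0] exI[of _ 1]) simp
  next
    case 3 then show ?thesis by (intro exI[of _ c] exI[of _ "-1"]) simp
  qed
next
  assume "\<exists>a b. (a \<noteq> 0 \<or> b \<noteq> 0) \<and> a *\<^sub>R x + b *\<^sub>R y = 0"
  then obtain a b where ab: "a \<noteq> 0 \<or> b \<noteq> 0" "a *\<^sub>R x + b *\<^sub>R y = 0" by blast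
  have "b *\<^sub>R cross3 x y = cross3 x (a *\<^sub>R x + b *\<^sub>R y)" "a *\<^sub>R cross3 x y = cross3 (a *\<^sub>R x + b *\<^sub>R y) y"
    by (simp_all add: cross_add_left cross_add_right cross_mult_left cross_mult_right)
  then show "cross3 x y = 0" using ab by auto
qed

lemma inj_frechet_iff_cross3:
  fixes F :: "real^2 \<Rightarrow> real^3"
  assumes "F differentiable (at q)"
  shows "inj (frechet_derivative F (at q)) \<longleftrightarrow> cross3 (partial 1 F q) (partial 2 F q) \<noteq> 0"
proof -
  have "inj (frechet_derivative F (at q)) \<longleftrightarrow> (\<forall>X::real^2. X$1 *\<^sub>R partial 1 F q + X$2 *\<^sub>R partial 2 F q = 0 \<longrightarrow> X = 0)"
    unfolding linear_injective_0[OF linear_frechet[OF assms]] frechet_partials[OF assms] ..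
  also have "\<dots> \<longleftrightarrow> cross3 (partial 1 F q) (partial 2 F q) \<noteq> 0"
    unfolding cross3_eq_0_iff forall_vector_2 by (auto simp: vec_eq_iff forall_2)
  finally show ?thesis .
qed

text \<open>\<open>cross3 a b\<close> is a multiple of \<open>n\<close>, and positivity of the
  triple product fixes the sign. Both kinds of adapted coordinates obtain their formula for the
  normal in this way.\<close>

lemma unit_normal_eq:
  fixes n a b :: "real^3"
  assumes "norm n = 1" "a \<bullet> n = 0" "b \<bullet> n = 0" "cross3 a b \<bullet> n > 0"
  shows "n = cross3 a b /\<^sub>R norm (cross3 a b)"
proof -
  let ?k = "cross3 a b \<bullet> n"
  have "cross3 a b - ?k *\<^sub>R n = 0"
  proof (rule eq_zero_if_orthogonal_to_basis)
    show "cross3 a b \<bullet> n \<noteq> 0" using assms by simp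
  qed (use assms in \<open>auto simp: inner_diff_left inner_commute[of n] dot_square_norm dot_cross_self\<close>)
  then have c: "cross3 a b = ?k *\<^sub>R n" by simp
  then have "norm (cross3 a b) = norm (?k *\<^sub>R n)" by simp
  also have "\<dots> = ?k" using assms by simp
  finally have "norm (cross3 a b) = ?k" .
  then have "cross3 a b /\<^sub>R norm (cross3 a b) = inverse ?k *\<^sub>R (?k *\<^sub>R n)" using c by metis
  then show ?thesis using assms(4) by simp
qed

lemma cross3_dot_normal_nonzero:
  fixes n a b :: "real^3"
  assumes "norm n = 1" "a \<bullet> n = 0" "b \<bullet> n = 0" "cross3 a b \<noteq> 0"
  shows "cross3 a b \<bullet> n \<noteq> 0"
proof
  assume z: "cross3 a b \<bullet> n = 0"
  have "n = 0"
    by (rule eq_zero_if_orthogonal_to_basis[of a b "cross3 a b"]) (use assms z in \<open>auto simp: inner_commute\<close>)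
  then show False using assms(1) by simp
qed

lemma partial_second_coordinate_times:
  fixes k :: "real^2 \<Rightarrow> 'b::real_normed_vector"
  assumes "k differentiable (at q)" "q$2 = 0"
  shows "partial 2 (\<lambda>q. q$2 *\<^sub>R k q) q = k q"
proof -
  have "((\<lambda>q. q$2 *\<^sub>R k q) has_derivative (\<lambda>X. q$2 *\<^sub>R frechet_derivative k (at q) X + X$2 *\<^sub>R k q)) (at q)"
    by (intro has_derivative_scaleR has_derivative_frechet assms(1) bounded_linear_imp_has_derivative bounded_linear_vec_nth)
  then show ?thesis
    unfolding partial_def by (simp add: frechet_derivative_eqI assms(2) axis_def)
qed

lemma partial_cong_open:
  assumes "open S" "x \<in> S" "\<And>y. y \<in> S \<Longrightarrow> f y = g y"
  shows "partial i f x = partial i g x"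
  unfolding partial_def using frechet_derivative_cong_open[OF assms] by simp

context front_chart
begin

lemma front_chart_compose:
  assumes "diffeo_on U (\<rho> ` U) \<rho>" "\<rho> ` U \<subseteq> V" "0 \<in> U" "\<rho> 0 = 0"
  shows "front_chart \<Sigma> f \<nu> p U (\<phi> \<circ> \<rho>)"
  by unfold_locales (intro front open_\<Sigma> coordinates_at_compose[OF chart assms])+

lemma front_chart_restrict:
  assumes "open V'" "V' \<subseteq> V" "0 \<in> V'"
  shows "front_chart \<Sigma> f \<nu> p V' \<phi>"
  by unfold_locales (intro front open_\<Sigma> coordinates_at_restrict[OF chart assms])+

lemma derivative_compose:
  assumes "diffeo_on U (\<rho> ` U) \<rho>" "\<rho> ` U \<subseteq> V" "q \<in> U"
  shows "frechet_derivative (f \<circ> (\<phi> \<circ> \<rho>)) (at q) X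
    = frechet_derivative \<rho> (at q) X $ 1 *\<^sub>R partial 1 F (\<rho> q) + frechet_derivative \<rho> (at q) X $ 2 *\<^sub>R partial 2 F (\<rho> q)"
proof -
  have V: "\<rho> q \<in> V" using assms by blast
  have r: "\<rho> differentiable (at q)" using assms by (auto simp: diffeo_on_def intro: smooth_on_differentiable)
  have F: "F differentiable (at (\<rho> q))" by (rule smooth_on_differentiable[OF smooth_F V])
  show ?thesis unfolding o_assoc frechet_chain[OF r F] frechet_partials[OF F] ..
qed

end

text \<open>The stage between the cuspidal normal form and adapted coordinates:
  \<open>F\<^sub>v\<close> is divisible by \<open>v\<close> with a quotient independent of
  \<open>F\<^sub>u\<close>, but orthonormality and orientation are not yet arranged.\<close>

locale edge_chart = front_chart +
  fixes g :: "real^2 \<Rightarrow> real^3"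
  assumes smooth_g: "smooth_on V g"
    and partial_2: "q \<in> V \<Longrightarrow> partial 2 (f \<circ> \<phi>) q = q$2 *\<^sub>R g q"
    and independent: "q \<in> V \<Longrightarrow> cross3 (partial 1 (f \<circ> \<phi>) q) (g q) \<noteq> 0"
begin

lemma singular_axis: "singular_set V F = {q \<in> V. q$2 = 0}"
  using independent
  by (auto simp: singular_set_def inj_frechet_iff_cross3[OF smooth_on_differentiable[OF smooth_F]] partial_2 cross_mult_right)

lemma normal_g: "q \<in> V \<Longrightarrow> g q \<bullet> N q = 0"
proof (rule zero_off_axis_imp_zero[OF open_V, where f = "\<lambda>q. g q \<bullet> N q"])
  show "continuous_on V (\<lambda>q. g q \<bullet> N q)"
    by (intro smooth_on_continuous_on smooth_intros open_V smooth_g smooth_N)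
  show "g q \<bullet> N q = 0" if "q \<in> V" "q$2 \<noteq> 0" for q
    using tangent_partial[OF that(1), of 2] that by (simp add: partial_2)
qed

lemma partial_22: "q \<in> V \<Longrightarrow> q$2 = 0 \<Longrightarrow> partial 2 (partial 2 F) q = g q"
  using partial_cong_open[OF open_V, of q "partial 2 F" "\<lambda>q. q$2 *\<^sub>R g q" 2] partial_2
    partial_second_coordinate_times[OF smooth_on_differentiable[OF smooth_g]] by simp

end

lemma vector3_eq_axis: "(vector [a, b, c] :: real^3) = a *\<^sub>R axis 1 1 + b *\<^sub>R axis 2 1 + c *\<^sub>R axis 3 1"
  by (simp add: vec_eq_iff forall_3 axis_def)

text \<open>Here \<open>F = \<Psi>(u, v\<^sup>2, v\<^sup>3)\<close> with a diffeomorphism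
  \<open>\<Psi>\<close>. The \<open>v\<close>-derivative of the inner map is
  \<open>v (0, 2, 3 v)\<close>, so \<open>g = d\<Psi>(0, 2, 3 v)\<close>; injectivity of
  \<open>d\<Psi>\<close> keeps it independent of
  \<open>F\<^sub>u = d\<Psi>(1, 0, 0)\<close>.\<close>

lemma cuspidal_edge_imp_edge_chart:
  assumes ce: "cuspidal_edge \<Sigma> f p" and fr: "front \<Sigma> f \<nu>" and \<Sigma>: "open \<Sigma>"
  obtains V \<phi> g where "edge_chart \<Sigma> f \<nu> p V \<phi> g"
proof -
  obtain V \<phi> A B \<Phi> where c: "coordinates_at \<Sigma> p V \<phi>" and d: "diffeo_on A B (\<Phi> :: real^3 \<Rightarrow> real^3)"
    and eq: "\<And>q. q \<in> V \<Longrightarrow> f (\<phi> q) \<in> A \<and> \<Phi> (f (\<phi> q)) = vector [q$1, (q$2)^2, (q$2)^3]"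
    using ce unfolding cuspidal_edge_def by blast
  interpret front_chart \<Sigma> f \<nu> p V \<phi> by unfold_locales fact+
  obtain \<Psi> where P: "open A" "open B" "smooth_on A \<Phi>" "smooth_on B \<Psi>" "\<Phi> ` A = B" "\<Psi> ` B = A"
    "\<And>x. x \<in> A \<Longrightarrow> \<Psi> (\<Phi> x) = x" "\<And>y. y \<in> B \<Longrightarrow> \<Phi> (\<Psi> y) = y"
    using diffeo_onE[OF d] by blast
  define c where "c q = q$1 *\<^sub>R axis 1 1 + (q$2)^2 *\<^sub>R axis 2 1 + (q$2)^3 *\<^sub>R (axis 3 1 :: real^3)" for q :: "real^2"
  have cB: "c q \<in> B" if "q \<in> V" for q
    using eq[OF that] P(5) unfolding c_def vector3_eq_axis[symmetric] by (metis imageI)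
  have Fc: "F q = \<Psi> (c q)" if "q \<in> V" for q
    using eq[OF that] P(7) unfolding c_def vector3_eq_axis[symmetric] by simp metis
  have dc: "(c has_derivative (\<lambda>X. X$1 *\<^sub>R axis 1 1 + (X$2 * q$2) *\<^sub>R (2 *\<^sub>R axis 2 1 + (3 * q$2) *\<^sub>R axis 3 1))) (at q)" for q
    unfolding c_def
    by (auto intro!: derivative_eq_intros bounded_linear_imp_has_derivative bounded_linear_vec_nth
        simp: algebra_simps power2_eq_square)
  have sc: "smooth_on V c"
    unfolding c_def[abs_def] by (intro smooth_intros open_V)
  define L where "L q = frechet_derivative \<Psi> (at (c q))" for q
  have dP: "\<Psi> differentiable (at (c q))" if "q \<in> V" for q
    using smooth_on_differentiable[OF P(4) cB[OF that]] .
  have lin: "linear (L q)" if "q \<in> V" for q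
    unfolding L_def by (rule linear_frechet[OF dP[OF that]])
  have inj: "inj (L q)" if q: "q \<in> V" for q
  proof -
    have dF: "\<Phi> differentiable (at (\<Psi> (c q)))" using smooth_on_differentiable[OF P(3)] cB[OF q] P(6) by blast
    have "frechet_derivative (\<Phi> \<circ> \<Psi>) (at (c q)) = frechet_derivative (\<lambda>x. x) (at (c q))"
      by (rule frechet_derivative_cong_open[OF P(2) cB[OF q]]) (simp add: P(8))
    then have "frechet_derivative \<Phi> (at (\<Psi> (c q))) (L q X) = X" for X
      using frechet_chain[OF dP[OF q] dF, of X] by (simp add: L_def)
    then show ?thesis by (metis injI)
  qed
  have sL: "smooth_on V (\<lambda>q. L q X)" for X
    unfolding L_def by (rule smooth_on_compose[OF open_V P(2) _ sc smooth_on_frechet[OF P(4)]]) (use cB in auto)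
  define z where "z q = 2 *\<^sub>R axis 2 1 + (3 * q$2) *\<^sub>R (axis 3 1 :: real^3)" for q :: "real^2"
  have dF: "frechet_derivative F (at q) X = X$1 *\<^sub>R L q (axis 1 1) + (X$2 * q$2) *\<^sub>R L q (z q)" if q: "q \<in> V" for q X
  proof -
    have "frechet_derivative F (at q) = frechet_derivative (\<Psi> \<circ> c) (at q)"
      by (rule frechet_derivative_cong_open[OF open_V q]) (simp only: Fc o_apply[of \<Psi>])
    then have "frechet_derivative F (at q) X = L q (X$1 *\<^sub>R axis 1 1 + (X$2 * q$2) *\<^sub>R z q)"
      using frechet_chain[OF differentiableI[OF dc] dP[OF q]] frechet_derivative_eqI[OF dc] by (simp add: L_def z_def)
    then show ?thesis by (simp add: linear_add[OF lin[OF q]] linear_scale[OF lin[OF q]])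
  qed
  have "edge_chart \<Sigma> f \<nu> p V \<phi> (\<lambda>q. L q (z q))"
  proof
    have "smooth_on V (\<lambda>q. 2 *\<^sub>R L q (axis 2 1) + (3 * q$2) *\<^sub>R L q (axis 3 1))"
      by (intro smooth_intros open_V sL)
    then show "smooth_on V (\<lambda>q. L q (z q))"
      by (rule smooth_on_cong[OF open_V, rotated]) (simp add: z_def linear_add[OF lin] linear_scale[OF lin])
    show "partial 2 F q = q$2 *\<^sub>R L q (z q)" if "q \<in> V" for q
      unfolding partial_def dF[OF that] by (simp add: axis_def)
    show "cross3 (partial 1 F q) (L q (z q)) \<noteq> 0" if q: "q \<in> V" for q
    proof
      assume "cross3 (partial 1 F q) (L q (z q)) = 0"
      then have "cross3 (L q (axis 1 1)) (L q (z q)) = 0"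
        unfolding partial_def dF[OF q] by (simp add: axis_def)
      then obtain a b where ab: "a \<noteq> 0 \<or> b \<noteq> 0" "a *\<^sub>R L q (axis 1 1) + b *\<^sub>R L q (z q) = 0"
        unfolding cross3_eq_0_iff by blast
      then have "L q (a *\<^sub>R axis 1 1 + b *\<^sub>R z q) = L q 0"
        by (simp add: linear_add[OF lin[OF q]] linear_scale[OF lin[OF q]] linear_0[OF lin[OF q]])
      then have "a *\<^sub>R axis 1 1 + b *\<^sub>R z q = 0" using inj[OF q] by (simp add: inj_eq)
      then show False using ab(1) by (auto simp: vec_eq_iff forall_3 z_def axis_def)
    qed
  qed
  then show ?thesis by (rule that)
qed

lemma norm_vector2_0: "norm (vector [x, 0] :: real^2) = \<bar>x\<bar>"
  by (simp add: norm_vec_def L2_set_def sum_2)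

lemma smooth_on_axis_line:
  fixes F :: "real^2 \<Rightarrow> 'b::real_normed_vector"
  assumes "smooth_on V F" "open V" "ball 0 r \<subseteq> V" and s: "\<bar>s\<bar> = 1"
  shows "smooth_on {-r<..<r} (\<lambda>x. F (vector [s * x, 0]))"
proof (rule smooth_on_compose[OF _ assms(2) _ _ assms(1)])
  show "(\<lambda>x. vector [s * x, 0]) ` {-r<..<r} \<subseteq> V"
    using assms(3) s by (force simp: norm_vector2_0 abs_mult)
  show "smooth_on {-r<..<r} (\<lambda>x. vector [s * x, 0] :: real^2)"
    by (intro smooth_on_vector2 smooth_intros) auto
qed simp

context edge_chart
begin

lemma arc_length_chart:
  obtains U \<rho> g' where "edge_chart \<Sigma> f \<nu> p U (\<phi> \<circ> \<rho>) g'"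
    "\<And>q. q \<in> U \<Longrightarrow> q$2 = 0 \<Longrightarrow> norm (partial 1 (f \<circ> (\<phi> \<circ> \<rho>)) q) = 1"
proof -
  obtain r where r: "r > 0" "ball 0 r \<subseteq> V" using open_V origin open_contains_ball by blast
  define m where "m x = norm (partial 1 F (vector [x, 0]))" for x
  have ne: "partial 1 F q \<noteq> 0" if "q \<in> V" for q using independent[OF that] by auto
  have inV: "(vector [x, 0] :: real^2) \<in> V" if "x \<in> {-r<..<r}" for x
    using r(2) that by (force simp: norm_vector2_0)
  have sm: "smooth_on {-r<..<r} m"
    unfolding m_def[abs_def]
  proof (rule smooth_on_norm)
    show "smooth_on {-r<..<r} (\<lambda>x. partial 1 F (vector [x, 0]))"
      using smooth_on_axis_line[OF smooth_on_partial[OF smooth_F] open_V r(2), of 1 1] by simp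
    show "partial 1 F (vector [x, 0]) \<noteq> 0" if "x \<in> {-r<..<r}" for x
      by (rule ne[OF inV[OF that]])
  qed simp
  have mpos: "m x > 0" if "x \<in> {-r<..<r}" for x using ne[OF inV[OF that]] by (simp add: m_def)
  obtain A where A: "smooth_on {-(r/2)<..<r/2} A" "\<And>x. x \<in> {-(r/2)<..<r/2} \<Longrightarrow> (A has_real_derivative m x) (at x)" "A 0 = 0"
    using smooth_antiderivative[OF sm, of "r/2"] r by auto
  define S where "S = ball (0::real^2) (r/2)"
  have S1: "q$1 \<in> {-(r/2)<..<r/2}" if "q \<in> S" for q
    using component_le_norm_cart[of q 1] that by (auto simp: S_def)
  \<comment> \<open>\<open>A\<close> is the arc length of the image of the singular curve; the new
    chart is the inverse \<open>\<rho>\<close> of this map. As \<open>v\<close> is left alone,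
    \<open>F\<^sub>v\<close> remains divisible by \<open>v\<close>, with quotient
    \<open>g \<circ> \<rho>\<close>.\<close>
  define \<theta> where "\<theta> q = (vector [A (q$1), q$2] :: real^2)" for q :: "real^2"
  have s\<theta>: "smooth_on S \<theta>"
    unfolding \<theta>_def[abs_def]
  proof (intro smooth_on_vector2)
    show "smooth_on S (\<lambda>q. A (q$1))"
      by (rule smooth_on_compose[OF _ _ _ _ A(1)]) (use S1 in \<open>auto simp: S_def intro!: smooth_intros\<close>)
  qed (auto simp: S_def intro!: smooth_intros)
  have d\<theta>: "(\<theta> has_derivative (\<lambda>X. vector [m (q$1) * X$1, X$2])) (at q)" if "q \<in> S" for q
  proof -
    have "((\<lambda>q. A (q$1)) has_derivative (\<lambda>X. m (q$1) * X$1)) (at q)"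
      by (rule has_derivative_compose[OF bounded_linear_imp_has_derivative[OF bounded_linear_vec_nth]
            has_field_derivative_imp_has_derivative[OF A(2)[OF S1[OF that]]]])
    then show ?thesis
      unfolding \<theta>_def vector2_eq_axis
      by (intro has_derivative_add has_derivative_scaleR_left bounded_linear_imp_has_derivative[OF bounded_linear_vec_nth])
  qed
  have 0: "0 \<in> S" using r by (simp add: S_def)
  have "jacobian \<theta> 0 \<noteq> 0"
    using mpos[of 0] r by (simp add: jacobian_def partial_def frechet_derivative_eqI[OF d\<theta>[OF 0]] axis_def)
  then obtain W where W: "open W" "0 \<in> W" "W \<subseteq> S" "diffeo_on W (\<theta> ` W) \<theta>"
    using local_diffeo[OF _ s\<theta> 0] by (auto simp: S_def)
  obtain \<rho> where \<rho>: "diffeo_on (\<theta> ` W) W \<rho>" "\<And>x. x \<in> W \<Longrightarrow> \<rho> (\<theta> x) = x" "\<And>y. y \<in> \<theta> ` W \<Longrightarrow> \<theta> (\<rho> y) = y"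
    using diffeo_on_inverse[OF W(4)] by metis
  define U where "U = \<theta> ` W"
  have \<rho>U: "\<rho> ` U = W" using \<rho>(1) by (simp add: U_def diffeo_on_def)
  have dU: "diffeo_on U (\<rho> ` U) \<rho>" using \<rho>(1) \<rho>U by (simp add: U_def)
  have \<theta>0: "\<theta> 0 = 0" by (simp add: \<theta>_def A(3) vec_eq_iff forall_2)
  have U0: "0 \<in> U" "\<rho> 0 = 0" using W(2) \<theta>0 \<rho>(2)[OF W(2)] by (auto simp: U_def intro: image_eqI[of 0 \<theta> 0])
  have WV: "\<rho> ` U \<subseteq> V" unfolding \<rho>U using W(3) r subset_ball[of "r / 2" r 0] by (auto simp: S_def)
  have \<rho>S: "\<rho> q \<in> S" if "q \<in> U" for q using \<rho>U W(3) that by blast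
  have \<rho>2: "\<rho> q $ 2 = q $ 2" if "q \<in> U" for q
  proof -
    have "\<theta> (\<rho> q) $ 2 = q $ 2" using \<rho>(3) that by (simp add: U_def)
    then show ?thesis by (simp add: \<theta>_def)
  qed
  have d\<rho>: "\<rho> differentiable (at q)" if "q \<in> U" for q
    using dU that by (auto simp: diffeo_on_def intro: smooth_on_differentiable)
  have oU: "open U" using dU by (simp add: diffeo_on_def)
  have s\<rho>: "smooth_on U \<rho>" using dU by (simp add: diffeo_on_def)
  \<comment> \<open>The derivative of the inverse is read off from
    \<open>\<theta> \<circ> \<rho> = id\<close>.\<close>
  have D\<rho>: "m (\<rho> q $ 1) * frechet_derivative \<rho> (at q) X $ 1 = X$1" "frechet_derivative \<rho> (at q) X $ 2 = X$2" if q: "q \<in> U" for q X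
  proof -
    have "frechet_derivative (\<theta> \<circ> \<rho>) (at q) = frechet_derivative (\<lambda>x. x) (at q)"
      by (rule frechet_derivative_cong_open[OF oU q]) (simp add: \<rho>(3) U_def)
    then have "(vector [m (\<rho> q $ 1) * frechet_derivative \<rho> (at q) X $ 1, frechet_derivative \<rho> (at q) X $ 2] :: real^2) = X"
      using frechet_chain[OF d\<rho>[OF q] differentiableI[OF d\<theta>[OF \<rho>S[OF q]]], of X] frechet_derivative_eqI[OF d\<theta>[OF \<rho>S[OF q]]] by simp
    then show "m (\<rho> q $ 1) * frechet_derivative \<rho> (at q) X $ 1 = X$1" "frechet_derivative \<rho> (at q) X $ 2 = X$2"
      by (metis vector_2)+
  qed
  have mq: "m (\<rho> q $ 1) > 0" if "q \<in> U" for q using S1[OF \<rho>S[OF that]] r by (intro mpos) auto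
  have p1: "partial 1 (f \<circ> (\<phi> \<circ> \<rho>)) q = (1 / m (\<rho> q $ 1)) *\<^sub>R partial 1 F (\<rho> q)" if q: "q \<in> U" for q
    unfolding partial_def[of 1 "f \<circ> (\<phi> \<circ> \<rho>)"] derivative_compose[OF dU WV q]
    using D\<rho>[OF q, of "axis 1 1"] mq[OF q] by (simp add: field_simps axis_def)
  have p2: "partial 2 (f \<circ> (\<phi> \<circ> \<rho>)) q = q$2 *\<^sub>R g (\<rho> q)" if q: "q \<in> U" for q
  proof -
    have "\<rho> q \<in> V" using WV q by blast
    then show ?thesis
    unfolding partial_def[of 2 "f \<circ> (\<phi> \<circ> \<rho>)"] derivative_compose[OF dU WV q]
    using D\<rho>[OF q, of "axis 2 1"] mq[OF q] by (simp add: axis_def partial_2 \<rho>2[OF q])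
  qed
  interpret C: front_chart \<Sigma> f \<nu> p U "\<phi> \<circ> \<rho>"
    by (rule front_chart_compose[OF dU WV U0])
  have "edge_chart \<Sigma> f \<nu> p U (\<phi> \<circ> \<rho>) (\<lambda>q. g (\<rho> q))"
  proof
    show "smooth_on U (\<lambda>q. g (\<rho> q))"
      by (rule smooth_on_compose[OF oU open_V WV s\<rho> smooth_g])
    show "cross3 (partial 1 (f \<circ> (\<phi> \<circ> \<rho>)) q) (g (\<rho> q)) \<noteq> 0" if "q \<in> U" for q
      using independent[of "\<rho> q"] WV that mq[OF that] by (auto simp: p1 cross_mult_left)
  qed (rule p2)
  moreover have "norm (partial 1 (f \<circ> (\<phi> \<circ> \<rho>)) q) = 1" if "q \<in> U" "q$2 = 0" for q
  proof -
    have "\<rho> q = vector [\<rho> q $ 1, 0]" using \<rho>2[OF that(1)] that(2) by (simp add: vec_eq_iff forall_2)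
    then have "m (\<rho> q $ 1) = norm (partial 1 F (\<rho> q))" unfolding m_def by metis
    then show ?thesis using mq[OF that(1)] by (simp add: p1[OF that(1)])
  qed
  ultimately show ?thesis by (rule that)
qed

lemma cuspidal_edge_coordinates_exist:
  assumes unit: "\<And>q. q \<in> V \<Longrightarrow> q$2 = 0 \<Longrightarrow> norm (partial 1 F q) = 1"
  obtains U \<rho> g' where "cuspidal_edge_coordinates \<Sigma> f \<nu> p U (\<phi> \<circ> \<rho>) g'"
proof -
  obtain r where r: "r > 0" "ball 0 r \<subseteq> V" using open_V origin open_contains_ball by blast
  \<comment> \<open>If the cross product of \<open>F\<^sub>u\<close> and \<open>g\<close> points
    against the normal at the origin, reversing \<open>u\<close> corrects it.\<close>
  define \<sigma> where "\<sigma> = sgn (cross3 (partial 1 F 0) (g 0) \<bullet> N 0)"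
  have det0: "cross3 (partial 1 F 0) (g 0) \<bullet> N 0 \<noteq> 0"
    by (rule cross3_dot_normal_nonzero[OF unit_N tangent_partial normal_g independent]) (rule origin)+
  then have \<sigma>: "\<bar>\<sigma>\<bar> = 1" "\<sigma> * (cross3 (partial 1 F 0) (g 0) \<bullet> N 0) > 0"
    by (auto simp: \<sigma>_def sgn_if)
  \<comment> \<open>The argument is \<open>\<sigma> * x\<close> because \<open>\<rho>\<close> below
    maps \<open>(x, 0)\<close> to \<open>(\<sigma> x, 0)\<close>.\<close>
  define T where "T x = partial 1 F (vector [\<sigma> * x, 0])" for x
  define G where "G x = g (vector [\<sigma> * x, 0])" for x
  \<comment> \<open>In the new chart the second \<open>v\<close>-derivative on the axis is
    \<open>b T + c\<^sup>2 G\<close>. It has to be the normalized component of \<open>G\<close>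
    orthogonal to the unit vector \<open>T\<close>, which forces \<open>c\<^sup>2 = 1 / P\<close>
    and \<open>b = -(G \<bullet> T) / P\<close>. Along the axis \<open>\<rho>\<close> only changes
    the sign of \<open>u\<close>, so unit speed persists.\<close>
  define P where "P x = norm (G x - (G x \<bullet> T x) *\<^sub>R T x)" for x
  define b where "b x = - (G x \<bullet> T x) / P x" for x
  define c where "c x = sqrt (1 / P x)" for x
  let ?I = "{-r<..<r}"
  have inV: "(vector [\<sigma> * x, 0] :: real^2) \<in> V" if "x \<in> ?I" for x
    using r(2) that \<sigma>(1) by (force simp: norm_vector2_0 abs_mult)
  have T1: "T x \<bullet> T x = 1" if "x \<in> ?I" for x
    using unit[OF inV[OF that]] by (simp add: T_def dot_square_norm)
  have Pne: "G x - (G x \<bullet> T x) *\<^sub>R T x \<noteq> 0" if "x \<in> ?I" for x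
  proof
    assume "G x - (G x \<bullet> T x) *\<^sub>R T x = 0"
    then have "cross3 (T x) (G x) = 0"
      unfolding cross3_eq_0_iff by (intro exI[of _ "- (G x \<bullet> T x)"] exI[of _ 1]) simp
    then show False using independent[OF inV[OF that]] by (simp add: T_def G_def)
  qed
  have P0: "P x > 0" if "x \<in> ?I" for x using Pne[OF that] by (simp add: P_def)
  have sT: "smooth_on ?I T" "smooth_on ?I G"
    unfolding T_def G_def
    by (rule smooth_on_axis_line[OF _ open_V r(2) \<sigma>(1)] smooth_on_partial smooth_F smooth_g)+
  have sP: "smooth_on ?I P"
    unfolding P_def[abs_def] by (intro smooth_intros sT Pne) auto
  have sb: "smooth_on ?I b"
    unfolding b_def[abs_def] by (intro smooth_intros sT sP less_imp_neq[OF P0, symmetric]) auto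
  have sc: "smooth_on ?I c"
    unfolding c_def[abs_def] by (intro smooth_intros sP less_imp_neq[OF P0, symmetric]) (auto intro: P0)
  have cpos: "c x > 0" "(c x)^2 = 1 / P x" if "x \<in> ?I" for x
    using P0[OF that] by (simp_all add: c_def)
  define \<rho> where "\<rho> q = (vector [\<sigma> * q$1 + b (q$1) * (q$2)^2 / 2, c (q$1) * q$2] :: real^2)" for q :: "real^2"
  define B where "B = ball (0::real^2) r"
  have B1: "q$1 \<in> ?I" if "q \<in> B" for q
    using component_le_norm_cart[of q 1] that by (auto simp: B_def)
  have s1: "smooth_on B (\<lambda>q. k (q$1))" if "smooth_on ?I k" for k :: "real \<Rightarrow> real"
    by (rule smooth_on_compose[OF _ _ _ _ that]) (use B1 in \<open>auto simp: B_def intro!: smooth_intros\<close>)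
  have sr: "smooth_on B \<rho>"
    unfolding \<rho>_def[abs_def]
    by (intro smooth_on_vector2 smooth_intros s1 sb sc) (auto simp: B_def)
  have dr: "frechet_derivative \<rho> (at q) X = vector [\<sigma> * X$1 + (q$2)^2 / 2 * (frechet_derivative b (at (q$1)) (X$1)) + b (q$1) * q$2 * X$2,
      frechet_derivative c (at (q$1)) (X$1) * q$2 + c (q$1) * X$2]" if "q \<in> B" for q X
  proof -
    have k: "((\<lambda>q. k (q$1)) has_derivative (\<lambda>X. frechet_derivative k (at (q$1)) (X$1))) (at q)"
      if k: "smooth_on ?I k" for k :: "real \<Rightarrow> real"
      by (rule has_derivative_compose[OF bounded_linear_imp_has_derivative[OF bounded_linear_vec_nth]
            smooth_on_has_derivative[OF k B1[OF \<open>q \<in> B\<close>]]])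
    note n = bounded_linear_imp_has_derivative[OF bounded_linear_vec_nth]
    have "(\<rho> has_derivative (\<lambda>X. vector [\<sigma> * X$1 + (q$2)^2 / 2 * (frechet_derivative b (at (q$1)) (X$1)) + b (q$1) * q$2 * X$2,
      frechet_derivative c (at (q$1)) (X$1) * q$2 + c (q$1) * X$2])) (at q)"
      unfolding \<rho>_def vector2_eq_axis
      by (auto intro!: derivative_eq_intros k[OF sb] k[OF sc] n
          simp: fun_eq_iff vec_eq_iff forall_2 axis_def algebra_simps)
    from frechet_derivative_eqI[OF this] show ?thesis by simp
  qed
  have 0: "0 \<in> B" using r by (simp add: B_def)
  have \<rho>0: "\<rho> 0 = 0" by (simp add: \<rho>_def vec_eq_iff forall_2)
  have zI: "0 \<in> ?I" using r by simp
  define S where "S = B \<inter> \<rho> -` V"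
  have S: "open S" "0 \<in> S" "S \<subseteq> B"
    unfolding S_def using continuous_open_preimage[OF smooth_on_continuous_on[OF sr] _ open_V] 0 \<rho>0 origin
    by (auto simp: B_def)
  have "jacobian \<rho> 0 \<noteq> 0"
    using \<sigma>(1) cpos[OF zI] by (auto simp: jacobian_def partial_def dr[OF 0] axis_def)
  then obtain W where W: "open W" "0 \<in> W" "W \<subseteq> S" "diffeo_on W (\<rho> ` W) \<rho>"
    using local_diffeo[OF S(1) smooth_on_subset[OF sr S(3)] S(2)] by blast
  have WV: "\<rho> ` W \<subseteq> V" using W(3) by (auto simp: S_def)
  have WB: "q \<in> B" if "q \<in> W" for q using that W(3) S(3) by blast
  interpret C: front_chart \<Sigma> f \<nu> p W "\<phi> \<circ> \<rho>"
    by (rule front_chart_compose[OF W(4) WV W(2) \<rho>0])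
  \<comment> \<open>The square of \<open>c\<close> has two sources: one factor from the chain rule,
    one from \<open>F\<^sub>v = v g\<close> taken at \<open>\<rho> q\<close>, whose second
    coordinate is \<open>c v\<close>.\<close>
  define g' where "g' q = b (q$1) *\<^sub>R partial 1 F (\<rho> q) + (c (q$1))^2 *\<^sub>R g (\<rho> q)" for q
  have sg': "smooth_on W g'"
    unfolding g'_def[abs_def]
    by (intro smooth_intros W smooth_on_subset[OF s1[OF sb]] smooth_on_subset[OF s1[OF sc]]
        smooth_on_compose[OF W(1) open_V WV smooth_on_subset[OF sr]] smooth_on_partial[OF smooth_F] smooth_g)
      (use WB in blast)+
  have p2: "partial 2 (f \<circ> (\<phi> \<circ> \<rho>)) q = q$2 *\<^sub>R g' q" if q: "q \<in> W" for q
  proof -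
    have "\<rho> q \<in> V" using WV q by blast
    then show ?thesis
      unfolding partial_def[of 2 "f \<circ> (\<phi> \<circ> \<rho>)"] derivative_compose[OF W(4) WV q] dr[OF WB[OF q]]
      by (simp add: axis_def partial_2 g'_def \<rho>_def power2_eq_square algebra_simps linear_0[OF linear_frechet]
          smooth_on_differentiable[OF sb B1[OF WB[OF q]]] smooth_on_differentiable[OF sc B1[OF WB[OF q]]])
  qed
  have on_axis: "\<rho> q = vector [\<sigma> * q$1, 0]" if "q$2 = 0" for q using that by (simp add: \<rho>_def)
  have p1: "partial 1 (f \<circ> (\<phi> \<circ> \<rho>)) q = \<sigma> *\<^sub>R T (q$1)" if q: "q \<in> W" "q$2 = 0" for q
    unfolding partial_def[of 1 "f \<circ> (\<phi> \<circ> \<rho>)"] derivative_compose[OF W(4) WV q(1)] dr[OF WB[OF q(1)]]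
    using q(2) by (simp add: axis_def T_def on_axis)
  have g'_axis: "g' q = (1 / P (q$1)) *\<^sub>R (G (q$1) - (G (q$1) \<bullet> T (q$1)) *\<^sub>R T (q$1))" if q: "q \<in> W" "q$2 = 0" for q
    unfolding g'_def on_axis[OF q(2)] cpos(2)[OF B1[OF WB[OF q(1)]]]
    by (simp add: b_def T_def G_def scaleR_diff_right)
  define d where "d q = cross3 (partial 1 (f \<circ> (\<phi> \<circ> \<rho>)) q) (g' q) \<bullet> (\<nu> \<circ> (\<phi> \<circ> \<rho>)) q" for q
  have sd: "continuous_on W d"
    unfolding d_def[abs_def]
    by (intro smooth_on_continuous_on smooth_intros W sg' C.smooth_F C.smooth_N)
  have d0: "d 0 > 0"
  proof -
    have "d 0 = (1 / P 0) * (\<sigma> * (cross3 (partial 1 F 0) (g 0) \<bullet> N 0))"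
      using p1[OF W(2)] g'_axis[OF W(2)] on_axis[of 0]
      by (simp add: d_def cross_mult_left cross_mult_right Cross3.right_diff_distrib T_def G_def \<rho>0)
    then show ?thesis using \<sigma>(2) P0[OF zI] by simp
  qed
  \<comment> \<open>The orientation is right at the origin by the choice of \<open>\<sigma>\<close>;
    shrinking the domain extends it to all points.\<close>
  define U where "U = W \<inter> d -` {0<..}"
  have U: "open U" "0 \<in> U" "U \<subseteq> W"
    unfolding U_def using continuous_open_preimage[OF sd W(1) open_greaterThan[of 0]] W(2) d0 by auto
  interpret D: front_chart \<Sigma> f \<nu> p U "\<phi> \<circ> \<rho>"
    by (rule C.front_chart_restrict[OF U(1,3,2)])
  interpret E: edge_chart \<Sigma> f \<nu> p U "\<phi> \<circ> \<rho>" g'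
  proof
    show "smooth_on U g'" by (rule smooth_on_subset[OF sg' U(3)])
    show "partial 2 (f \<circ> (\<phi> \<circ> \<rho>)) q = q $ 2 *\<^sub>R g' q" if "q \<in> U" for q
      using p2 that U(3) by blast
    show "cross3 (partial 1 (f \<circ> (\<phi> \<circ> \<rho>)) q) (g' q) \<noteq> 0" if "q \<in> U" for q
      using that by (auto simp: U_def d_def)
  qed
  have "cuspidal_edge_coordinates \<Sigma> f \<nu> p U (\<phi> \<circ> \<rho>) g'"
    unfolding cuspidal_edge_coordinates_def Let_def
  proof (intro conjI ballI impI)
    fix q assume q: "q \<in> U"
    show "(\<nu> \<circ> (\<phi> \<circ> \<rho>)) q = cross3 (partial 1 (f \<circ> (\<phi> \<circ> \<rho>)) q) (g' q) /\<^sub>R norm (cross3 (partial 1 (f \<circ> (\<phi> \<circ> \<rho>)) q) (g' q))"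
      by (rule unit_normal_eq[OF D.unit_N[OF q] D.tangent_partial[OF q] E.normal_g[OF q]])
        (use q in \<open>simp add: U_def d_def\<close>)
    show "partial 2 (f \<circ> (\<phi> \<circ> \<rho>)) q = q $ 2 *\<^sub>R g' q" by (rule E.partial_2[OF q])
    assume z: "q$2 = 0"
    have qW: "q \<in> W" using q U by blast
    note I = B1[OF WB[OF qW]]
    show "partial 2 (f \<circ> (\<phi> \<circ> \<rho>)) q = 0" using E.partial_2[OF q] z by simp
    show "norm (partial 1 (f \<circ> (\<phi> \<circ> \<rho>)) q) = 1"
      using unit[OF inV[OF I]] \<sigma>(1) by (simp add: p1[OF qW z] T_def)
    show "norm (partial 2 (partial 2 (f \<circ> (\<phi> \<circ> \<rho>))) q) = 1"
      unfolding E.partial_22[OF q z] g'_axis[OF qW z] using P0[OF I] by (simp add: P_def)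
    show "norm ((\<nu> \<circ> (\<phi> \<circ> \<rho>)) q) = 1" by (rule D.unit_N[OF q])
    show "partial 1 (f \<circ> (\<phi> \<circ> \<rho>)) q \<bullet> partial 2 (partial 2 (f \<circ> (\<phi> \<circ> \<rho>))) q = 0"
      unfolding E.partial_22[OF q z] g'_axis[OF qW z] p1[OF qW z]
      using T1[OF I] by (simp add: inner_diff_right inner_commute)
    show "partial 1 (f \<circ> (\<phi> \<circ> \<rho>)) q \<bullet> (\<nu> \<circ> (\<phi> \<circ> \<rho>)) q = 0" by (rule D.tangent_partial[OF q])
    show "partial 2 (partial 2 (f \<circ> (\<phi> \<circ> \<rho>))) q \<bullet> (\<nu> \<circ> (\<phi> \<circ> \<rho>)) q = 0"
      unfolding E.partial_22[OF q z] by (rule E.normal_g[OF q])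
  qed (fact D.chart E.singular_axis E.smooth_g)+
  then show ?thesis by (rule that)
qed

end

lemma cuspidal_edge_coordinates_at_cuspidal_edge:
  assumes "cuspidal_edge \<Sigma> f p" "front \<Sigma> f \<nu>" "open \<Sigma>"
  obtains V \<phi> g where "cuspidal_edge_coordinates \<Sigma> f \<nu> p V \<phi> g"
  by (metis assms cuspidal_edge_imp_edge_chart edge_chart.arc_length_chart edge_chart.cuspidal_edge_coordinates_exist)

section \<open>Adapted coordinates at a singular point of the second kind\<close>

lemma singular_iff_signed_area:
  assumes "frontal \<Sigma> f \<nu>" "q \<in> \<Sigma>"
  shows "q \<in> singular_set \<Sigma> f \<longleftrightarrow> signed_area f \<nu> q = 0"
proof -
  have d: "f differentiable (at q)" and n: "norm (\<nu> q) = 1" and t: "partial i f q \<bullet> \<nu> q = 0" for i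
    using assms by (auto simp: frontal_def partial_def intro: smooth_on_differentiable)
  have "cross3 (partial 1 f q) (partial 2 f q) = 0 \<longleftrightarrow> cross3 (partial 1 f q) (partial 2 f q) \<bullet> \<nu> q = 0"
    using cross3_dot_normal_nonzero[OF n t t] by force
  then show ?thesis
    using assms(2) by (simp add: singular_set_def inj_frechet_iff_cross3[OF d] signed_area_cross)
qed

lemma cross3_linear_combination:
  "cross3 (a *\<^sub>R x + b *\<^sub>R y) (c *\<^sub>R x + d *\<^sub>R y) = (a * d - b * c) *\<^sub>R cross3 x y"
  by (simp add: cross3_simps forall_3)

lemma (in front_chart) signed_area_chart:
  assumes q: "q \<in> V"
  shows "signed_area F N q = jacobian \<phi> q * signed_area f \<nu> (\<phi> q)"
proof -
  have pF: "partial i F q = partial i \<phi> q $ 1 *\<^sub>R partial 1 f (\<phi> q) + partial i \<phi> q $ 2 *\<^sub>R partial 2 f (\<phi> q)" for i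
    unfolding partial_def[of i] derivative_F[OF q]
      frechet_partials[OF smooth_on_differentiable[OF smooth_f \<phi>_in[OF q]]] ..
  show ?thesis
    unfolding signed_area_cross pF cross3_linear_combination by (simp add: jacobian_def)
qed

lemma straightened_chart:
  assumes fr: "front \<Sigma> f \<nu>" and \<Sigma>: "open \<Sigma>" and nd: "non_degenerate \<Sigma> f \<nu> p"
  obtains V \<phi> where "front_chart \<Sigma> f \<nu> p V \<phi>" "\<And>q. q \<in> V \<Longrightarrow> signed_area f \<nu> (\<phi> q) = q$2"
proof -
  have sf: "smooth_on \<Sigma> f" "smooth_on \<Sigma> \<nu>" "frontal \<Sigma> f \<nu>" using fr by (auto simp: front_def frontal_def)
  have p: "p \<in> \<Sigma>" "signed_area f \<nu> p = 0"
    using nd singular_iff_signed_area[OF sf(3), of p] by (auto simp: non_degenerate_def singular_set_def)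
  define s where "s = signed_area f \<nu>"
  have ss: "smooth_on \<Sigma> s" unfolding s_def by (rule smooth_on_signed_area[OF \<Sigma> sf(1,2)])
  \<comment> \<open>The first coordinate is a linear form with the gradient of
    \<open>\<lambda>\<close> at \<open>p\<close>, turned by a right angle, as its coefficients. The
    Jacobian at \<open>p\<close> is then the squared length of that gradient.\<close>
  define \<theta> where "\<theta> q = (vector [partial 2 s p * (q$1 - p$1) - partial 1 s p * (q$2 - p$2), s q] :: real^2)" for q
  have st: "smooth_on \<Sigma> \<theta>"
    unfolding \<theta>_def[abs_def] by (intro smooth_on_vector2 smooth_intros ss \<Sigma>)
  note n = bounded_linear_imp_has_derivative[OF bounded_linear_vec_nth]
  have "(\<theta> has_derivative (\<lambda>X. vector [partial 2 s p * X$1 - partial 1 s p * X$2, frechet_derivative s (at p) X])) (at p)"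
    unfolding \<theta>_def vector2_eq_axis
    by (auto intro!: derivative_eq_intros n smooth_on_has_derivative[OF ss p(1)])
  note D = frechet_derivative_eqI[OF this]
  have "partial 1 s p \<noteq> 0 \<or> partial 2 s p \<noteq> 0"
    using nd frechet_partials[OF smooth_on_differentiable[OF ss p(1)]]
    by (auto simp: non_degenerate_def s_def fun_eq_iff)
  then have "(partial 1 s p)^2 + (partial 2 s p)^2 \<noteq> 0" by (simp add: sum_power2_eq_zero_iff)
  then have "jacobian \<theta> p \<noteq> 0"
    by (simp add: jacobian_def partial_def[of _ \<theta>] D axis_def power2_eq_square flip: partial_def)
      (simp add: partial_def axis_def algebra_simps)
  then obtain W where W: "open W" "p \<in> W" "W \<subseteq> \<Sigma>" "diffeo_on W (\<theta> ` W) \<theta>"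
    using local_diffeo[OF \<Sigma> st p(1)] by blast
  obtain \<phi> where \<phi>: "diffeo_on (\<theta> ` W) W \<phi>" "\<And>x. x \<in> W \<Longrightarrow> \<phi> (\<theta> x) = x" "\<And>y. y \<in> \<theta> ` W \<Longrightarrow> \<theta> (\<phi> y) = y"
    using diffeo_on_inverse[OF W(4)] by metis
  have \<theta>p: "\<theta> p = 0" using p(2) by (simp add: \<theta>_def s_def vec_eq_iff forall_2)
  have im: "\<phi> ` (\<theta> ` W) = W" using \<phi>(1) by (simp add: diffeo_on_def)
  have "front_chart \<Sigma> f \<nu> p (\<theta> ` W) \<phi>"
  proof
    have "0 \<in> \<theta> ` W" using W(2) \<theta>p by (metis image_eqI)
    moreover have "\<phi> 0 = p" using \<phi>(2)[OF W(2)] \<theta>p by simp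
    ultimately show "coordinates_at \<Sigma> p (\<theta> ` W) \<phi>"
      using \<phi>(1) W(3) by (simp add: coordinates_at_def im)
  qed (fact fr \<Sigma>)+
  moreover have "signed_area f \<nu> (\<phi> q) = q$2" if "q \<in> \<theta> ` W" for q
  proof -
    have "\<theta> (\<phi> q) $ 2 = q $ 2" using \<phi>(3)[OF that] by simp
    then show ?thesis by (simp add: \<theta>_def s_def)
  qed
  ultimately show ?thesis by (rule that)
qed

text \<open>\<open>\<lambda>\<close> is quadratic in the first derivatives of \<open>f\<close>, so
  if both vanish at \<open>p\<close>, its differential vanishes there too.\<close>

lemma non_degenerate_partials:
  assumes fr: "front \<Sigma> f \<nu>" and nd: "non_degenerate \<Sigma> f \<nu> p"
  shows "partial 1 f p \<noteq> 0 \<or> partial 2 f p \<noteq> 0"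
proof (rule ccontr)
  assume "\<not> ?thesis"
  then have z: "partial 1 f p = 0" "partial 2 f p = 0" by auto
  have p: "p \<in> \<Sigma>" using nd by (simp add: non_degenerate_def singular_set_def)
  have sf: "smooth_on \<Sigma> f" "smooth_on \<Sigma> \<nu>" using fr by (auto simp: front_def frontal_def)
  have d: "partial i f differentiable (at p)" for i
    by (rule smooth_on_differentiable[OF smooth_on_partial[OF sf(1)] p])
  have "((\<lambda>q. cross3 (partial 1 f q) (partial 2 f q)) has_derivative (\<lambda>X. 0)) (at p)"
    using bounded_bilinear.FDERIV[OF bounded_bilinear_cross3 has_derivative_frechet[OF d[of 1]] has_derivative_frechet[OF d[of 2]]]
    by (simp add: z)
  from has_derivative_inner[OF this smooth_on_has_derivative[OF sf(2) p]]
  have "(signed_area f \<nu> has_derivative (\<lambda>X. 0)) (at p)"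
    unfolding signed_area_cross[abs_def] by (simp add: z)
  then show False using nd frechet_derivative_eqI by (auto simp: non_degenerate_def)
qed

lemma (in front_chart) second_kind_coordinates_exist:
  assumes straight: "\<And>q. q \<in> V \<Longrightarrow> signed_area f \<nu> (\<phi> q) = q$2"
    and sk: "second_kind \<Sigma> f \<nu> p"
  obtains U \<rho> e h where "second_kind_coordinates \<Sigma> f \<nu> p U (\<phi> \<circ> \<rho>) e h"
proof -
  have nd: "non_degenerate \<Sigma> f \<nu> p" and nf: "\<not> first_kind \<Sigma> f \<nu> p"
    using sk by (auto simp: second_kind_def)
  have fr: "frontal \<Sigma> f \<nu>" using front by (simp add: front_def)
  have "singular_set V F = {q \<in> V. q$2 = 0}"
    unfolding singular_chart using singular_iff_signed_area[OF fr \<phi>_in] straight by auto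
  \<comment> \<open>With \<open>F\<^sub>u \<noteq> 0\<close> the point would be of the first
    kind.\<close>
  then have F10: "partial 1 F 0 = 0" using first_kindI nd nf by blast
  define k where "k = partial 2 F 0"
  have k: "k \<noteq> 0"
  proof
    assume "k = 0"
    then have z: "frechet_derivative F (at 0) X = 0" for X
      using F10 by (simp add: k_def frechet_partials[OF smooth_on_differentiable[OF smooth_F origin]])
    have "frechet_derivative f (at p) Y = 0" for Y
      using derivative_F[OF origin] z \<phi>_0 bij_is_surj[OF derivative_\<phi>_bij[OF origin]] by (metis surjD)
    then show False using non_degenerate_partials[OF front nd] by (simp add: partial_def)
  qed
  define F12 where "F12 = partial 2 (partial 1 F) 0"
  \<comment> \<open>In the chart \<open>\<phi>\<close> the signed area is
    \<open>jacobian \<phi>\<close> times \<open>v\<close>, so the sign of the Jacobian decides on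
    which side the normal lies.\<close>
  define \<sigma> where "\<sigma> = sgn (jacobian \<phi> 0)"
  have J0: "jacobian \<phi> 0 \<noteq> 0"
    using inj_frechet_iff_jacobian[OF smooth_on_differentiable[OF smooth_\<phi> origin]] bij_is_inj[OF derivative_\<phi>_bij[OF origin]] by simp
  then have \<sigma>: "\<sigma>^2 = 1" "\<sigma> \<noteq> 0" "\<sigma> * jacobian \<phi> 0 > 0" by (auto simp: \<sigma>_def sgn_if)
  define a where "a = 1 / norm k"
  \<comment> \<open>In the new chart \<open>F\<^sub>v\<close> becomes \<open>a k\<close> and
    \<open>F\<^sub>u\<^sub>v\<close> becomes \<open>\<sigma> a F12 + b k\<close> at the origin. The
    choice of \<open>a\<close> makes the former a unit vector, that of \<open>b\<close> makes the
    two orthogonal.\<close>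
  define b where "b = - \<sigma> * a * (F12 \<bullet> k) / (k \<bullet> k)"
  have a: "a > 0" using k by (simp add: a_def)
  define \<rho> where "\<rho> q = (vector [\<sigma> * q$1, (a + b * q$1) * q$2] :: real^2)" for q :: "real^2"
  have sr: "smooth_on UNIV \<rho>"
    unfolding \<rho>_def[abs_def] by (intro smooth_on_vector2 smooth_intros open_UNIV)
  note n = bounded_linear_imp_has_derivative[OF bounded_linear_vec_nth]
  have "(\<rho> has_derivative (\<lambda>X. vector [\<sigma> * X$1, b * X$1 * q$2 + (a + b * q$1) * X$2])) (at q)" for q
    unfolding \<rho>_def vector2_eq_axis by (auto intro!: derivative_eq_intros n simp: fun_eq_iff vec_eq_iff forall_2 axis_def algebra_simps)
  note dr = frechet_derivative_eqI[OF this]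
  have \<rho>0: "\<rho> 0 = 0" by (simp add: \<rho>_def vec_eq_iff forall_2)
  define S where "S = \<rho> -` V \<inter> {q. a + b * q$1 > 0}"
  have S: "open S" "0 \<in> S"
  proof -
    have "open (\<rho> -` V)"
      using continuous_open_vimage[OF open_V] smooth_on_continuous_on[OF sr] open_vimage[OF open_V] by blast
    moreover have "open {q::real^2. a + b * q$1 > 0}"
      by (intro open_Collect_less continuous_intros)
    ultimately show "open S" unfolding S_def by blast
    show "0 \<in> S" using \<rho>0 origin a by (simp add: S_def)
  qed
  have "jacobian \<rho> 0 \<noteq> 0"
    using \<sigma> a by (simp add: jacobian_def partial_def dr axis_def)
  then obtain W where W: "open W" "0 \<in> W" "W \<subseteq> S" "diffeo_on W (\<rho> ` W) \<rho>"
    using local_diffeo[OF S(1) smooth_on_subset[OF sr] S(2)] by blast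
  have WV: "\<rho> ` W \<subseteq> V" using W(3) by (auto simp: S_def)
  have pos: "a + b * q$1 > 0" if "q \<in> W" for q using W(3) that by (auto simp: S_def)
  interpret C: front_chart \<Sigma> f \<nu> p W "\<phi> \<circ> \<rho>"
    by (rule front_chart_compose[OF W(4) WV W(2) \<rho>0])
  have p1: "partial 1 C.F q = \<sigma> *\<^sub>R partial 1 F (\<rho> q) + (b * q$2) *\<^sub>R partial 2 F (\<rho> q)" if "q \<in> W" for q
    unfolding partial_def[of 1 C.F] derivative_compose[OF W(4) WV that] dr by (simp add: axis_def)
  have p2: "partial 2 C.F q = (a + b * q$1) *\<^sub>R partial 2 F (\<rho> q)" if "q \<in> W" for q
    unfolding partial_def[of 2 C.F] derivative_compose[OF W(4) WV that] dr by (simp add: axis_def)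
  have C10: "partial 1 C.F 0 = 0" using p1[OF W(2)] F10 \<rho>0 by simp
  have C20: "partial 2 C.F 0 = a *\<^sub>R k" using p2[OF W(2)] \<rho>0 by (simp add: k_def)
  have C12: "partial 2 (partial 1 C.F) 0 = (\<sigma> * a) *\<^sub>R F12 + b *\<^sub>R k"
  proof -
    have r: "(\<rho> has_derivative frechet_derivative \<rho> (at 0)) (at 0)"
      by (rule smooth_on_has_derivative[OF sr]) simp
    have d: "((\<lambda>q. partial i F (\<rho> q)) has_derivative (\<lambda>X. frechet_derivative (partial i F) (at (\<rho> 0)) (frechet_derivative \<rho> (at 0) X))) (at 0)" for i
      by (rule has_derivative_compose[OF r smooth_on_has_derivative[OF smooth_on_partial[OF smooth_F]]]) (simp add: \<rho>0 origin)
    have b: "((\<lambda>q. b * q$2) has_derivative (\<lambda>X. b * X$2)) (at (0::real^2))"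
      by (auto intro!: derivative_eq_intros n)
    have "partial 2 (partial 1 C.F) 0 = partial 2 (\<lambda>q. \<sigma> *\<^sub>R partial 1 F (\<rho> q) + (b * q$2) *\<^sub>R partial 2 F (\<rho> q)) 0"
      by (rule partial_cong_open[OF W(1,2)]) (rule p1)
    also have "\<dots> = \<sigma> *\<^sub>R frechet_derivative (partial 1 F) (at 0) (vector [0, a]) + b *\<^sub>R k"
      unfolding partial_def[of 2 "\<lambda>q. \<sigma> *\<^sub>R partial 1 F (\<rho> q) + (b * q$2) *\<^sub>R partial 2 F (\<rho> q)"]
        frechet_derivative_eqI[OF has_derivative_add[OF has_derivative_scaleR_right[OF d] has_derivative_scaleR[OF b d]]]
      by (simp add: dr \<rho>0 axis_def k_def)
    also have "\<dots> = (\<sigma> * a) *\<^sub>R F12 + b *\<^sub>R k"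
      by (simp add: frechet_partials[OF smooth_on_differentiable[OF smooth_on_partial[OF smooth_F] origin]] F12_def)
    finally show ?thesis .
  qed
  have axis: "singular_set W C.F = {q \<in> W. q$2 = 0}"
  proof -
    have "signed_area f \<nu> ((\<phi> \<circ> \<rho>) q) = (a + b * q$1) * q$2" if "q \<in> W" for q
      using straight[of "\<rho> q"] WV that by (auto simp: \<rho>_def)
    then show ?thesis
      unfolding C.singular_chart using singular_iff_signed_area[OF fr C.\<phi>_in] pos by fastforce
  qed
  have "continuous_on W (partial 2 C.F)" by (intro smooth_on_continuous_on smooth_on_partial C.smooth_F)
  from continuous_open_preimage[OF this W(1), of "- {0}"]
  have "open (W \<inter> partial 2 C.F -` (- {0}))" by auto
  moreover have "0 \<in> W \<inter> partial 2 C.F -` (- {0})" using W(2) C20 a k by auto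
  ultimately obtain r where r: "r > 0" "ball 0 r \<subseteq> W \<inter> partial 2 C.F -` (- {0})"
    using open_contains_ball by blast
  have rW: "ball 0 r \<subseteq> W" using r(2) by auto
  have ne: "partial 2 C.F q \<noteq> 0" if "q \<in> ball 0 r" for q
    using r(2) that by auto
  \<comment> \<open>The projection coefficient that makes \<open>\<partial>u + e \<partial>v\<close>
    null along the axis. It is formed from values on the axis alone, since \<open>e\<close> has to
    be a function of \<open>u\<close>.\<close>
  define e where "e x = - ((partial 2 C.F (vector [x, 0]) \<bullet> partial 1 C.F (vector [x, 0]))
    / (partial 2 C.F (vector [x, 0]) \<bullet> partial 2 C.F (vector [x, 0])))" for x
  have line: "smooth_on {-r<..<r} (\<lambda>x. partial i C.F (vector [x, 0]))" for i
    using smooth_on_axis_line[OF smooth_on_partial[OF C.smooth_F] W(1) rW, of 1] by simp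
  have ne': "partial 2 C.F (vector [x, 0]) \<bullet> partial 2 C.F (vector [x, 0]) \<noteq> 0" if "x \<in> {-r<..<r}" for x
  proof -
    have "(vector [x, 0] :: real^2) \<in> ball 0 r" using that by (auto simp: norm_vector2_0)
    then show ?thesis using ne by auto
  qed
  have se: "smooth_on {-r<..<r} e"
    unfolding e_def[abs_def] by (intro smooth_intros line ne') auto
  have e0: "e 0 = 0"
  proof -
    have "(vector [0, 0] :: real^2) = 0" by (simp add: vec_eq_iff forall_2)
    then show ?thesis using C10 by (simp add: e_def)
  qed
  have I: "q$1 \<in> {-r<..<r}" if "q \<in> ball 0 r" for q :: "real^2"
    using component_le_norm_cart[of q 1] that by auto
  define H where "H q = partial 1 C.F q + e (q$1) *\<^sub>R partial 2 C.F q" for q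
  have sH: "smooth_on (ball 0 r) H"
    unfolding H_def[abs_def]
  proof (intro smooth_intros open_ball smooth_on_subset[OF C.smooth_F rW])
    show "smooth_on (ball 0 r) (\<lambda>q::real^2. e (q$1))"
    proof (rule smooth_on_compose[OF open_ball _ _ _ se])
      show "(\<lambda>q. q$1) ` ball (0::real^2) r \<subseteq> {-r<..<r}" by (intro image_subsetI I)
    qed (auto intro!: smooth_intros)
  qed
  have H0: "H q = 0" if q: "q \<in> ball 0 r" "q$2 = 0" for q
  proof -
    have "vector [q$1, 0] = q" using q(2) by (simp add: vec_eq_iff forall_2)
    moreover have "q \<in> singular_set W C.F" using axis q rW by auto
    ultimately show ?thesis
      unfolding H_def e_def by (subst C.singular_partials[of q 2 1]) (auto simp: ne[OF q(1)])
  qed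
  obtain h where h: "smooth_on (ball 0 r) h" "\<And>q. q \<in> ball 0 r \<Longrightarrow> H q = q$2 *\<^sub>R h q"
    using divide_by_second_coordinate[OF sH H0] by blast
  define d where "d q = cross3 (h q) (partial 2 C.F q) \<bullet> C.N q" for q
  have sd: "smooth_on (ball 0 r) d"
    unfolding d_def[abs_def] by (intro smooth_intros open_ball h smooth_on_subset[OF C.smooth_F rW] smooth_on_subset[OF C.smooth_N rW])
  \<comment> \<open>Off the axis \<open>v * d\<close> is the signed area of the new chart, which the
    chain rule and the straightened \<open>\<lambda>\<close> give as \<open>v * ?d\<close>.
    Continuity yields \<open>d 0\<close>, positive by the choice of \<open>\<sigma>\<close>.\<close>
  let ?d = "\<lambda>q. \<sigma> * (a + b * q$1)^2 * jacobian \<phi> (\<rho> q)"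
  have d0: "d 0 > 0"
  proof -
    have "smooth_on (ball 0 r) (\<lambda>q. jacobian \<phi> (\<rho> q))"
      by (rule smooth_on_compose[OF _ open_V _ smooth_on_subset[OF sr] smooth_on_jacobian[OF open_V smooth_\<phi>]]) (use WV rW in auto)
    then have "smooth_on (ball 0 r) (\<lambda>q. d q - ?d q)" by (intro smooth_intros sd open_ball)
    then have "d 0 - ?d 0 = 0"
    proof (rule zero_off_axis_imp_zero[OF open_ball smooth_on_continuous_on])
      fix q :: "real^2" assume q: "q \<in> ball 0 r" "q$2 \<noteq> 0"
      have qW: "q \<in> W" using q(1) rW by blast
      then have \<rho>V: "\<rho> q \<in> V" using WV by blast
      have "q$2 * d q = cross3 (H q) (partial 2 C.F q) \<bullet> C.N q"
        unfolding d_def h(2)[OF q(1)] by (simp add: cross_mult_left)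
      also have "\<dots> = cross3 (partial 1 C.F q) (partial 2 C.F q) \<bullet> C.N q"
        unfolding H_def by (simp add: cross_add_left cross_mult_left)
      also have "\<dots> = \<sigma> * (a + b * q$1) * (cross3 (partial 1 F (\<rho> q)) (partial 2 F (\<rho> q)) \<bullet> N (\<rho> q))"
        unfolding p1[OF qW] p2[OF qW] by (simp add: cross_add_left cross_mult_left cross_mult_right)
      also have "\<dots> = \<sigma> * (a + b * q$1) * (jacobian \<phi> (\<rho> q) * (\<rho> q $ 2))"
        using signed_area_chart[OF \<rho>V] straight[OF \<rho>V] by (simp add: signed_area_cross)
      also have "\<dots> = q$2 * ?d q" by (simp add: \<rho>_def power2_eq_square)
      finally show "d q - ?d q = 0" using q(2) by simp
    qed (use r in simp)
    then have "d 0 = a^2 * (\<sigma> * jacobian \<phi> 0)" by (simp add: \<rho>0)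
    then show ?thesis using \<sigma>(3) a by simp
  qed
  have "open (ball 0 r \<inter> d -` {0<..})"
    by (rule continuous_open_preimage[OF smooth_on_continuous_on[OF sd]]) auto
  moreover have "0 \<in> ball 0 r \<inter> d -` {0<..}" using r d0 by simp
  ultimately obtain r' where r': "r' > 0" "ball 0 r' \<subseteq> ball 0 r \<inter> d -` {0<..}"
    using open_contains_ball by blast
  define U where "U = ball (0::real^2) r'"
  have U: "open U" "0 \<in> U" "U \<subseteq> ball 0 r" using r' by (auto simp: U_def)
  have UW: "U \<subseteq> W" using U rW by blast
  interpret D: front_chart \<Sigma> f \<nu> p U "\<phi> \<circ> \<rho>"
    by (rule C.front_chart_restrict[OF U(1) UW U(2)])
  have axisU: "singular_set U D.F = {q \<in> U. q$2 = 0}"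
    using axis UW by (auto simp: singular_set_def)
  have normal_h: "h q \<bullet> D.N q = 0" if "q \<in> U" for q
  proof (rule zero_off_axis_imp_zero[OF U(1) _ _ that])
    show "continuous_on U (\<lambda>q. h q \<bullet> D.N q)"
      by (intro smooth_on_continuous_on smooth_intros U(1) D.smooth_N smooth_on_subset[OF h(1) U(3)])
    fix q assume q: "q \<in> U" "q$2 \<noteq> 0"
    have "q$2 * (h q \<bullet> D.N q) = H q \<bullet> D.N q" using h(2)[of q] q U(3) by auto
    also have "\<dots> = 0" unfolding H_def using D.tangent_partial[OF q(1)] by (simp add: inner_add_left)
    finally show "h q \<bullet> D.N q = 0" using q(2) by simp
  qed
  have "second_kind_coordinates \<Sigma> f \<nu> p U (\<phi> \<circ> \<rho>) e h"
    unfolding second_kind_coordinates_def Let_def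
  proof (intro conjI ballI impI)
    show "norm (partial 2 D.F 0) = 1" unfolding C20 using k by (simp add: a_def)
    show "partial 2 (partial 1 D.F) 0 \<bullet> partial 2 D.F 0 = 0"
      unfolding C12 C20 b_def using k by (simp add: inner_add_left inner_diff_left)
    show "smooth_on ((\<lambda>q. q$1) ` U) e"
      by (rule smooth_on_subset[OF se]) (use I U(3) in blast)
    show "smooth_on U h" by (rule smooth_on_subset[OF h(1) U(3)])
    fix q assume q: "q \<in> U"
    have qr: "q \<in> ball 0 r" using q U by blast
    show eq: "partial 1 D.F q + e (q$1) *\<^sub>R partial 2 D.F q = q$2 *\<^sub>R h q"
      using h(2)[OF qr] by (simp add: H_def)
    show "D.N q = cross3 (h q) (partial 2 D.F q) /\<^sub>R norm (cross3 (h q) (partial 2 D.F q))"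
      by (rule unit_normal_eq[OF D.unit_N[OF q] normal_h[OF q] D.tangent_partial[OF q]])
        (use q r' in \<open>auto simp: U_def d_def\<close>)
    show "frechet_derivative D.F (at q) (vector [1, e (q$1)]) = 0" if "q$2 = 0"
      using eq that frechet_partials[OF smooth_on_differentiable[OF D.smooth_F q]] by simp
  qed (fact D.chart C10 axisU e0)+
  then show ?thesis by (rule that)
qed

section \<open>Sub-parabolic points\<close>

text \<open>The pair \<open>\<kappa>\<close>, \<open>\<kappa>h\<close> exists only on a smaller
  domain, where the discriminant is positive, and \<open>sub_parabolic\<close> wants chart and pair
  on the same domain.\<close>

lemma cuspidal_edge_coordinates_restrict:
  assumes "cuspidal_edge_coordinates \<Sigma> f \<nu> p V \<phi> g" "open V'" "V' \<subseteq> V" "0 \<in> V'"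
  shows "cuspidal_edge_coordinates \<Sigma> f \<nu> p V' \<phi> g"
proof -
  have "singular_set V' (f \<circ> \<phi>) = singular_set V (f \<circ> \<phi>) \<inter> V'"
    using assms(3) by (auto simp: singular_set_def)
  then show ?thesis
    using assms coordinates_at_restrict[of \<Sigma> p V \<phi> V'] smooth_on_subset[of V g V']
    unfolding cuspidal_edge_coordinates_def Let_def by blast
qed

lemma second_kind_coordinates_restrict:
  assumes "second_kind_coordinates \<Sigma> f \<nu> p V \<phi> e h" "open V'" "V' \<subseteq> V" "0 \<in> V'"
  shows "second_kind_coordinates \<Sigma> f \<nu> p V' \<phi> e h"
proof -
  have "singular_set V' (f \<circ> \<phi>) = singular_set V (f \<circ> \<phi>) \<inter> V'"
    using assms(3) by (auto simp: singular_set_def)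
  moreover have "smooth_on ((\<lambda>q. q$1) ` V) e \<Longrightarrow> smooth_on ((\<lambda>q. q$1) ` V') e"
    by (erule smooth_on_subset) (use assms(3) in blast)
  ultimately show ?thesis
    using assms coordinates_at_restrict[of \<Sigma> p V \<phi> V'] smooth_on_subset[of V h V']
    unfolding second_kind_coordinates_def Let_def by blast
qed

context front_chart
begin

text \<open>At the origin \<open>v = \<lambda> = 0\<close> and \<open>F\<^sub>u\<close> is a unit
  vector, so the principal vector is \<open>\<kappa>h \<partial>v\<close>. The chart and the pair
  are arbitrary and the right-hand side mentions neither: the condition does not depend on these
  choices.\<close>

lemma sub_parabolic_iff_in_edge_coordinates:
  assumes c: "cuspidal_edge_coordinates \<Sigma> f \<nu> p V \<phi> g"
    and pair: "principal_curvature_pair V F N \<kappa> \<kappa>h"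
    and bdd: "gauss_curvature_bounded_near \<Sigma> f \<nu> p"
  shows "frechet_derivative \<kappa> (at 0) (cuspidal_edge_principal_vector F N g \<kappa>h 0) = 0
    \<longleftrightarrow> gauss_curvature_value \<Sigma> f \<nu> p = 0"
proof -
  interpret frame: adapted_frame V F N "\<lambda>q. axis 2 1" "\<lambda>q. axis 1 1" g "-1"
    by (rule cuspidal_edge_frame[OF c])
  obtain U where U: "open U" "0 \<in> U" "U \<subseteq> V" "bounded (gauss_curvature F N ` (U - singular_set V F))"
    using gauss_curvature_bounded_chart[OF bdd] by blast
  obtain r Kt k where K: "r > 0" "ball 0 r \<subseteq> U" "smooth_on (ball 0 r) Kt"
    "\<And>q. q \<in> ball 0 r \<Longrightarrow> q$2 \<noteq> 0 \<Longrightarrow> Kt q = gauss_curvature F N q"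
    "frechet_derivative \<kappa> (at 0) = (\<lambda>X. X$2 * k)" "Kt 0 = 0 \<longleftrightarrow> k = 0"
    using frame.gauss_curvature_extension[OF pair U] by blast
  have "gauss_curvature_value \<Sigma> f \<nu> p = Kt 0"
    using gauss_curvature_value_chart[OF frame.singular_axis K(1) _ K(3,4)] K(2) U(3) by blast
  moreover have "cuspidal_edge_principal_vector F N g \<kappa>h 0 $ 2 = \<kappa>h 0"
  proof -
    have "norm (partial 1 F 0) = 1"
      using c origin unfolding cuspidal_edge_coordinates_def Let_def by auto
    then show ?thesis
      by (simp add: cuspidal_edge_principal_vector_def Let_def frame.signed_area_eq[OF origin] dot_square_norm)
  qed
  ultimately show ?thesis
    using K(5,6) frame.unbounded_curvature_nonzero[OF pair] by simp
qed

text \<open>At the origin \<open>v = 0\<close> and \<open>e = 0\<close>, so the principal vector has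
  no \<open>v\<close>-component, and the differential of \<open>\<kappa>\<close> sees only that
  component.\<close>

lemma derivative_zero_in_second_kind_coordinates:
  assumes c: "second_kind_coordinates \<Sigma> f \<nu> p V \<phi> e h"
    and pair: "principal_curvature_pair V F N \<kappa> \<kappa>h"
    and bdd: "gauss_curvature_bounded_near \<Sigma> f \<nu> p"
  shows "frechet_derivative \<kappa> (at 0) (second_kind_principal_vector F N e h \<kappa>h 0) = 0"
proof -
  interpret frame: adapted_frame V F N "\<lambda>q. vector [1, e (q$1)]" "\<lambda>q. axis 2 1" h 1
    by (rule second_kind_frame[OF c])
  obtain U where U: "open U" "0 \<in> U" "U \<subseteq> V" "bounded (gauss_curvature F N ` (U - singular_set V F))"
    using gauss_curvature_bounded_chart[OF bdd] by blast
  obtain k where "frechet_derivative \<kappa> (at 0) = (\<lambda>X. X$2 * k)"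
    using frame.gauss_curvature_extension[OF pair U] by metis
  moreover have "e 0 = 0" using c unfolding second_kind_coordinates_def Let_def by blast
  ultimately show ?thesis by (simp add: second_kind_principal_vector_def Let_def)
qed

end

theorem proposition4p4:
  fixes \<Sigma> :: "(real^2) set" and f \<nu> :: "real^2 \<Rightarrow> real^3" and p :: "real^2"
  assumes "open \<Sigma>" and "connected \<Sigma>"
    and "front \<Sigma> f \<nu>"
    and "p \<in> \<Sigma>" and "non_degenerate \<Sigma> f \<nu> p"
    and "gauss_curvature_bounded_near \<Sigma> f \<nu> p"
  shows "(cuspidal_edge \<Sigma> f p \<longrightarrow> (sub_parabolic \<Sigma> f \<nu> p \<longleftrightarrow> gauss_curvature_value \<Sigma> f \<nu> p = 0)) \<and>
         (second_kind \<Sigma> f \<nu> p \<longrightarrow> sub_parabolic \<Sigma> f \<nu> p)"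
proof (intro conjI impI)
  note bdd = assms(6)
  have chartI: "front_chart \<Sigma> f \<nu> p V \<phi>" if "coordinates_at \<Sigma> p V \<phi>" for V \<phi>
    using that assms by unfold_locales
  assume ce: "cuspidal_edge \<Sigma> f p"
  obtain V \<phi> g where c: "cuspidal_edge_coordinates \<Sigma> f \<nu> p V \<phi> g"
    using cuspidal_edge_coordinates_at_cuspidal_edge[OF ce assms(3,1)] .
  interpret front_chart \<Sigma> f \<nu> p V \<phi>
    by (rule chartI) (use c in \<open>simp add: cuspidal_edge_coordinates_def\<close>)
  interpret frame: adapted_frame V F N "\<lambda>q. axis 2 1" "\<lambda>q. axis 1 1" g "-1"
    by (rule cuspidal_edge_frame[OF c])
  have "norm (partial 1 F 0) = 1"
    using c origin unfolding cuspidal_edge_coordinates_def Let_def by auto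
  \<comment> \<open>This excludes the second-kind alternative in \<open>sub_parabolic\<close>, so
    the hypothesis there must come from edge coordinates.\<close>
  then have "first_kind \<Sigma> f \<nu> p"
    by (intro first_kindI frame.singular_axis assms) auto
  then have nsk: "\<not> second_kind \<Sigma> f \<nu> p" by (simp add: second_kind_def)
  show "sub_parabolic \<Sigma> f \<nu> p \<longleftrightarrow> gauss_curvature_value \<Sigma> f \<nu> p = 0"
  proof
    assume "sub_parabolic \<Sigma> f \<nu> p"
    \<comment> \<open>These coordinates are supplied by the hypothesis and may differ from the chart
      fixed above; the equivalence holds in them as well.\<close>
    then obtain V \<phi> g \<kappa> \<kappa>h where *: "cuspidal_edge_coordinates \<Sigma> f \<nu> p V \<phi> g"
      "principal_curvature_pair V (f \<circ> \<phi>) (\<nu> \<circ> \<phi>) \<kappa> \<kappa>h"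
      "frechet_derivative \<kappa> (at 0) (cuspidal_edge_principal_vector (f \<circ> \<phi>) (\<nu> \<circ> \<phi>) g \<kappa>h 0) = 0"
      using nsk unfolding sub_parabolic_def by blast
    have "front_chart \<Sigma> f \<nu> p V \<phi>"
      by (rule chartI) (use *(1) in \<open>simp add: cuspidal_edge_coordinates_def\<close>)
    from front_chart.sub_parabolic_iff_in_edge_coordinates[OF this *(1,2) bdd] *(3)
    show "gauss_curvature_value \<Sigma> f \<nu> p = 0" by simp
  next
    assume K: "gauss_curvature_value \<Sigma> f \<nu> p = 0"
    obtain V' \<kappa> \<kappa>h where V': "open V'" "0 \<in> V'" "V' \<subseteq> V" "principal_curvature_pair V' F N \<kappa> \<kappa>h"
      by (rule frame.principal_curvature_pair_exists)
    have c': "cuspidal_edge_coordinates \<Sigma> f \<nu> p V' \<phi> g"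
      by (rule cuspidal_edge_coordinates_restrict[OF c V'(1,3,2)])
    have "frechet_derivative \<kappa> (at 0) (cuspidal_edge_principal_vector F N g \<kappa>h 0) = 0"
      using front_chart.sub_parabolic_iff_in_edge_coordinates[OF front_chart_restrict[OF V'(1,3,2)] c' V'(4) bdd] K
      by (rule iffD2)
    with ce c' V'(4) show "sub_parabolic \<Sigma> f \<nu> p"
      unfolding sub_parabolic_def by (intro disjI2 conjI exI)
  qed
next
  assume sk: "second_kind \<Sigma> f \<nu> p"
  obtain V0 \<phi>0 where s: "front_chart \<Sigma> f \<nu> p V0 \<phi>0" "\<And>q. q \<in> V0 \<Longrightarrow> signed_area f \<nu> (\<phi>0 q) = q$2"
    by (rule straightened_chart[OF assms(3,1,5)]) (rule that)
  obtain V \<phi> e h where c: "second_kind_coordinates \<Sigma> f \<nu> p V \<phi> e h"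
    by (rule front_chart.second_kind_coordinates_exist[OF s sk])
  interpret front_chart \<Sigma> f \<nu> p V \<phi>
    using c assms by unfold_locales (simp_all add: second_kind_coordinates_def)
  interpret frame: adapted_frame V F N "\<lambda>q. vector [1, e (q$1)]" "\<lambda>q. axis 2 1" h 1
    by (rule second_kind_frame[OF c])
  obtain V' \<kappa> \<kappa>h where V': "open V'" "0 \<in> V'" "V' \<subseteq> V" "principal_curvature_pair V' F N \<kappa> \<kappa>h"
    by (rule frame.principal_curvature_pair_exists)
  have c': "second_kind_coordinates \<Sigma> f \<nu> p V' \<phi> e h"
    by (rule second_kind_coordinates_restrict[OF c V'(1,3,2)])
  from sk c' V'(4) front_chart.derivative_zero_in_second_kind_coordinates[OF front_chart_restrict[OF V'(1,3,2)] c' V'(4) assms(6)]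
  show "sub_parabolic \<Sigma> f \<nu> p"
    unfolding sub_parabolic_def by (intro disjI1 conjI exI)
qed

end
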